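(* In the setting described in the context, let $$\widehat{\mathcal P}=\begin{pmatrix} A_\gamma & B^T\\ 0 & -\widehat S\end{pmatrix}.$$ Then there is a constant $c>0$, independent of the mesh parameter $h$ and of the problem parameters $\nu$, $\gamma$, $\bm a$, such that $$\mu(\mathcal K\widehat{\mathcal P}^{-1})=\inf_{0\neq (v,q)\in\mathbb R^n\times\mathbb R^m}\frac{\left\langle\begin{pmatrix} I&0\\ BA_\gamma^{-1}& S\widehat S^{-1}\end{pmatrix}\begin{pmatrix} v \\ q \end{pmatrix},\begin{pmatrix} v \\ q \end{pmatrix}\right\rangle_{\mathcal M^{-1}}}{\left\langle\begin{pmatrix} v \\ q \end{pmatrix},\begin{pmatrix} v \\ q \end{pmatrix}\right\rangle_{\mathcal M^{-1}}}\ \ge\ c\,\nu(\nu+\gamma)$$ and $$\mu(\widehat{\mathcal P}\mathcal K^{-1})=\inf_{0\neq (v,q)\in\mathbb R^n\times\mathbb R^m}\frac{\left\langle\begin{pmatrix} I&0\\ -\widehat S S^{-1}BA_\gamma^{-1}& \widehat S S^{-1}\end{pmatrix}\begin{pmatrix} v \\ q \end{pmatrix},\begin{pmatrix} v \\ q \end{pmatrix}\right\rangle_{\mathcal M^{-1}}}{\left\langle\begin{pmatrix} v \\ q \end{pmatrix},\begin{pmatrix} v \\ q \end{pmatrix}\right\rangle_{\mathcal M^{-1}}}\ \ge\ \frac12 .$$ Consequently, there is a constant $\tilde c>0$, independent of $h$, $\nu$, $\gamma$, $\bm a$, such that for every right-hand side $b\in\mathbb R^{n+m}$ and every initial guess,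 the residuals $r_k$ of the GMRES method for $\mathcal K x=b$ with preconditioner $\widehat{\mathcal P}$ satisfy, for all $k\ge 0$, $$\|r_k\|_{\mathcal M^{-1}}\le\big(1-\tilde c\,\nu(\nu+\gamma)\big)^{k/2}\,\|r_0\|_{\mathcal M^{-1}} .$$
   Context: Domain and data. $\Omega\subset\mathbb R^d$, $d\in\{2,3\}$, is a bounded polygonal or polyhedral domain; $(\cdot,\cdot)$ and $\|\cdot\|$ are the $L^2(\Omega)$ inner product and norm. $\nu>0$ is the viscosity, $\gamma\ge 0$ the grad-div stabilization parameter, and $\bm a:\Omega\to\mathbb R^d$ a smooth divergence-free vector field. Standing assumptions: $\|\bm a\|_{L^\infty(\Omega)}=1$, and $\nu\le C_0$, $\gamma\le C_0\nu^{-1}$ for a fixed constant $C_0$. Finite element spaces. $\{\mathcal T_h\}_{h>0}$ is a quasi-uniform regular family of tessellations of $\Omega$. For a fixed degree $k$, $R_k(T)$ is $P_k(T)$ (polynomials of total degree at most $k$) if $T$ is a triangle or tetrahedron, and $Q_k(T)$ (tensor product polynomials of degree at most $k$) if $T$ is a quadrilateral or hexahedron. Set $\bm V_h=\{\bm v_h\in H^1_0(\Omega)^d:\bm v_h|_T\in R_k(T)^d\ \forall T\in\mathcal T_h\}$ and $Q_h=\{q_h\in L^2_0(\Omega): q_h|_T\in R_k(T)\ \forall T\in\mathcal T_h\}$, where $L^2_0(\Omega)$ denotes the mean-zero functions in $L^2(\Omega)$. Forms. $b(\bm v,q)=-(q,\operatorname{div}\bm v)$. $s(\cdot,\cdot)$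 is a symmetric positive semi-definite bilinear form on $L^2(\Omega)\times L^2(\Omega)$ (pressure stabilization) such that, for a constant $\delta_0>0$ independent of $h$, $$\sup_{0\ne\bm v_h\in\bm V_h}\frac{b(\bm v_h,q_h)}{\|\nabla\bm v_h\|}+s(q_h,q_h)^{1/2}\ge\delta_0\|q_h\|\qquad\forall q_h\in Q_h .$$ Matrices. Let $\{\psi_i\}_{i=1}^n$ and $\{\phi_i\}_{i=1}^m$ be bases of $\bm V_h$ and $Q_h$. Define $D_{ij}=(\nabla\psi_i,\nabla\psi_j)$, $N_{ij}=(\bm a\cdot\nabla\psi_j,\psi_i)$, $G_{ij}=(\operatorname{div}\psi_i,\operatorname{div}\psi_j)$ (all $n\times n$), $B\in\mathbb R^{m\times n}$ with $B_{ij}=-(\phi_i,\operatorname{div}\psi_j)$, $C\in\mathbb R^{m\times m}$ with $C_{ij}=(\nu+\gamma)^{-1}s(\phi_i,\phi_j)$, the pressure mass matrix $M\in\mathbb R^{m\times m}$ with $M_{ij}=(\phi_i,\phi_j)$, and $$A_\gamma=\nu D+N+\gamma G,\quad A_s=\tfrac12(A_\gamma+A_\gamma^T)=\nu D+\gamma G,\quad \mathcal K=\begin{pmatrix} A_\gamma & B^T \\ B & -C \end{pmatrix},$$ $$S=BA_\gamma^{-1}B^T+C,\quad \widehat S=(\nu+\gamma)^{-1}M+C,\quad \mathcal M=\begin{pmatrix} A_s & 0 \\ 0 & \widehat S \end{pmatrix}.$$ Notation. $\langle\cdot,\cdot\rangle$ is the Euclidean inner product; for a symmetric positive definite matrix $F$,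 $\langle x,y\rangle_F=\langle Fx,y\rangle$ and $\|x\|_F=\langle x,x\rangle_F^{1/2}$. For $\mathcal B\in\mathbb R^{(n+m)\times(n+m)}$, $$\mu(\mathcal B)=\inf_{0\ne z\in\mathbb R^{n+m}}\frac{\langle\mathcal Bz,z\rangle_{\mathcal M^{-1}}}{\langle z,z\rangle_{\mathcal M^{-1}}}.$$ GMRES. The (right-)preconditioned GMRES method with preconditioner $\widehat{\mathcal P}$ is understood with residual minimization in the $\mathcal M^{-1}$-norm: with $r_0=b-\mathcal Kx_0$, $\|r_k\|_{\mathcal M^{-1}}=\min\{\|p(\mathcal K\widehat{\mathcal P}^{-1})r_0\|_{\mathcal M^{-1}}: p \text{ a real polynomial of degree}\le k,\ p(0)=1\}$. "Independent of the problem parameters" means the constants may depend only on $\Omega$ (and $d$), $\delta_0$ and $C_0$. *)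

theory Defs
  imports
    "HOL-Probability.Essential_Supremum"
    "HOL-Computational_Algebra.Polynomial"
    "Jordan_Normal_Form.Gauss_Jordan_Elimination"
begin

(* Functions on \<Omega> live on real^'d (d is fixed throughout), whereas the matrices, whose size
   depends on the mesh, are Jordan_Normal_Form matrices.  "$" and "\<bullet>" refer to real^'d. *)
no_notation vec_index (infixl "$" 100)
no_notation scalar_prod (infix "\<bullet>" 70)

section \<open>Smooth functions, L2 and Sobolev spaces\<close>

(* Only used for open S. *)
primrec Ck_on :: "nat \<Rightarrow> (real^'d) set \<Rightarrow> (real^'d \<Rightarrow> 'b::real_normed_vector) \<Rightarrow> bool" where
  "Ck_on 0 S f \<longleftrightarrow> continuous_on S f"
| "Ck_on (Suc k) S f \<longleftrightarrow>
     (\<forall>x\<in>S. f differentiable (at x)) \<and>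
     (\<forall>i. Ck_on k S (\<lambda>x. frechet_derivative f (at x) (axis i 1)))"

definition smooth_on :: "(real^'d) set \<Rightarrow> (real^'d \<Rightarrow> 'b::real_normed_vector) \<Rightarrow> bool" where
  "smooth_on S f \<longleftrightarrow> (\<forall>k. Ck_on k S f)"

definition grad :: "(real^'d \<Rightarrow> real) \<Rightarrow> real^'d \<Rightarrow> real^'d" where
  "grad f x = (\<chi> i. frechet_derivative f (at x) (axis i 1))"

definition test_functions :: "(real^'d) set \<Rightarrow> (real^'d \<Rightarrow> real) set" where
  "test_functions \<Omega> =
     {f. smooth_on UNIV f \<and> (\<exists>K. compact K \<and> K \<subseteq> \<Omega> \<and> (\<forall>x. x \<notin> K \<longrightarrow> f x = 0))}"

(* Elements of L2 and of its subspaces are represented by functions; two representatives of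
   the same element agree almost everywhere on \<Omega>. *)
definition L2 :: "(real^'d) set \<Rightarrow> (real^'d \<Rightarrow> 'b::euclidean_space) set" where
  "L2 \<Omega> = {f. f \<in> borel_measurable (lebesgue_on \<Omega>) \<and>
              integrable (lebesgue_on \<Omega>) (\<lambda>x. (norm (f x))\<^sup>2)}"

definition l2_inner ::
  "(real^'d) set \<Rightarrow> (real^'d \<Rightarrow> 'b::euclidean_space) \<Rightarrow> (real^'d \<Rightarrow> 'b) \<Rightarrow> real" where
  "l2_inner \<Omega> f g = (LINT x|lebesgue_on \<Omega>. f x \<bullet> g x)"

definition l2_norm :: "(real^'d) set \<Rightarrow> (real^'d \<Rightarrow> 'b::euclidean_space) \<Rightarrow> real" where
  "l2_norm \<Omega> f = sqrt (l2_inner \<Omega> f f)"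

definition L2_mean_zero :: "(real^'d) set \<Rightarrow> (real^'d \<Rightarrow> real) set" where
  "L2_mean_zero \<Omega> = {q \<in> L2 \<Omega>. (LINT x|lebesgue_on \<Omega>. q x) = 0}"

definition is_weak_grad ::
  "(real^'d) set \<Rightarrow> (real^'d \<Rightarrow> real) \<Rightarrow> (real^'d \<Rightarrow> real^'d) \<Rightarrow> bool" where
  "is_weak_grad \<Omega> v g \<longleftrightarrow> g \<in> L2 \<Omega> \<and>
     (\<forall>f\<in>test_functions \<Omega>.
        (LINT x|lebesgue_on \<Omega>. v x *\<^sub>R grad f x) = - (LINT x|lebesgue_on \<Omega>. f x *\<^sub>R g x))"

definition H1 :: "(real^'d) set \<Rightarrow> (real^'d \<Rightarrow> real) set" where
  "H1 \<Omega> = {v \<in> L2 \<Omega>. \<exists>g. is_weak_grad \<Omega> v g}"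

(* Determined up to a null set for v in H1 \<Omega>. *)
definition weak_grad :: "(real^'d) set \<Rightarrow> (real^'d \<Rightarrow> real) \<Rightarrow> real^'d \<Rightarrow> real^'d" where
  "weak_grad \<Omega> v = (SOME g. is_weak_grad \<Omega> v g)"

(* The closure of the test functions in the H1 norm. *)
definition H10 :: "(real^'d) set \<Rightarrow> (real^'d \<Rightarrow> real) set" where
  "H10 \<Omega> = {v \<in> H1 \<Omega>. \<exists>f :: nat \<Rightarrow> real^'d \<Rightarrow> real.
      (\<forall>j. f j \<in> test_functions \<Omega>) \<and>
      (\<lambda>j. l2_norm \<Omega> (\<lambda>x. f j x - v x)) \<longlonglongrightarrow> 0 \<and>
      (\<lambda>j. l2_norm \<Omega> (\<lambda>x. grad (f j) x - weak_grad \<Omega> v x)) \<longlonglongrightarrow> 0}"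

(* Row i is the gradient of the i-th component; the inner product of real^'d^'d is the
   Frobenius product, so l2_inner of two such functions is the product of gradients. *)
definition vgrad :: "(real^'d) set \<Rightarrow> (real^'d \<Rightarrow> real^'d) \<Rightarrow> real^'d \<Rightarrow> real^'d^'d" where
  "vgrad \<Omega> v x = (\<chi> i. weak_grad \<Omega> (\<lambda>y. v y $ i) x)"

definition wdiv :: "(real^'d) set \<Rightarrow> (real^'d \<Rightarrow> real^'d) \<Rightarrow> real^'d \<Rightarrow> real" where
  "wdiv \<Omega> v x = (\<Sum>i\<in>UNIV. vgrad \<Omega> v x $ i $ i)"

section \<open>Domain, tessellations and finite element spaces\<close>

(* The boundary consists of finitely many segments (d = 2) or convex polygons (d = 3). *)
definition polyhedral_domain :: "(real^'d) set \<Rightarrow> bool" where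
  "polyhedral_domain \<Omega> \<longleftrightarrow>
     open \<Omega> \<and> connected \<Omega> \<and> bounded \<Omega> \<and> \<Omega> \<noteq> {} \<and>
     (\<exists>F. finite F \<and> (\<forall>S\<in>F. polytope S \<and> aff_dim S = int CARD('d) - 1) \<and>
          frontier \<Omega> = \<Union>F)"

definition poly_P :: "nat \<Rightarrow> (real^'d \<Rightarrow> real) set" where
  "poly_P k = {p. \<exists>c :: ('d \<Rightarrow> nat) \<Rightarrow> real. \<forall>x.
     p x = (\<Sum>e | (\<Sum>i\<in>UNIV. e i) \<le> k. c e * (\<Prod>i\<in>UNIV. (x $ i) ^ e i))}"

definition poly_Q :: "nat \<Rightarrow> (real^'d \<Rightarrow> real) set" where
  "poly_Q k = {p. \<exists>c :: ('d \<Rightarrow> nat) \<Rightarrow> real. \<forall>x.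
     p x = (\<Sum>e | \<forall>i. e i \<le> k. c e * (\<Prod>i\<in>UNIV. (x $ i) ^ e i))}"

(* F is a nondegenerate multilinear parametrization of T by the unit cube. *)
definition cube_chart :: "(real^'d) set \<Rightarrow> (real^'d \<Rightarrow> real^'d) \<Rightarrow> bool" where
  "cube_chart T F \<longleftrightarrow>
     (\<forall>i. (\<lambda>x. F x $ i) \<in> poly_Q 1) \<and> inj_on F (cbox 0 1) \<and> F ` cbox 0 1 = T \<and>
     (\<forall>x\<in>cbox 0 1. inj (frechet_derivative F (at x)))"

(* Triangles and tetrahedra. *)
definition simplicial_cell :: "(real^'d) set \<Rightarrow> bool" where
  "simplicial_cell T \<longleftrightarrow> int CARD('d) simplex T"

(* Convex quadrilaterals and (trilinear) hexahedra. *)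
definition cubical_cell :: "(real^'d) set \<Rightarrow> bool" where
  "cubical_cell T \<longleftrightarrow> (\<exists>F. cube_chart T F)"

(* Hanging nodes are not excluded. *)
definition tessellation :: "(real^'d) set \<Rightarrow> (real^'d) set set \<Rightarrow> bool" where
  "tessellation \<Omega> \<T> \<longleftrightarrow>
     finite \<T> \<and> (\<forall>T\<in>\<T>. simplicial_cell T \<or> cubical_cell T) \<and>
     \<Union>\<T> = closure \<Omega> \<and> (\<forall>T\<in>\<T>. interior T \<subseteq> \<Omega>) \<and>
     pairwise (\<lambda>T T'. interior T \<inter> interior T' = {}) \<T>"

(* The index set H of mesh sizes is a set of positive numbers: an upper bound for the ratio of
   h to the cell diameters cannot hold for arbitrarily large h on a bounded domain. *)
definition mesh_family :: "(real^'d) set \<Rightarrow> real set \<Rightarrow> (real \<Rightarrow> (real^'d) set set) \<Rightarrow> bool" where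
  "mesh_family \<Omega> H \<T> \<longleftrightarrow>
     (\<forall>h\<in>H. 0 < h \<and> tessellation \<Omega> (\<T> h) \<and> h = Max (diameter ` \<T> h)) \<and>
     (\<exists>\<sigma>>0. \<forall>h\<in>H. \<forall>T\<in>\<T> h. \<exists>x r. 0 < r \<and> ball x r \<subseteq> T \<and> diameter T \<le> \<sigma> * r) \<and>
     (\<exists>\<tau>>0. \<forall>h\<in>H. \<forall>T\<in>\<T> h. \<tau> * h \<le> diameter T)"

(* On a quadrilateral or hexahedron T there are two customary meanings of Q_k(T): the tensor
   product polynomials in the Cartesian coordinates, or those in the coordinates of the
   reference cube.  Both are covered by means of the flag "mapped". *)
definition local_space :: "bool \<Rightarrow> nat \<Rightarrow> (real^'d) set \<Rightarrow> (real^'d \<Rightarrow> real) set" where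
  "local_space mapped k T =
     (if simplicial_cell T then poly_P k
      else if mapped
        then {f. \<exists>F. cube_chart T F \<and> (\<exists>p\<in>poly_Q k. \<forall>x\<in>cbox 0 1. f (F x) = p x)}
        else poly_Q k)"

definition piecewise ::
  "bool \<Rightarrow> nat \<Rightarrow> (real^'d) set set \<Rightarrow> (real^'d \<Rightarrow> real) \<Rightarrow> bool" where
  "piecewise mapped k \<T> f \<longleftrightarrow>
     (\<forall>T\<in>\<T>. \<exists>p\<in>local_space mapped k T. AE x in lebesgue_on T. f x = p x)"

definition V_space ::
  "(real^'d) set \<Rightarrow> bool \<Rightarrow> nat \<Rightarrow> (real^'d) set set \<Rightarrow> (real^'d \<Rightarrow> real^'d) set" where
  "V_space \<Omega> mapped k \<T> =
     {v. \<forall>i. (\<lambda>x. v x $ i) \<in> H10 \<Omega> \<and> piecewise mapped k \<T> (\<lambda>x. v x $ i)}"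

definition Q_space ::
  "(real^'d) set \<Rightarrow> bool \<Rightarrow> nat \<Rightarrow> (real^'d) set set \<Rightarrow> (real^'d \<Rightarrow> real) set" where
  "Q_space \<Omega> mapped k \<T> = {q \<in> L2_mean_zero \<Omega>. piecewise mapped k \<T> q}"

definition is_basis ::
  "(real^'d) set \<Rightarrow> (real^'d \<Rightarrow> 'b::euclidean_space) set \<Rightarrow> nat \<Rightarrow>
     (nat \<Rightarrow> real^'d \<Rightarrow> 'b) \<Rightarrow> bool" where
  "is_basis \<Omega> V n \<psi> \<longleftrightarrow>
     (\<forall>i<n. \<psi> i \<in> V) \<and>
     (\<forall>c. (AE x in lebesgue_on \<Omega>. (\<Sum>i<n. c i *\<^sub>R \<psi> i x) = 0) \<longrightarrow> (\<forall>i<n. c i = 0)) \<and>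
     (\<forall>v\<in>V. \<exists>c. AE x in lebesgue_on \<Omega>. v x = (\<Sum>i<n. c i *\<^sub>R \<psi> i x))"

section \<open>Forms and data\<close>

definition b_form :: "(real^'d) set \<Rightarrow> (real^'d \<Rightarrow> real^'d) \<Rightarrow> (real^'d \<Rightarrow> real) \<Rightarrow> real" where
  "b_form \<Omega> v q = - l2_inner \<Omega> q (wdiv \<Omega> v)"

(* The second conjunct says that s is a form on L2 \<Omega> proper, i.e. on almost-everywhere classes. *)
definition psd_form ::
  "(real^'d) set \<Rightarrow> ((real^'d \<Rightarrow> real) \<Rightarrow> (real^'d \<Rightarrow> real) \<Rightarrow> real) \<Rightarrow> bool" where
  "psd_form \<Omega> s \<longleftrightarrow>
     (\<forall>f\<in>L2 \<Omega>. \<forall>g\<in>L2 \<Omega>. s f g = s g f \<and> 0 \<le> s f f) \<and>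
     (\<forall>f\<in>L2 \<Omega>. \<forall>f'\<in>L2 \<Omega>. \<forall>g\<in>L2 \<Omega>.
        (AE x in lebesgue_on \<Omega>. f x = f' x) \<longrightarrow> s f g = s f' g) \<and>
     (\<forall>f\<in>L2 \<Omega>. \<forall>f'\<in>L2 \<Omega>. \<forall>g\<in>L2 \<Omega>. \<forall>c.
        s (\<lambda>x. f x + f' x) g = s f g + s f' g \<and> s (\<lambda>x. c * f x) g = c * s f g)"

(* The supremum is taken in ereal, so that it has its usual meaning without any side
   condition. *)
definition inf_sup ::
  "(real^'d) set \<Rightarrow> (real^'d \<Rightarrow> real^'d) set \<Rightarrow> (real^'d \<Rightarrow> real) set \<Rightarrow>
     ((real^'d \<Rightarrow> real) \<Rightarrow> (real^'d \<Rightarrow> real) \<Rightarrow> real) \<Rightarrow> real \<Rightarrow> bool" where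
  "inf_sup \<Omega> V Q s \<delta> \<longleftrightarrow>
     (\<forall>q\<in>Q.
        (SUP v\<in>{v\<in>V. \<not> (AE x in lebesgue_on \<Omega>. v x = 0)}.
           ereal (b_form \<Omega> v q / l2_norm \<Omega> (vgrad \<Omega> v)))
        + ereal (sqrt (s q q)) \<ge> ereal (\<delta> * l2_norm \<Omega> q))"

definition convection_field :: "(real^'d) set \<Rightarrow> (real^'d \<Rightarrow> real^'d) \<Rightarrow> bool" where
  "convection_field \<Omega> a \<longleftrightarrow>
     smooth_on \<Omega> a \<and>
     (\<forall>x\<in>\<Omega>. (\<Sum>i\<in>UNIV. frechet_derivative a (at x) (axis i 1) $ i) = 0) \<and>
     esssup (lebesgue_on \<Omega>) (\<lambda>x. ereal (norm (a x))) = 1"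

section \<open>Matrices\<close>

definition D_mat :: "(real^'d) set \<Rightarrow> nat \<Rightarrow> (nat \<Rightarrow> real^'d \<Rightarrow> real^'d) \<Rightarrow> real mat" where
  "D_mat \<Omega> n \<psi> = Matrix.mat n n (\<lambda>(i,j). l2_inner \<Omega> (vgrad \<Omega> (\<psi> i)) (vgrad \<Omega> (\<psi> j)))"

definition N_mat ::
  "(real^'d) set \<Rightarrow> (real^'d \<Rightarrow> real^'d) \<Rightarrow> nat \<Rightarrow> (nat \<Rightarrow> real^'d \<Rightarrow> real^'d) \<Rightarrow> real mat" where
  "N_mat \<Omega> a n \<psi> =
     Matrix.mat n n (\<lambda>(i,j). l2_inner \<Omega> (\<lambda>x. vgrad \<Omega> (\<psi> j) x *v a x) (\<psi> i))"

definition G_mat :: "(real^'d) set \<Rightarrow> nat \<Rightarrow> (nat \<Rightarrow> real^'d \<Rightarrow> real^'d) \<Rightarrow> real mat" where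
  "G_mat \<Omega> n \<psi> = Matrix.mat n n (\<lambda>(i,j). l2_inner \<Omega> (wdiv \<Omega> (\<psi> i)) (wdiv \<Omega> (\<psi> j)))"

definition B_mat ::
  "(real^'d) set \<Rightarrow> nat \<Rightarrow> (nat \<Rightarrow> real^'d \<Rightarrow> real^'d) \<Rightarrow> nat \<Rightarrow> (nat \<Rightarrow> real^'d \<Rightarrow> real) \<Rightarrow> real mat"
  where
  "B_mat \<Omega> n \<psi> m \<phi> = Matrix.mat m n (\<lambda>(i,j). - l2_inner \<Omega> (\<phi> i) (wdiv \<Omega> (\<psi> j)))"

definition C_mat ::
  "real \<Rightarrow> real \<Rightarrow> ((real^'d \<Rightarrow> real) \<Rightarrow> (real^'d \<Rightarrow> real) \<Rightarrow> real) \<Rightarrow>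
     nat \<Rightarrow> (nat \<Rightarrow> real^'d \<Rightarrow> real) \<Rightarrow> real mat" where
  "C_mat \<nu> \<gamma> s m \<phi> = Matrix.mat m m (\<lambda>(i,j). (1 / (\<nu> + \<gamma>)) * s (\<phi> i) (\<phi> j))"

definition M_mat :: "(real^'d) set \<Rightarrow> nat \<Rightarrow> (nat \<Rightarrow> real^'d \<Rightarrow> real) \<Rightarrow> real mat" where
  "M_mat \<Omega> m \<phi> = Matrix.mat m m (\<lambda>(i,j). l2_inner \<Omega> (\<phi> i) (\<phi> j))"

(* Meaningful for invertible matrices only. *)
definition inv_mat :: "real mat \<Rightarrow> real mat" where
  "inv_mat A = the (mat_inverse A)"

section \<open>Weighted inner products, field of values and GMRES\<close>

definition ip :: "real mat \<Rightarrow> real vec \<Rightarrow> real vec \<Rightarrow> real" where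
  "ip F x y = scalar_prod (F *\<^sub>v x) y"

definition nrm :: "real mat \<Rightarrow> real vec \<Rightarrow> real" where
  "nrm F x = sqrt (ip F x x)"

(* W is the weight, i.e. the inverse of the block diagonal matrix in the intended use. *)
definition mu :: "real mat \<Rightarrow> real mat \<Rightarrow> real" where
  "mu W X = (INF z\<in>{z \<in> carrier_vec (dim_row X). z \<noteq> 0\<^sub>v (dim_row X)}.
               ip W (X *\<^sub>v z) z / ip W z z)"

definition poly_mat :: "real poly \<Rightarrow> real mat \<Rightarrow> real mat" where
  "poly_mat p X = Matrix.mat (dim_row X) (dim_row X)
     (\<lambda>(i,j). \<Sum>l\<le>degree p. coeff p l * (X ^\<^sub>m l) $$ (i,j))"

(* r is the sequence of residuals of right-preconditioned GMRES for K x = b with preconditioner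
   P and initial guess x0, minimizing in the W-norm. *)
definition gmres_residuals ::
  "real mat \<Rightarrow> real mat \<Rightarrow> real mat \<Rightarrow> real vec \<Rightarrow> real vec \<Rightarrow> (nat \<Rightarrow> real vec) \<Rightarrow> bool" where
  "gmres_residuals W K P b x0 r \<longleftrightarrow>
     r 0 = b - K *\<^sub>v x0 \<and>
     (\<forall>k. \<exists>p. degree p \<le> k \<and> poly p 0 = 1 \<and> r k = poly_mat p (K * inv_mat P) *\<^sub>v r 0 \<and>
        (\<forall>p'. degree p' \<le> k \<and> poly p' 0 = 1 \<longrightarrow>
           nrm W (r k) \<le> nrm W (poly_mat p' (K * inv_mat P) *\<^sub>v r 0)))"

end

theory Submission
  imports Defs "Jordan_Normal_Form.Determinant" "HOL-Real_Asymp.Real_Asymp"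
begin

no_notation vec_index (infixl "$" 100)
no_notation scalar_prod (infix "\<bullet>" 70)
notation scalar_prod (infixl \<open>\<bullet>\<^sub>v\<close> 70)
hide_const (open) Determinants.det

text \<open>
  In the coordinates \<open>(v, q) = (A\<^sub>s u, S' p)\<close> both fields of values become quadratic forms in \<open>u\<close>, \<open>p\<close>
  and one adjoint velocity \<open>w\<close> with \<open>A\<^sup>T w = B\<^sup>T y\<close>, where \<open>y = p\<close> for the first and
  \<open>S\<^sup>T y = q\<close> for the second. Young's inequality absorbs the mixed term. What is left for the first form is
  the bound \<open>\<nu> (\<nu> + \<gamma>) |p|\<^sup>2 \<lesssim> |w|\<^sup>2 + |p|\<^sup>2\<close> in the norms of \<open>S'\<close>, \<open>A\<^sub>s\<close> and \<open>C\<close>,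
  which is the inf-sup condition together with the Poincare bound for the convection term; for the second
  form it is duality with \<open>\<parallel>div w\<parallel> \<le> \<parallel>grad w\<parallel>\<close>. The two bounds show that the single
  step \<open>1 - x/2\<close> reduces the residual by the asserted factor.

  Analytically, all that is used about \<open>H10\<close> are identities that are bilinear in functions and gradients;
  they hold for compactly supported \<open>C\<^sup>1\<close> functions because integrals are translation invariant, and
  pass to limits in \<open>L\<^sup>2\<close>.
\<close>

section \<open>Multilinear charts of a cell\<close>

text \<open>The factor \<open>\<nu> * (\<nu> + \<gamma>)\<close> comes from convection. For
  \<open>A\<^sup>T w = B\<^sup>T p\<close> the inf-sup quotient at a velocity c is the
  \<open>A\<close>-form of c and w over the norm of grad c. Its convective part is only bounded by
  the two gradient norms, and measuring grad w in the \<open>A\<close>-energy costs a factor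
  1/\<nu>; the scaled mass matrix in the preconditioner accounts for \<nu> + \<gamma>. Convection is
  skew-symmetric, so it drops out of the symmetric part that defines the weight. Two gaps between
  functions and coefficient vectors shape the rest. The inf-sup condition speaks only of members of
  the pressure space, so combinations of basis pressures must be shown to be members; for mapped
  cells this is a statement about charts. And a velocity agrees with its basis expansion only almost
  everywhere, while \<open>weak_grad\<close> chooses a gradient for each representative separately,
  so gradients must be shown to be unique almost everywhere.\<close>

lemma poly_Q_add: "p \<in> poly_Q k \<Longrightarrow> q \<in> poly_Q k \<Longrightarrow> (\<lambda>x. p x + q x) \<in> poly_Q k"
proof -
  assume "p \<in> poly_Q k" "q \<in> poly_Q k"
  then obtain c c' where
    "\<And>x. p x = (\<Sum>e | \<forall>i. e i \<le> k. c e * (\<Prod>i\<in>UNIV. (x $ i) ^ e i))"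
    "\<And>x. q x = (\<Sum>e | \<forall>i. e i \<le> k. c' e * (\<Prod>i\<in>UNIV. (x $ i) ^ e i))"
    unfolding poly_Q_def by auto
  then show ?thesis
    unfolding poly_Q_def by (auto intro!: exI[of _ "\<lambda>e. c e + c' e"] simp: sum.distrib distrib_right)
qed

lemma poly_Q_cmult: "p \<in> poly_Q k \<Longrightarrow> (\<lambda>x. r * p x) \<in> poly_Q k"
proof -
  assume "p \<in> poly_Q k"
  then obtain c where "\<And>x. p x = (\<Sum>e | \<forall>i. e i \<le> k. c e * (\<Prod>i\<in>UNIV. (x $ i) ^ e i))"
    unfolding poly_Q_def by auto
  then show ?thesis
    unfolding poly_Q_def by (auto intro!: exI[of _ "\<lambda>e. r * c e"] simp: sum_distrib_left mult.assoc)
qed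

lemma poly_P_add: "p \<in> poly_P k \<Longrightarrow> q \<in> poly_P k \<Longrightarrow> (\<lambda>x. p x + q x) \<in> poly_P k"
proof -
  assume "p \<in> poly_P k" "q \<in> poly_P k"
  then obtain c c' where
    "\<And>x. p x = (\<Sum>e | (\<Sum>i\<in>UNIV. e i) \<le> k. c e * (\<Prod>i\<in>UNIV. (x $ i) ^ e i))"
    "\<And>x. q x = (\<Sum>e | (\<Sum>i\<in>UNIV. e i) \<le> k. c' e * (\<Prod>i\<in>UNIV. (x $ i) ^ e i))"
    unfolding poly_P_def by auto
  then show ?thesis
    unfolding poly_P_def by (auto intro!: exI[of _ "\<lambda>e. c e + c' e"] simp: sum.distrib distrib_right)
qed

lemma poly_P_cmult: "p \<in> poly_P k \<Longrightarrow> (\<lambda>x. r * p x) \<in> poly_P k"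
proof -
  assume "p \<in> poly_P k"
  then obtain c where "\<And>x. p x = (\<Sum>e | (\<Sum>i\<in>UNIV. e i) \<le> k. c e * (\<Prod>i\<in>UNIV. (x $ i) ^ e i))"
    unfolding poly_P_def by auto
  then show ?thesis
    unfolding poly_P_def by (auto intro!: exI[of _ "\<lambda>e. r * c e"] simp: sum_distrib_left mult.assoc)
qed

lemma finite_exponents: "finite {e :: 'd::finite \<Rightarrow> nat. \<forall>i. e i \<le> k}"
proof -
  have "{e :: 'd \<Rightarrow> nat. \<forall>i. e i \<le> k} = (UNIV :: 'd set) \<rightarrow>\<^sub>E {..k}"
    by (auto simp: PiE_UNIV_domain)
  then show ?thesis by (simp add: finite_PiE)
qed

lemma zero_in_poly_Q: "(\<lambda>x. 0) \<in> poly_Q k"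
  unfolding poly_Q_def by (auto intro!: exI[of _ "\<lambda>_. 0"])

lemma zero_in_poly_P: "(\<lambda>x. 0) \<in> poly_P k"
  unfolding poly_P_def by (auto intro!: exI[of _ "\<lambda>_. 0"])

lemma poly_Q_sum:
  "finite I \<Longrightarrow> (\<And>e. e \<in> I \<Longrightarrow> f e \<in> poly_Q k) \<Longrightarrow> (\<lambda>x. \<Sum>e\<in>I. f e x) \<in> poly_Q k"
  by (induction I rule: finite_induct) (auto intro: zero_in_poly_Q poly_Q_add)

text \<open>Padding each factor with zero coefficients up to degree k and multiplying out yields one
  monomial for every choice of a degree per coordinate, and these choices are the exponent functions
  of \<open>poly_Q\<close>.\<close>

lemma prod_poly_in_poly_Q:
  assumes "\<And>i. degree (q i) \<le> k"
  shows "(\<lambda>x :: real^'d. \<Prod>i\<in>UNIV. poly (q i) (x $ i)) \<in> poly_Q k"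
proof -
  have "poly (q i) t = (\<Sum>l\<in>{..k}. coeff (q i) l * t ^ l)" for i t
    unfolding poly_altdef by (rule sum.mono_neutral_left) (use assms in \<open>auto simp: coeff_eq_0\<close>)
  then have "(\<Prod>i\<in>UNIV. poly (q i) (x $ i)) =
      (\<Sum>e\<in>(UNIV :: 'd set) \<rightarrow>\<^sub>E {..k}. \<Prod>i\<in>UNIV. coeff (q i) (e i) * (x $ i) ^ e i)" for x
    by (simp add: prod_sum_PiE)
  moreover have "(UNIV :: 'd set) \<rightarrow>\<^sub>E {..k} = {e. \<forall>i. e i \<le> k}"
    by (auto simp: PiE_UNIV_domain)
  ultimately show ?thesis
    unfolding poly_Q_def
    by (auto intro!: exI[of _ "\<lambda>e. \<Prod>i\<in>UNIV. coeff (q i) (e i)"] simp: prod.distrib)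
qed

section \<open>Symmetries of the unit cube\<close>

definition cube_symmetry :: "('d \<Rightarrow> 'd) \<Rightarrow> ('d \<Rightarrow> bool) \<Rightarrow> real^'d \<Rightarrow> real^'d" where
  "cube_symmetry \<rho> s x = (\<chi> j. if s j then 1 - x $ \<rho> j else x $ \<rho> j)"

lemma cube_symmetry_in_cube: "x \<in> cbox 0 1 \<Longrightarrow> cube_symmetry \<rho> s x \<in> cbox 0 1"
  by (auto simp: cube_symmetry_def mem_box_cart)

text \<open>Each component of the symmetry is affine in a single coordinate. As
  \<open>\<rho>\<close> is bijective, every coordinate occurs in exactly one factor of a transformed
  monomial, so the degree in each coordinate stays at most k.\<close>

lemma poly_Q_cube_symmetry:
  fixes \<rho> :: "'d::finite \<Rightarrow> 'd"
  assumes "bij \<rho>" "p \<in> poly_Q k"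
  shows "(\<lambda>x. p (cube_symmetry \<rho> s x)) \<in> poly_Q k"
proof -
  obtain c where c: "\<And>x. p x = (\<Sum>e | \<forall>i. e i \<le> k. c e * (\<Prod>i\<in>UNIV. (x $ i) ^ e i))"
    using assms(2) unfolding poly_Q_def by auto
  have "(\<lambda>x. \<Prod>j\<in>UNIV. (cube_symmetry \<rho> s x $ j) ^ e j) \<in> poly_Q k" if e: "\<forall>i. e i \<le> k" for e
  proof -
    let ?q = "\<lambda>j. (if s j then [:1, -1:] else [:0, 1::real:]) ^ e j"
    have 1: "(\<Prod>j\<in>UNIV. (cube_symmetry \<rho> s x $ j) ^ e j) = (\<Prod>j\<in>UNIV. poly (?q j) (x $ \<rho> j))" for x
      by (rule prod.cong) (auto simp: cube_symmetry_def)
    have 2: "(\<Prod>j\<in>UNIV. poly (?q j) (x $ \<rho> j)) = (\<Prod>i\<in>UNIV. poly (?q (inv_into UNIV \<rho> i)) (x $ i))" for x :: "real^'d"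
      by (rule prod.reindex_bij_witness[of _ "inv_into UNIV \<rho>" \<rho>])
        (use assms(1) in \<open>auto simp: bij_is_surj surj_f_inv_f inv_f_f bij_is_inj\<close>)
    have eq: "(\<lambda>x. \<Prod>j\<in>UNIV. (cube_symmetry \<rho> s x $ j) ^ e j) =
        (\<lambda>x. \<Prod>i\<in>UNIV. poly (?q (inv_into UNIV \<rho> i)) (x $ i))"
      by (intro ext trans[OF 1 2])
    have "degree (?q j) \<le> k" for j
      by (rule order_trans[OF degree_power_le]) (use e in auto)
    then show ?thesis
      unfolding eq by (intro prod_poly_in_poly_Q)
  qed
  then show ?thesis
    unfolding c by (intro poly_Q_sum poly_Q_cmult finite_exponents) auto
qed

lemma poly_Q_differentiable:
  fixes x :: "real^'d"
  assumes "p \<in> poly_Q k"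
  shows "p differentiable (at x)"
proof -
  obtain c where c: "\<And>x. p x = (\<Sum>e | \<forall>i. e i \<le> k. c e * (\<Prod>i\<in>UNIV. (x $ i) ^ e i))"
    using assms unfolding poly_Q_def by auto
  have "((\<lambda>x. \<Prod>i\<in>I. (x $ i) ^ e i) :: real^'d \<Rightarrow> real) differentiable (at x)" if "finite I" for I e
    using that
  proof (induction I)
    case (insert i I)
    have "(\<lambda>x. x $ i) differentiable (at x)"
      by (intro bounded_linear_imp_differentiable bounded_linear_vec_nth)
    then show ?case using insert by (auto intro: differentiable_mult differentiable_power)
  qed simp
  then show ?thesis
    unfolding c[abs_def] by (auto intro!: differentiable_sum finite_exponents differentiable_mult)
qed

lemma cube_chart_has_derivative:
  assumes "cube_chart T F"
  shows "(F has_derivative frechet_derivative F (at x)) (at x within S)"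
proof -
  have "F differentiable (at x)"
    using assms poly_Q_differentiable
    by (subst differentiable_componentwise_within) (auto simp: cube_chart_def Basis_vec_def inner_axis)
  then show ?thesis
    using frechet_derivative_works has_derivative_at_withinI by blast
qed

text \<open>Each monomial contains the coordinate i to the power 0 or 1, so p is affine in it and is
  interpolated from the values 0 and 1 of that coordinate.\<close>

lemma poly_Q_1_affine:
  fixes x :: "real^'d"
  assumes "p \<in> poly_Q 1"
  shows "p x = (1 - x $ i) * p (\<chi> j. if j = i then 0 else x $ j) + x $ i * p (\<chi> j. if j = i then 1 else x $ j)"
proof -
  obtain c where c: "\<And>x. p x = (\<Sum>e | \<forall>i. e i \<le> 1. c e * (\<Prod>i\<in>UNIV. (x $ i) ^ e i))"
    using assms unfolding poly_Q_def by auto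
  have split: "(\<Prod>j\<in>UNIV. (y $ j) ^ e j) = (y $ i) ^ e i * (\<Prod>j\<in>UNIV - {i}. (y $ j) ^ e j)" for e and y :: "real^'d"
    by (simp add: prod.remove)
  have "(\<Prod>j\<in>UNIV. (x $ j) ^ e j) =
      (1 - x $ i) * (\<Prod>j\<in>UNIV. ((\<chi> j. if j = i then 0 else x $ j) $ j) ^ e j) +
      x $ i * (\<Prod>j\<in>UNIV. ((\<chi> j. if j = i then 1 else x $ j) $ j) ^ e j)" if "\<forall>i. e i \<le> 1" for e
  proof -
    have "e i = 0 \<or> e i = 1" using that by (meson le_Suc_eq le_zero_eq One_nat_def le_less less_one)
    moreover have "(\<Prod>j\<in>UNIV - {i}. ((\<chi> j. if j = i then r else x $ j) $ j) ^ e j) = (\<Prod>j\<in>UNIV - {i}. (x $ j) ^ e j)" for r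
      by (rule prod.cong) auto
    ultimately show ?thesis
      unfolding split by (auto simp: algebra_simps)
  qed
  then show ?thesis
    unfolding c[of x] c[of "\<chi> j. _ j"] sum_distrib_left sum.distrib[symmetric]
    by (intro sum.cong refl) (auto simp: mult.left_commute[of _ "c _"] distrib_left[symmetric])
qed

text \<open>Two multilinear charts are thus equal as soon as they agree at the vertices of the
  cube.\<close>

lemma poly_Q_1_eq_0:
  fixes p :: "real^'d \<Rightarrow> real"
  assumes p: "p \<in> poly_Q 1" and vert: "\<And>x. (\<And>i. x $ i = 0 \<or> x $ i = 1) \<Longrightarrow> p x = 0"
  shows "p x = 0"
proof -
  \<comment> \<open>\<open>I\<close> holds the coordinates not yet known to be 0 or 1; interpolation
    removes them one at a time.\<close>
  have "(\<forall>i. i \<notin> I \<longrightarrow> x $ i = 0 \<or> x $ i = 1) \<Longrightarrow> p x = 0" if "finite I" for I x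
    using that
  proof (induction I arbitrary: x)
    case empty
    then show ?case using vert[of x] by simp
  next
    case (insert i I)
    have "p (\<chi> j. if j = i then 0 else x $ j) = 0" "p (\<chi> j. if j = i then 1 else x $ j) = 0"
      using insert by auto
    then show ?case
      using poly_Q_1_affine[OF p, of x i] by simp
  qed
  from this[of UNIV x] show ?thesis by simp
qed

text \<open>The members of a mapped local space may use different charts of the cell, so that it is a linear
  space only because the chart is unique up to the symmetries of the cube. The invariant that
  identifies facets is the rank of the derivative of the transition map \<open>\<Phi>\<close>.\<close>

locale two_charts =
  fixes T :: "(real^'d) set" and F G :: "real^'d \<Rightarrow> real^'d"
  assumes F: "cube_chart T F" and G: "cube_chart T G"
begin

definition \<Phi> where "\<Phi> = inv_into (cbox 0 1) F \<circ> G"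

lemma charts: "inj_on F (cbox 0 1)" "F ` cbox 0 1 = T" "inj_on G (cbox 0 1)" "G ` cbox 0 1 = T"
  using F G by (auto simp: cube_chart_def)

lemma \<Phi>_in [simp]: "x \<in> cbox 0 1 \<Longrightarrow> \<Phi> x \<in> cbox 0 1"
  and F_\<Phi> [simp]: "x \<in> cbox 0 1 \<Longrightarrow> F (\<Phi> x) = G x"
proof -
  assume "x \<in> cbox 0 1"
  then have "G x \<in> F ` cbox 0 1" using charts by blast
  then show "\<Phi> x \<in> cbox 0 1" "F (\<Phi> x) = G x"
    by (auto simp: \<Phi>_def intro: inv_into_into f_inv_into_f simp del: image_iff)
qed

text \<open>Compactness of the cube makes the inverse of \<open>F\<close> continuous; with a left
  inverse \<open>H\<close> of the derivative of \<open>F\<close> it is then differentiable. All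
  derivatives are relative to the closed cube, since the points of interest lie on its
  boundary.\<close>

lemma \<Phi>_derivative:
  assumes x: "x \<in> cbox 0 1"
  obtains D where "(\<Phi> has_derivative D) (at x within cbox 0 1)" "surj D"
proof -
  let ?c = "cbox 0 1 :: (real^'d) set" and ?h = "inv_into (cbox 0 1) F"
  let ?DF = "frechet_derivative F (at (\<Phi> x))" and ?DG = "frechet_derivative G (at x)"
  have dF: "(F has_derivative ?DF) (at (\<Phi> x) within ?c)" and dG: "(G has_derivative ?DG) (at x within ?c)"
    using cube_chart_has_derivative[OF F] cube_chart_has_derivative[OF G] by auto
  have inj: "inj ?DF" "inj ?DG"
    using F G x by (auto simp: cube_chart_def)
  obtain H where H: "linear H" "H \<circ> ?DF = id"
    using linear_injective_left_inverse[OF has_derivative_linear[OF dF] inj(1)] by blast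
  have "continuous_on ?c F"
    by (rule has_derivative_continuous_on) (rule cube_chart_has_derivative[OF F])
  then have "continuous_on T ?h"
    unfolding charts(2)[symmetric]
    by (intro continuous_on_inv) (auto simp: charts(1))
  then have "continuous (at (F (\<Phi> x)) within F ` ?c) ?h"
    using x by (simp add: charts(2) continuous_on_eq_continuous_within) (use charts(4) in blast)
  then have "(?h has_derivative H) (at (F (\<Phi> x)) within F ` ?c)"
    by (intro has_derivative_inverse_within[OF dF _ _ H]) (auto simp: x charts(1))
  then have "(?h has_derivative H) (at (G x) within G ` ?c)"
    using x by (simp add: charts)
  then have "(\<Phi> has_derivative H \<circ> ?DG) (at x within ?c)"
    unfolding \<Phi>_def by (rule diff_chain_within[OF dG])
  moreover have "surj (H \<circ> ?DG)"
    using linear_injective_imp_surjective[OF has_derivative_linear[OF dG] inj(2)] H(2)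
    by (intro comp_surj) (auto simp: surj_def o_def id_def, metis)
  ultimately show thesis by (rule that)
qed

lemma continuous_\<Phi>: "continuous_on (cbox 0 1) \<Phi>"
  unfolding continuous_on_eq_continuous_within
  by (intro ballI, erule \<Phi>_derivative) (rule has_derivative_continuous)

text \<open>A component of \<open>\<Phi>\<close> with value 0 or 1 is extremal on the cube.\<close>

lemma \<Phi>_row_zero:
  assumes x: "x \<in> cbox 0 1" and D: "(\<Phi> has_derivative D) (at x within cbox 0 1)"
    and l: "0 < x $ l" "x $ l < 1" and j: "\<Phi> x $ j = 0 \<or> \<Phi> x $ j = 1"
  shows "D (axis l 1) $ j = 0"
proof -
  let ?c = "cbox 0 1 :: (real^'d) set"
  define r where "r = min (x $ l) (1 - x $ l)"
  have r: "0 < r" using l by (simp add: r_def)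
  have in_c: "x + t *\<^sub>R axis l 1 \<in> ?c" if "\<bar>t\<bar> < r" for t
    using x that by (auto simp: mem_box_cart r_def axis_def)
  let ?g = "\<lambda>t. x + t *\<^sub>R axis l (1::real)" and ?S = "{t. \<bar>t\<bar> < r}"
  have S: "open ?S" "0 \<in> ?S"
  proof -
    have "?S = ball 0 r" by (auto simp: dist_real_def)
    then show "open ?S" "0 \<in> ?S" using r by auto
  qed
  have "(?g has_derivative (\<lambda>t. t *\<^sub>R axis l 1)) (at 0 within ?S)"
    by (auto intro!: derivative_eq_intros)
  moreover have "(\<Phi> has_derivative D) (at (?g 0) within ?g ` ?S)"
    using has_derivative_subset[OF D, of "?g ` ?S"] in_c by auto
  ultimately have "(\<Phi> \<circ> ?g has_derivative D \<circ> (\<lambda>t. t *\<^sub>R axis l 1)) (at 0 within ?S)"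
    by (rule diff_chain_within)
  from bounded_linear.has_derivative[OF bounded_linear_vec_nth this, of j]
  have "((\<lambda>t. \<Phi> (?g t) $ j) has_derivative (\<lambda>t. D (t *\<^sub>R axis l 1) $ j)) (at 0)"
    by (simp add: at_within_open[OF S(2,1)])
  moreover have "D (t *\<^sub>R axis l 1) $ j = D (axis l 1) $ j * t" for t
    using linear_cmul[OF has_derivative_linear[OF D]] by simp
  ultimately have der: "DERIV (\<lambda>t. \<Phi> (?g t) $ j) 0 :> D (axis l 1) $ j"
    by (simp add: has_field_derivative_def)
  have bounds: "0 \<le> \<Phi> (?g t) $ j" "\<Phi> (?g t) $ j \<le> 1" if "\<bar>t\<bar> < r" for t
    using \<Phi>_in[OF in_c[OF that]] by (auto simp: mem_box_cart)
  from j show ?thesis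
  proof
    assume "\<Phi> x $ j = 0"
    with bounds show ?thesis by (intro DERIV_local_min[OF der r]) auto
  next
    assume "\<Phi> x $ j = 1"
    with bounds show ?thesis by (intro DERIV_local_max[OF der r]) auto
  qed
qed

text \<open>If all coordinates but i are interior, the rows of \<open>D\<close> that belong to
  extreme components vanish outside column i. Two such rows are linearly dependent, which
  contradicts the surjectivity of \<open>D\<close>.\<close>

lemma two_extreme_components:
  assumes x: "x \<in> cbox 0 1" and int: "\<And>l. l \<noteq> i \<Longrightarrow> 0 < x $ l \<and> x $ l < 1"
    and j: "\<Phi> x $ j = 0 \<or> \<Phi> x $ j = 1" and j': "\<Phi> x $ j' = 0 \<or> \<Phi> x $ j' = 1"
  shows "j = j'"
proof (rule ccontr)
  assume "j \<noteq> j'"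
  obtain D where D: "(\<Phi> has_derivative D) (at x within cbox 0 1)" "surj D"
    by (rule \<Phi>_derivative[OF x])
  have lin: "linear D" by (rule has_derivative_linear[OF D(1)])
  have comp: "D w $ a = w $ i * D (axis i 1) $ a" if "\<Phi> x $ a = 0 \<or> \<Phi> x $ a = 1" for w a
  proof -
    have "D w = D (\<Sum>l\<in>UNIV. w $ l *\<^sub>R axis l 1)"
      by (simp add: basis_expansion scalar_mult_eq_scaleR[symmetric])
    also have "\<dots> = (\<Sum>l\<in>UNIV. w $ l *\<^sub>R D (axis l 1))"
      by (simp add: linear_sum[OF lin] linear_cmul[OF lin])
    finally have "D w $ a = (\<Sum>l\<in>UNIV. w $ l * D (axis l 1) $ a)" by simp
    also have "\<dots> = (\<Sum>l\<in>{i}. w $ l * D (axis l 1) $ a)"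
      using \<Phi>_row_zero[OF x D(1) _ _ that] int by (intro sum.mono_neutral_right) auto
    finally show ?thesis by simp
  qed
  obtain w w' where w: "D w = axis j 1" "D w' = axis j' 1"
    using D(2) unfolding surj_def by metis
  have "w $ i * D (axis i 1) $ j = 1" "w $ i * D (axis i 1) $ j' = 0"
    "w' $ i * D (axis i 1) $ j' = 1"
    using comp[OF j, of w] comp[OF j', of w] comp[OF j', of w'] w \<open>j \<noteq> j'\<close> by (auto simp: axis_def)
  then show False by auto
qed

text \<open>Here not even one column is left, so an extreme component would give a zero row of the
  surjective \<open>D\<close>.\<close>

lemma no_extreme_component:
  assumes x: "x \<in> cbox 0 1" and int: "\<And>l. 0 < x $ l \<and> x $ l < 1"
  shows "0 < \<Phi> x $ j \<and> \<Phi> x $ j < 1"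
proof (rule ccontr)
  assume "\<not> ?thesis"
  then have j: "\<Phi> x $ j = 0 \<or> \<Phi> x $ j = 1"
    using \<Phi>_in[OF x] by (auto simp: mem_box_cart less_le)
  obtain D where D: "(\<Phi> has_derivative D) (at x within cbox 0 1)" "surj D"
    by (rule \<Phi>_derivative[OF x])
  have lin: "linear D" by (rule has_derivative_linear[OF D(1)])
  obtain w where w: "D w = axis j 1"
    using D(2) unfolding surj_def by metis
  have "D w = D (\<Sum>l\<in>UNIV. w $ l *\<^sub>R axis l 1)"
    by (simp add: basis_expansion scalar_mult_eq_scaleR[symmetric])
  also have "\<dots> = (\<Sum>l\<in>UNIV. w $ l *\<^sub>R D (axis l 1))"
    by (simp add: linear_sum[OF lin] linear_cmul[OF lin])
  finally have "D w $ j = (\<Sum>l\<in>UNIV. w $ l * D (axis l 1) $ j)" by simp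
  then show False
    using \<Phi>_row_zero[OF x D(1) _ _ j] int w by (simp add: axis_def)
qed

text \<open>On the relatively open facet \<open>S\<close> exactly one component is extreme: none is
  impossible since the inverse transition keeps interior points interior, and two are excluded by
  the rank. The facet is connected and splits into finitely many relatively closed pieces according
  to that component and its value, so there is only one piece. Continuity covers the rest of the
  facet.\<close>

lemma facet_to_facet:
  assumes \<epsilon>: "\<epsilon> = 0 \<or> \<epsilon> = 1"
  obtains j \<delta> where "\<delta> = 0 \<or> \<delta> = (1::real)"
    "\<And>x. x \<in> cbox 0 1 \<Longrightarrow> x $ i = \<epsilon> \<Longrightarrow> \<Phi> x $ j = \<delta>"
proof -
  interpret swap: two_charts T G F by unfold_locales (rule G F)+
  let ?c = "cbox 0 1 :: (real^'d) set"
  define S where "S = {x :: real^'d. x $ i = \<epsilon> \<and> (\<forall>l. l \<noteq> i \<longrightarrow> 0 < x $ l \<and> x $ l < 1)}"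
  have S_c: "S \<subseteq> ?c"
    using \<epsilon> by (auto simp: S_def mem_box_cart) (metis less_eq_real_def order_refl zero_le_one)+
  define m :: "real^'d" where "m = (\<chi> l. if l = i then \<epsilon> else 1 / 2)"
  have m: "m \<in> S" by (simp add: S_def m_def)
  have "convex S"
    unfolding convex_alt
  proof (intro ballI allI impI)
    fix x y and u :: real assume xy: "x \<in> S" "y \<in> S" and u: "0 \<le> u \<and> u \<le> 1"
    have "0 < (1 - u) * x $ l + u * y $ l \<and> (1 - u) * x $ l + u * y $ l < 1" if "l \<noteq> i" for l
    proof -
      have "0 < x $ l" "x $ l < 1" "0 < y $ l" "y $ l < 1" using xy that by (auto simp: S_def)
      then show ?thesis
        using u convex_bound_lt[of "x $ l" 1 "y $ l" "1 - u" u]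
          convex_bound_lt[of "- (x $ l)" 0 "- (y $ l)" "1 - u" u] by (simp add: algebra_simps)
    qed
    moreover have "(1 - u) * \<epsilon> + u * \<epsilon> = \<epsilon>" by (simp add: algebra_simps)
    ultimately show "(1 - u) *\<^sub>R x + u *\<^sub>R y \<in> S"
      using xy by (auto simp: S_def)
  qed
  then have conn: "connected S" by (rule convex_connected)
  have cont: "continuous_on S (\<lambda>x. \<Phi> x $ a)" for a
    by (intro continuous_on_component continuous_on_subset[OF continuous_\<Phi> S_c])
  have unique: "a = b" if "x \<in> S" "\<Phi> x $ a = 0 \<or> \<Phi> x $ a = 1" "\<Phi> x $ b = 0 \<or> \<Phi> x $ b = 1" for x a b
    using that S_c by (intro two_extreme_components[where i=i and x=x]) (auto simp: S_def)
  have ex: "\<exists>a. \<Phi> x $ a = 0 \<or> \<Phi> x $ a = 1" if x: "x \<in> S" for x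
  proof (rule ccontr)
    assume "\<not> ?thesis"
    then have "0 < \<Phi> x $ a \<and> \<Phi> x $ a < 1" for a
      using \<Phi>_in[of x] x S_c by (auto simp: mem_box_cart less_le)
    then have *: "0 < swap.\<Phi> (\<Phi> x) $ i \<and> swap.\<Phi> (\<Phi> x) $ i < 1"
      using x S_c by (intro swap.no_extreme_component) auto
    have xc: "x \<in> ?c" using x S_c by blast
    have "swap.\<Phi> (\<Phi> x) = x"
      by (rule inj_onD[OF charts(3)]) (simp_all add: xc)
    with *  show False using x \<epsilon> by (auto simp: S_def)
  qed
  obtain j where j: "\<Phi> m $ j = 0 \<or> \<Phi> m $ j = 1" using ex[OF m] by blast
  define \<delta> where "\<delta> = \<Phi> m $ j"
  have \<delta>: "\<delta> = 0 \<or> \<delta> = 1" using j by (simp add: \<delta>_def)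
  \<comment> \<open>The other pairs of component and value; the pieces that they define make up the
    complement of \<open>?U\<close> in \<open>S\<close>.\<close>
  let ?I = "UNIV \<times> {0, 1} - {(j, \<delta>)} :: ('d \<times> real) set"
  let ?U = "S \<inter> (\<lambda>x. \<Phi> x $ j) -` {\<delta>}"
  have "closedin (top_of_set S) ?U"
    by (intro continuous_closedin_preimage cont) auto
  moreover have "openin (top_of_set S) ?U"
  proof -
    have "S - ?U = (\<Union>(a, d)\<in>?I. S \<inter> (\<lambda>x. \<Phi> x $ a) -` {d})"
      using ex unique \<delta> by fastforce
    moreover have "closedin (top_of_set S) (\<Union>(a, d)\<in>?I. S \<inter> (\<lambda>x. \<Phi> x $ a) -` {d})"
      by (rule closedin_Union) (auto intro!: continuous_closedin_preimage cont)
    ultimately show ?thesis by (simp add: openin_closedin_eq)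
  qed
  ultimately have "?U = S"
    using conn m by (auto simp: connected_clopen \<delta>_def)
  then have on_S: "\<Phi> x $ j = \<delta>" if "x \<in> S" for x using that by auto
  have "\<Phi> x $ j = \<delta>" if x: "x \<in> ?c" "x $ i = \<epsilon>" for x
  proof -
    \<comment> \<open>The half-open segment from the centre of the facet towards x lies in
      \<open>S\<close>, so x is a limit of points where the value is known.\<close>
    let ?g = "\<lambda>t. (1 - t) *\<^sub>R x + t *\<^sub>R m"
    have g_S: "?g t \<in> S" if "0 < t" "t \<le> 1" for t
    proof -
      have "0 < (1 - t) * x $ l + t * (1 / 2) \<and> (1 - t) * x $ l + t * (1 / 2) < 1" for l
      proof -
        have "0 \<le> (1 - t) * x $ l" "(1 - t) * x $ l \<le> (1 - t) * 1"
          using x that by (intro mult_left_mono mult_nonneg_nonneg; simp add: mem_box_cart)+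
        then show ?thesis using that by auto
      qed
      moreover have "(1 - t) * \<epsilon> + t * \<epsilon> = \<epsilon>" by (simp add: algebra_simps)
      ultimately show ?thesis using x by (simp add: S_def m_def)
    qed
    have "continuous_on {0..1} (\<lambda>t. \<Phi> (?g t) $ j)"
    proof (intro continuous_on_component continuous_on_compose2[OF continuous_\<Phi>] continuous_intros)
      show "?g ` {0..1} \<subseteq> ?c"
        using x m S_c convex_box(1)[of "0::real^'d" 1] by (auto simp: convex_alt)
    qed
    then have "continuous_on (closure {0<..<1}) (\<lambda>t. \<Phi> (?g t) $ j)" by simp
    moreover have "\<Phi> (?g t) $ j = \<delta>" if "t \<in> {0<..<1}" for t
      using that by (intro on_S g_S) auto
    ultimately have "\<Phi> (?g 0) $ j = \<delta>"
      by (rule continuous_constant_on_closure) auto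
    then show ?thesis by simp
  qed
  with \<delta> show thesis by (rule that)
qed

text \<open>The transition map permutes the facets and maps opposite ones to opposite ones, which
  prescribes its value at each vertex as that of a cube symmetry. Both \<open>G\<close> and
  \<open>F\<close> composed with this symmetry are multilinear, so agreement at the vertices is
  agreement everywhere.\<close>

lemma chart_unique:
  obtains \<rho> s where "bij \<rho>" "\<And>x. G x = F (cube_symmetry \<rho> s x)"
proof -
  interpret swap: two_charts T G F by unfold_locales (rule G F)+
  let ?c = "cbox 0 1 :: (real^'d) set" and ?b = "\<lambda>e. of_bool e :: real"
  have swap_\<Phi>: "swap.\<Phi> (\<Phi> x) = x" "\<Phi> (swap.\<Phi> x) = x" if "x \<in> ?c" for x
    by (rule inj_onD[OF charts(3)] inj_onD[OF charts(1)]; simp add: that)+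
  have facet: "\<exists>j d. \<forall>x\<in>?c. x $ i = ?b e \<longrightarrow> \<Phi> x $ j = ?b d" for i e
  proof -
    obtain j \<delta> where "\<delta> = 0 \<or> \<delta> = (1::real)" "\<And>x. x \<in> ?c \<Longrightarrow> x $ i = ?b e \<Longrightarrow> \<Phi> x $ j = \<delta>"
      by (rule facet_to_facet[of "?b e" i]) auto
    then show ?thesis
      by (intro exI[of _ j] exI[of _ "\<delta> = 1"]) auto
  qed
  then obtain r \<delta> where r: "\<And>i e x. x \<in> ?c \<Longrightarrow> x $ i = ?b e \<Longrightarrow> \<Phi> x $ r i e = ?b (\<delta> i e)"
    by metis
  have facet': "\<exists>j d. \<forall>x\<in>?c. x $ i = ?b e \<longrightarrow> swap.\<Phi> x $ j = ?b d" for i e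
  proof -
    obtain j \<delta> where "\<delta> = 0 \<or> \<delta> = (1::real)" "\<And>x. x \<in> ?c \<Longrightarrow> x $ i = ?b e \<Longrightarrow> swap.\<Phi> x $ j = \<delta>"
      by (rule swap.facet_to_facet[of "?b e" i]) auto
    then show ?thesis
      by (intro exI[of _ j] exI[of _ "\<delta> = 1"]) auto
  qed
  have same: "i = i' \<and> e = e'" if sub: "\<And>x. x \<in> ?c \<Longrightarrow> x $ i = ?b e \<Longrightarrow> x $ i' = ?b e'" for i i' e e'
  proof -
    \<comment> \<open>A point of the facet (i, e) whose other coordinates all avoid the value of e',
      so a facet lies in no other facet.\<close>
    define y :: "real^'d" where "y = (\<chi> l. if l = i then ?b e else ?b (\<not> e'))"
    have "y \<in> ?c" by (auto simp: y_def mem_box_cart)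
    then have "y $ i' = ?b e'" by (intro sub) (simp_all add: y_def)
    then show ?thesis by (cases e'; cases e) (auto simp: y_def split: if_splits)
  qed
  \<comment> \<open>The inverse transition takes the image facet into some facet, which contains the
    original one and is therefore equal to it by \<open>same\<close>.\<close>
  have pull: "x $ i = ?b e" if x: "x \<in> ?c" "\<Phi> x $ r i e = ?b (\<delta> i e)" for x i e
  proof -
    obtain i' e' where ie: "\<And>x. x \<in> ?c \<Longrightarrow> x $ r i e = ?b (\<delta> i e) \<Longrightarrow> swap.\<Phi> x $ i' = ?b e'"
      using facet' by metis
    then have "y $ i' = ?b e'" if "y \<in> ?c" "y $ i = ?b e" for y
      using ie[of "\<Phi> y"] r[of y i e] that swap_\<Phi>(1) by simp
    then have "i = i' \<and> e = e'" by (rule same)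
    then show ?thesis using ie[of "\<Phi> x"] x swap_\<Phi>(1) by simp
  qed
  have inj: "i = i' \<and> e = e'" if "r i e = r i' e'" "\<delta> i e = \<delta> i' e'" for i i' e e'
  proof (rule same)
    fix x assume "x \<in> ?c" "x $ i = ?b e"
    then show "x $ i' = ?b e'"
      using r[of x i e] pull[of x i' e'] that by simp
  qed
  \<comment> \<open>Facets in different directions meet, whereas the facets for the values 0 and 1
    of one coordinate do not.\<close>
  have opposite: "r i True = r i False" for i
  proof (rule ccontr)
    assume ne: "r i True \<noteq> r i False"
    define y :: "real^'d" where "y = (\<chi> l. if l = r i True then ?b (\<delta> i True) else ?b (\<delta> i False))"
    have y: "y \<in> ?c" by (auto simp: y_def mem_box_cart)
    have "y $ r i True = ?b (\<delta> i True)" "y $ r i False = ?b (\<delta> i False)"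
      using ne by (auto simp: y_def)
    then have "swap.\<Phi> y $ i = ?b True" "swap.\<Phi> y $ i = ?b False"
      using pull[OF swap.\<Phi>_in[OF y], of i True] pull[OF swap.\<Phi>_in[OF y], of i False]
      unfolding swap_\<Phi>(2)[OF y] by blast+
    then show False by simp
  qed
  define \<pi> where "\<pi> i = r i False" for i
  define s where "s i = \<delta> i False" for i
  have r_\<pi>: "r i e = \<pi> i" for i e using opposite by (cases e) (auto simp: \<pi>_def)
  have \<delta>_s: "\<delta> i e = (s i \<noteq> e)" for i e
    using inj[of i True i False] by (cases e) (auto simp: s_def r_\<pi>)
  have "inj \<pi>"
  proof (rule injI)
    fix i i' assume "\<pi> i = \<pi> i'"
    then show "i = i'"
      using inj[of i False i' "s i \<noteq> s i'"] by (auto simp: r_\<pi> \<delta>_s)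
  qed
  then have "bij \<pi>" by (simp add: bij_def finite_UNIV_inj_surj)
  define \<rho> where "\<rho> = inv_into UNIV \<pi>"
  have \<rho>: "bij \<rho>" "\<pi> (\<rho> j) = j" for j
    using \<open>bij \<pi>\<close> by (auto simp: \<rho>_def bij_imp_bij_inv bij_is_surj surj_f_inv_f)
  have vert: "G x = F (cube_symmetry \<rho> (s \<circ> \<rho>) x)" if x: "\<And>i. x $ i = 0 \<or> x $ i = 1" for x
  proof -
    have xc: "x \<in> ?c" unfolding mem_box_cart using x by (metis order_refl zero_le_one zero_index one_index)
    have *: "\<Phi> x $ \<pi> i = (if s i then 1 - x $ i else x $ i)" for i
      using r[OF xc, of i "x $ i = 1"] x[of i] by (auto simp: r_\<pi> \<delta>_s)
    then have "\<Phi> x = cube_symmetry \<rho> (s \<circ> \<rho>) x"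
      using *[of "\<rho> _"] unfolding \<rho>(2) by (simp add: Finite_Cartesian_Product.vec_eq_iff cube_symmetry_def)
    then show ?thesis using F_\<Phi>[OF xc] by simp
  qed
  have "G x $ a + (-1) * F (cube_symmetry \<rho> (s \<circ> \<rho>) x) $ a = 0" for x a
  proof (rule poly_Q_1_eq_0[where p="\<lambda>x. G x $ a + (-1) * F (cube_symmetry \<rho> (s \<circ> \<rho>) x) $ a"])
    have "(\<lambda>x. G x $ a) \<in> poly_Q 1" "(\<lambda>x. F x $ a) \<in> poly_Q 1"
      using F G by (auto simp: cube_chart_def)
    then show "(\<lambda>x. G x $ a + (-1) * F (cube_symmetry \<rho> (s \<circ> \<rho>) x) $ a) \<in> poly_Q 1"
      by (rule poly_Q_add[OF _ poly_Q_cmult[OF poly_Q_cube_symmetry[OF \<rho>(1)]]])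
  qed (simp add: vert)
  then have "G x = F (cube_symmetry \<rho> (s \<circ> \<rho>) x)" for x
    by (simp add: Finite_Cartesian_Product.vec_eq_iff)
  with \<rho>(1) show thesis by (rule that)
qed

end

section \<open>The pressure space is a linear space\<close>

text \<open>In the mapped case the chart \<open>F\<close> of f is the chart \<open>G\<close> of g
  after a cube symmetry, so g pulled back by \<open>F\<close> is still a tensor product
  polynomial.\<close>

lemma local_space_linear:
  assumes f: "f \<in> local_space mapped k T" and g: "g \<in> local_space mapped k T"
  shows "(\<lambda>x. f x + r * g x) \<in> local_space mapped k T"
proof (cases "simplicial_cell T \<or> \<not> mapped")
  case True
  then show ?thesis
    using assms by (auto simp: local_space_def intro!: poly_P_add poly_P_cmult poly_Q_add poly_Q_cmult)
next
  case False
  then obtain F p G q where Fp: "cube_chart T F" "p \<in> poly_Q k" "\<And>x. x \<in> cbox 0 1 \<Longrightarrow> f (F x) = p x"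
    and Gq: "cube_chart T G" "q \<in> poly_Q k" "\<And>x. x \<in> cbox 0 1 \<Longrightarrow> g (G x) = q x"
    using assms by (auto simp: local_space_def)
  interpret two_charts T G F by unfold_locales (rule Fp Gq)+
  obtain \<rho> s where \<rho>: "bij \<rho>" "\<And>x. F x = G (cube_symmetry \<rho> s x)" using chart_unique by blast
  have pq: "(\<lambda>x. p x + r * q (cube_symmetry \<rho> s x)) \<in> poly_Q k"
    by (intro poly_Q_add poly_Q_cmult poly_Q_cube_symmetry Fp(2) Gq(2) \<rho>(1))
  have "f (F x) + r * g (F x) = p x + r * q (cube_symmetry \<rho> s x)" if "x \<in> cbox 0 1" for x
    using Fp(3)[OF that] Gq(3)[OF cube_symmetry_in_cube[OF that]] by (simp add: \<rho>(2))
  then have "\<exists>F. cube_chart T F \<and> (\<exists>p\<in>poly_Q k. \<forall>x\<in>cbox 0 1. f (F x) + r * g (F x) = p x)"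
    by (intro exI[of _ F] conjI Fp(1) bexI[OF _ pq] ballI)
  then show ?thesis
    using False by (simp add: local_space_def)
qed

lemma zero_in_local_space:
  assumes "simplicial_cell T \<or> cubical_cell T"
  shows "(\<lambda>x. 0) \<in> local_space mapped k T"
  using assms zero_in_poly_Q
  by (auto simp: local_space_def cubical_cell_def intro: zero_in_poly_P zero_in_poly_Q)

lemma piecewise_sum:
  fixes m :: nat
  assumes "tessellation \<Omega> \<T>" and f: "\<And>i. i < m \<Longrightarrow> piecewise mapped k \<T> (f i)"
  shows "piecewise mapped k \<T> (\<lambda>x. \<Sum>i<m. c i * f i x)"
  using f
proof (induction m)
  case 0
  then show ?case
    using assms(1) zero_in_local_space
    by (auto simp: piecewise_def tessellation_def intro!: bexI[of _ "\<lambda>x. 0"])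
next
  case (Suc m)
  show ?case
    unfolding piecewise_def
  proof
    fix T assume "T \<in> \<T>"
    moreover have "piecewise mapped k \<T> (\<lambda>x. \<Sum>i<m. c i * f i x)" "piecewise mapped k \<T> (f m)"
      using Suc by auto
    ultimately obtain p q where "p \<in> local_space mapped k T" "q \<in> local_space mapped k T"
      and pq: "AE x in lebesgue_on T. (\<Sum>i<m. c i * f i x) = p x" "AE x in lebesgue_on T. f m x = q x"
      unfolding piecewise_def by blast
    moreover from pq have "AE x in lebesgue_on T. (\<Sum>i<Suc m. c i * f i x) = p x + c m * q x"
      by eventually_elim simp
    ultimately show "\<exists>p\<in>local_space mapped k T. AE x in lebesgue_on T. (\<Sum>i<Suc m. c i * f i x) = p x"
      by (intro bexI[of _ "\<lambda>x. p x + c m * q x"] local_space_linear)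
  qed
qed

section \<open>Continuously differentiable functions with compact support\<close>

definition C1_on :: "(real^'d) set \<Rightarrow> (real^'d \<Rightarrow> real) \<Rightarrow> bool" where
  "C1_on S f \<longleftrightarrow> (\<forall>x\<in>S. f differentiable (at x)) \<and> (\<forall>i. continuous_on S (\<lambda>x. grad f x $ i))"

text \<open>Test functions lie in this class, and it absorbs products with weights that are
  \<open>C1_on\<close> the domain only, such as the components of the convection field.\<close>

definition C1c :: "(real^'d) set \<Rightarrow> (real^'d \<Rightarrow> real) \<Rightarrow> bool" where
  "C1c \<Omega> f \<longleftrightarrow> C1_on UNIV f \<and> (\<exists>K. compact K \<and> K \<subseteq> \<Omega> \<and> (\<forall>x. x \<notin> K \<longrightarrow> f x = 0))"

lemma grad_eq: "(f has_derivative D) (at x) \<Longrightarrow> grad f x $ i = D (axis i 1)"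
  by (simp add: grad_def frechet_derivative_at[symmetric])

lemma grad_add:
  assumes "f differentiable (at x)" "g differentiable (at x)"
  shows "grad (\<lambda>x. f x + g x) x $ i = grad f x $ i + grad g x $ i"
  using grad_eq[OF has_derivative_add[OF assms[unfolded frechet_derivative_works]], of i]
  by (simp add: grad_def)

lemma grad_mult:
  assumes "f differentiable (at x)" "g differentiable (at x)"
  shows "grad (\<lambda>x. f x * g x) x $ i = f x * grad g x $ i + grad f x $ i * g x"
  using grad_eq[OF has_derivative_mult[OF assms[unfolded frechet_derivative_works]], of i]
  by (simp add: grad_def)

lemma grad_cmult:
  "f differentiable (at x) \<Longrightarrow> grad (\<lambda>x. r * f x) x $ i = r * grad f x $ i"
  using grad_eq[OF has_derivative_mult_right[of f "frechet_derivative f (at x)" "at x" r], of i]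
  by (simp add: grad_def frechet_derivative_works)

lemma grad_transform:
  assumes "f differentiable (at x)" "open S" "x \<in> S" "\<And>y. y \<in> S \<Longrightarrow> f y = g y"
  shows "g differentiable (at x)" "grad g x = grad f x"
proof -
  have "(g has_derivative frechet_derivative f (at x)) (at x)"
    using assms by (auto intro: has_derivative_transform_within_open simp: frechet_derivative_works)
  then show "g differentiable (at x)" "grad g x = grad f x"
    by (auto simp: differentiable_def Finite_Cartesian_Product.vec_eq_iff grad_eq) (simp add: grad_def)
qed

lemma grad_zero: "grad (\<lambda>x. 0) x = 0"
  by (simp add: grad_def Finite_Cartesian_Product.vec_eq_iff)

lemma C1_on_continuous: "C1_on S f \<Longrightarrow> continuous_on S f"
  unfolding C1_on_def
  by (meson continuous_at_imp_continuous_on differentiable_imp_continuous_within)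

lemma C1_on_add: "C1_on S f \<Longrightarrow> C1_on S g \<Longrightarrow> C1_on S (\<lambda>x. f x + g x)"
  unfolding C1_on_def
  by (auto simp: grad_add intro!: continuous_on_add differentiable_add
    intro: continuous_on_eq[where f="\<lambda>x. grad f x $ _ + grad g x $ _"])

lemma C1_on_mult:
  assumes "C1_on S f" "C1_on S g"
  shows "C1_on S (\<lambda>x. f x * g x)"
proof -
  have "continuous_on S (\<lambda>x. f x * grad g x $ i + grad f x $ i * g x)" for i
    using assms assms[THEN C1_on_continuous] unfolding C1_on_def by (intro continuous_on_add continuous_on_mult) auto
  then have "continuous_on S (\<lambda>x. grad (\<lambda>x. f x * g x) x $ i)" for i
    by (rule continuous_on_eq) (use assms in \<open>auto simp: C1_on_def grad_mult\<close>)
  then show ?thesis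
    using assms by (auto simp: C1_on_def)
qed

lemma C1_on_const: "C1_on S (\<lambda>x. r)"
  by (auto simp: C1_on_def grad_def)

lemma C1_on_subset: "C1_on S f \<Longrightarrow> T \<subseteq> S \<Longrightarrow> C1_on T f"
  unfolding C1_on_def by (meson continuous_on_subset subsetD)

lemma C1c_mono: "C1c \<Omega> f \<Longrightarrow> \<Omega> \<subseteq> \<Omega>' \<Longrightarrow> C1c \<Omega>' f"
  unfolding C1c_def by blast

lemma C1c_support:
  assumes "C1c \<Omega> f"
  obtains K where "compact K" "K \<subseteq> \<Omega>" "\<And>x. x \<notin> K \<Longrightarrow> f x = 0" "\<And>x. x \<notin> K \<Longrightarrow> grad f x = 0"
proof -
  obtain K where K: "compact K" "K \<subseteq> \<Omega>" "\<And>x. x \<notin> K \<Longrightarrow> f x = 0"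
    using assms unfolding C1c_def by blast
  have "grad f x = 0" if "x \<notin> K" for x
    using grad_transform(2)[of "\<lambda>x. 0" x "- K" f] that K compact_imp_closed[OF K(1)]
    by (auto simp: grad_zero)
  with K that show thesis by blast
qed

lemma C1c_differentiable: "C1c \<Omega> f \<Longrightarrow> f differentiable (at x)"
  by (simp add: C1c_def C1_on_def)

lemma C1c_continuous: "C1c \<Omega> f \<Longrightarrow> continuous_on UNIV f"
  and C1c_continuous_grad: "C1c \<Omega> f \<Longrightarrow> continuous_on UNIV (\<lambda>x. grad f x $ i)"
  by (auto simp: C1c_def C1_on_continuous) (simp add: C1_on_def)

text \<open>Nothing is known about the weight outside \<open>\<Omega>\<close>. The open sets
  \<open>\<Omega>\<close> and the complement of the support cover the space, and the product is 0 on
  the second one.\<close>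

lemma C1c_mult_weight:
  assumes \<Omega>: "open \<Omega>" and w: "C1_on \<Omega> w" and f: "C1c \<Omega> f"
  shows "C1c \<Omega> (\<lambda>x. w x * f x)"
proof -
  obtain K where K: "compact K" "K \<subseteq> \<Omega>" "\<And>x. x \<notin> K \<Longrightarrow> f x = 0"
    using C1c_support[OF f] by metis
  have op: "open (- K)" using compact_imp_closed[OF K(1)] by auto
  have wf: "C1_on \<Omega> (\<lambda>x. w x * f x)"
    using f by (intro C1_on_mult w) (auto simp: C1c_def intro: C1_on_subset)
  have out: "(\<lambda>x. w x * f x) differentiable (at x)" "grad (\<lambda>x. w x * f x) x = 0" if "x \<notin> K" for x
    using grad_transform[of "\<lambda>x. 0" x "- K" "\<lambda>x. w x * f x"] op that K(3) by (auto simp: grad_zero)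
  have "continuous_on (\<Omega> \<union> - K) (\<lambda>x. grad (\<lambda>x. w x * f x) x $ i)" for i
  proof (rule continuous_on_open_Un[OF \<Omega> op])
    show "continuous_on \<Omega> (\<lambda>x. grad (\<lambda>x. w x * f x) x $ i)"
      using wf by (simp add: C1_on_def)
    show "continuous_on (- K) (\<lambda>x. grad (\<lambda>x. w x * f x) x $ i)"
      by (rule continuous_on_eq[where f="\<lambda>x. 0"]) (auto simp: out)
  qed
  moreover have "\<Omega> \<union> - K = UNIV" using K(2) by auto
  moreover have "(\<lambda>x. w x * f x) differentiable (at x)" for x
    using wf out(1) K(2) by (cases "x \<in> K") (auto simp: C1_on_def)
  ultimately have "C1_on UNIV (\<lambda>x. w x * f x)"
    by (auto simp: C1_on_def)
  then show ?thesis
    unfolding C1c_def using K by auto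
qed

lemma C1c_add:
  assumes "C1c \<Omega> f" "C1c \<Omega> g"
  shows "C1c \<Omega> (\<lambda>x. f x + g x)"
proof -
  obtain K where K: "compact K" "K \<subseteq> \<Omega>" "\<And>x. x \<notin> K \<Longrightarrow> f x = 0"
    using C1c_support[OF assms(1)] by metis
  obtain L where L: "compact L" "L \<subseteq> \<Omega>" "\<And>x. x \<notin> L \<Longrightarrow> g x = 0"
    using C1c_support[OF assms(2)] by metis
  have "compact (K \<union> L)" "K \<union> L \<subseteq> \<Omega>" "\<And>x. x \<notin> K \<union> L \<Longrightarrow> f x + g x = 0"
    using K L by auto
  then show ?thesis
    using assms C1_on_add unfolding C1c_def by blast
qed

lemma C1c_cmult: "C1c \<Omega> f \<Longrightarrow> C1c \<Omega> (\<lambda>x. r * f x)"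
  unfolding C1c_def by (auto intro!: C1_on_mult C1_on_const)

lemma C1c_zero: "C1c \<Omega> (\<lambda>x. 0)"
  unfolding C1c_def by (auto intro!: C1_on_const exI[of _ "{}"])

section \<open>Integration by parts\<close>

lemma integrable_compact_support:
  fixes f :: "real^'d \<Rightarrow> real"
  assumes "continuous_on UNIV f" "compact K" "\<And>x. x \<notin> K \<Longrightarrow> f x = 0"
  shows "integrable lborel f"
proof -
  have "integrable lborel (\<lambda>x. indicat_real K x *\<^sub>R f x)"
    using assms by (intro borel_integrable_compact) (auto intro: continuous_on_subset)
  also have "(\<lambda>x. indicat_real K x *\<^sub>R f x) = f"
    using assms(3) by (auto simp: indicator_def fun_eq_iff)
  finally show ?thesis .
qed

lemma C1c_mult_grad:
  assumes "C1c \<Omega> f"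
  shows "continuous_on UNIV w \<Longrightarrow> integrable lborel (\<lambda>x. w x * grad f x $ i)"
    and "continuous_on UNIV w \<Longrightarrow> integrable lborel (\<lambda>x. w x * f x)"
proof -
  obtain K where K: "compact K" "\<And>x. x \<notin> K \<Longrightarrow> f x = 0" "\<And>x. x \<notin> K \<Longrightarrow> grad f x = 0"
    using C1c_support[OF assms] by metis
  assume w: "continuous_on UNIV w"
  show "integrable lborel (\<lambda>x. w x * grad f x $ i)"
    by (rule integrable_compact_support[OF _ K(1)])
      (auto intro!: continuous_on_mult w C1c_continuous_grad[OF assms] simp: K)
  show "integrable lborel (\<lambda>x. w x * f x)"
    by (rule integrable_compact_support[OF _ K(1)])
      (auto intro!: continuous_on_mult w C1c_continuous[OF assms] simp: K)
qed

lemma lborel_integral_translate: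
  fixes F :: "real^'d \<Rightarrow> real"
  assumes "F \<in> borel_measurable borel"
  shows "(LBINT x. F (x + c)) = (LBINT x. F x)"
proof -
  have "(LBINT x. F x) = integral\<^sup>L (distr lborel borel ((+) c)) F"
    by (simp add: lborel_distr_plus)
  also have "\<dots> = (LBINT x. F (c + x))"
    using assms by (intro integral_distr) auto
  finally show ?thesis by (simp add: add.commute)
qed

lemma lborel_integrable_translate:
  fixes F :: "real^'d \<Rightarrow> real"
  assumes "integrable lborel F"
  shows "integrable lborel (\<lambda>x. F (x + c))"
proof -
  have "integrable (distr lborel borel ((+) c)) F"
    using assms by (simp add: lborel_distr_plus)
  then show ?thesis
    using assms by (subst (asm) integrable_distr_eq) (auto simp: add.commute)
qed

lemma directional_derivative:
  fixes f :: "real^'d \<Rightarrow> real"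
  assumes "f differentiable (at (x + t *\<^sub>R axis i 1))"
  shows "((\<lambda>t. f (x + t *\<^sub>R axis i 1)) has_real_derivative grad f (x + t *\<^sub>R axis i 1) $ i) (at t)"
proof -
  let ?D = "frechet_derivative f (at (x + t *\<^sub>R axis i 1))"
  have "((\<lambda>t. x + t *\<^sub>R axis i (1::real)) has_derivative (\<lambda>t. t *\<^sub>R axis i 1)) (at t)"
    by (auto intro!: derivative_eq_intros)
  moreover have D: "(f has_derivative ?D) (at (x + t *\<^sub>R axis i 1))"
    using assms by (simp add: frechet_derivative_works)
  ultimately have "(f \<circ> (\<lambda>t. x + t *\<^sub>R axis i 1) has_derivative ?D \<circ> (\<lambda>t. t *\<^sub>R axis i 1)) (at t)"
    by (rule diff_chain_at)
  moreover have "?D \<circ> (\<lambda>t. t *\<^sub>R axis i 1) = (*) (grad f (x + t *\<^sub>R axis i 1) $ i)"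
    using linear_cmul[OF has_derivative_linear[OF D]] by (auto simp: grad_def)
  ultimately show ?thesis
    by (simp add: has_field_derivative_def o_def)
qed

text \<open>Dominated convergence: the quotient is bounded by a bound \<open>M\<close> of the
  derivative, and for steps of size at most 1 it vanishes outside the ball of radius
  \<open>R + 1\<close>.\<close>

lemma difference_quotient_tendsto:
  fixes f :: "real^'d \<Rightarrow> real"
  assumes f: "C1c UNIV f" and w: "w \<in> borel_measurable borel" "\<And>x. \<bar>w x\<bar> \<le> B"
    and h: "h \<longlonglongrightarrow> 0" "\<And>n. h n \<noteq> 0" "\<And>n. \<bar>h n\<bar> \<le> 1"
  shows "(\<lambda>n. LBINT x. w x * ((f (x + h n *\<^sub>R axis i 1) - f x) / h n)) \<longlonglongrightarrow> (LBINT x. w x * grad f x $ i)"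
proof -
  obtain K where K: "compact K" "\<And>x. x \<notin> K \<Longrightarrow> f x = 0" "\<And>x. x \<notin> K \<Longrightarrow> grad f x = 0"
    using C1c_support[OF f] by metis
  obtain R where R: "0 < R" "\<And>x. x \<in> K \<Longrightarrow> norm x \<le> R"
    using compact_imp_bounded[OF K(1)] by (auto simp: bounded_pos)
  have cont: "continuous_on UNIV f" "continuous_on UNIV (\<lambda>x. grad f x $ i)"
    using C1c_continuous[OF f] C1c_continuous_grad[OF f] by auto
  have "bounded ((\<lambda>x. grad f x $ i) ` K)"
    by (intro compact_imp_bounded compact_continuous_image continuous_on_subset[OF cont(2)] K) auto
  then obtain M where M: "0 < M" "\<And>x. x \<in> K \<Longrightarrow> \<bar>grad f x $ i\<bar> \<le> M"
    by (auto simp: bounded_pos)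
  then have M': "\<bar>grad f x $ i\<bar> \<le> M" for x
    using K(3)[of x] by (cases "x \<in> K") auto
  have B: "0 \<le> B" using w(2)[of 0] by linarith
  have [measurable]: "f \<in> borel_measurable borel" "(\<lambda>x. grad f x $ i) \<in> borel_measurable borel"
    "w \<in> borel_measurable borel"
    using cont w by (auto intro: borel_measurable_continuous_onI)
  let ?q = "\<lambda>n x. (f (x + h n *\<^sub>R axis i 1) - f x) / h n"
  have lip: "\<bar>f (x + t *\<^sub>R axis i 1) - f x\<bar> \<le> M * \<bar>t\<bar>" for x t
    using field_differentiable_bound[of UNIV "\<lambda>t. f (x + t *\<^sub>R axis i 1)"
        "\<lambda>t. grad f (x + t *\<^sub>R axis i 1) $ i" M t 0] directional_derivative[OF C1c_differentiable[OF f]] M'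
    by simp
  show ?thesis
  proof (rule integral_dominated_convergence[where w="\<lambda>x. indicat_real (cball 0 (R + 1)) x *\<^sub>R (B * M)"])
    show "integrable lborel (\<lambda>x::real^'d. indicat_real (cball 0 (R + 1)) x *\<^sub>R (B * M))"
      by (rule borel_integrable_compact) auto
    show "AE x in lborel. (\<lambda>n. w x * ?q n x) \<longlonglongrightarrow> w x * grad f x $ i"
    proof (intro AE_I2 tendsto_mult tendsto_const)
      fix x
      have "((\<lambda>t. f (x + t *\<^sub>R axis i 1)) has_real_derivative grad f x $ i) (at 0)"
        using directional_derivative[OF C1c_differentiable[OF f], where x=x and t=0 and i=i] by simp
      then have "((\<lambda>t. (f (x + t *\<^sub>R axis i 1) - f x) / t) \<longlongrightarrow> grad f x $ i) (at 0)"
        by (simp add: DERIV_def)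
      moreover have "filterlim h (at 0) sequentially"
        using h by (auto simp: filterlim_at)
      ultimately show "(\<lambda>n. ?q n x) \<longlonglongrightarrow> grad f x $ i"
        by (rule filterlim_compose)
    qed
    fix n
    show "AE x in lborel. norm (w x * ?q n x) \<le> indicat_real (cball 0 (R + 1)) x *\<^sub>R (B * M)"
    proof (rule AE_I2)
      fix x
      show "norm (w x * ?q n x) \<le> indicat_real (cball 0 (R + 1)) x *\<^sub>R (B * M)"
      proof (cases "x \<in> cball 0 (R + 1)")
        case True
        have "\<bar>?q n x\<bar> \<le> M"
          using lip[of x "h n"] h(2)[of n] by (simp add: abs_divide pos_divide_le_eq)
        then have "\<bar>w x\<bar> * \<bar>?q n x\<bar> \<le> B * M"
          by (intro mult_mono w B) auto
        with True show ?thesis by (simp add: abs_mult)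
      next
        case False
        have "norm x \<le> norm (x + h n *\<^sub>R axis i 1) + norm (h n *\<^sub>R axis i (1::real) :: real^'d)"
          using norm_triangle_ineq4[of "x + h n *\<^sub>R axis i 1" "h n *\<^sub>R axis i 1"] by simp
        then have "x \<notin> K" "x + h n *\<^sub>R axis i 1 \<notin> K"
          using False R(2)[of x] R(2)[of "x + h n *\<^sub>R axis i 1"] h(3)[of n] R(1) by auto
        then show ?thesis using B M(1) by (simp add: K)
      qed
    qed
  qed simp_all
qed

text \<open>Each difference quotient integrates to 0 because the integral is translation
  invariant.\<close>

lemma integral_grad_eq_0:
  fixes f :: "real^'d \<Rightarrow> real"
  assumes f: "C1c UNIV f"
  shows "(LBINT x. grad f x $ i) = 0"
proof -
  have [measurable]: "f \<in> borel_measurable borel"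
    using C1c_continuous[OF f] by (intro borel_measurable_continuous_onI)
  have int: "integrable lborel f"
    using C1c_mult_grad(2)[OF f, of "\<lambda>x. 1"] by simp
  let ?h = "\<lambda>n. 1 / real (Suc n)"
  have lim: "(\<lambda>n. LBINT x. 1 * ((f (x + ?h n *\<^sub>R axis i 1) - f x) / ?h n)) \<longlonglongrightarrow> (LBINT x. 1 * grad f x $ i)"
    by (rule difference_quotient_tendsto[OF f]) (use LIMSEQ_Suc[OF lim_1_over_n] in auto)
  have zero: "(LBINT x. 1 * ((f (x + c) - f x) / t)) = 0" for c t
    using lborel_integral_translate[of f c] lborel_integrable_translate[OF int] int by simp
  show ?thesis
    using LIMSEQ_unique[OF lim[unfolded zero] tendsto_const] by simp
qed

text \<open>Only first derivatives are available, so one of the two derivatives is replaced by a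
  difference quotient before integrating by parts.\<close>

lemma integral_grad_swap:
  fixes f g :: "real^'d \<Rightarrow> real"
  assumes f: "C1c UNIV f" and g: "C1c UNIV g"
  shows "(LBINT x. grad f x $ i * grad g x $ j) = (LBINT x. grad f x $ j * grad g x $ i)"
proof -
  have bdd: "\<exists>B. \<forall>x. \<bar>grad f x $ k\<bar> \<le> B" if f': "C1c UNIV f" for f :: "real^'d \<Rightarrow> real" and k
  proof -
    obtain K where K: "compact K" "\<And>x. x \<notin> K \<Longrightarrow> grad f x = 0"
      using C1c_support[OF f'] by metis
    have "bounded ((\<lambda>x. grad f x $ k) ` K)"
      by (intro compact_imp_bounded compact_continuous_image
        continuous_on_subset[OF C1c_continuous_grad[OF f']] K) auto
    then obtain M where "0 < M" "\<And>x. x \<in> K \<Longrightarrow> \<bar>grad f x $ k\<bar> \<le> M"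
      by (auto simp: bounded_pos)
    then have "\<bar>grad f x $ k\<bar> \<le> M" for x
      using K(2)[of x] by (cases "x \<in> K") auto
    then show ?thesis by blast
  qed
  obtain Bf Bg where B: "\<And>x. \<bar>grad f x $ j\<bar> \<le> Bf" "\<And>x. \<bar>grad g x $ j\<bar> \<le> Bg"
    using bdd[OF f] bdd[OF g] by metis
  have [measurable]: "(\<lambda>x. grad f x $ j) \<in> borel_measurable borel" "(\<lambda>x. grad g x $ j) \<in> borel_measurable borel"
    using C1c_continuous_grad[OF f] C1c_continuous_grad[OF g] by (auto intro: borel_measurable_continuous_onI)
  let ?h = "\<lambda>n. 1 / real (Suc n)"
  have h: "?h \<longlonglongrightarrow> 0" using LIMSEQ_Suc[OF lim_1_over_n] by simp
  let ?e = "axis i 1 :: real^'d"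
  have 1: "(\<lambda>n. LBINT x. grad f x $ j * ((g (x + ?h n *\<^sub>R ?e) - g x) / ?h n)) \<longlonglongrightarrow> (LBINT x. grad f x $ j * grad g x $ i)"
    by (rule difference_quotient_tendsto[OF g _ B(1) h]) auto
  have 2: "(\<lambda>n. LBINT x. grad g x $ j * ((f (x + - ?h n *\<^sub>R ?e) - f x) / - ?h n)) \<longlonglongrightarrow> (LBINT x. grad g x $ j * grad f x $ i)"
    by (rule difference_quotient_tendsto[OF f _ B(2)]) (use tendsto_minus[OF h] in auto)
  \<comment> \<open>The derivative in direction j moves from f to the difference quotient of g by
    integration by parts. Shifting the argument by -t then turns the quotient of g with step t into
    one of f with step -t.\<close>
  have quotient_swap: "(LBINT x. grad f x $ j * ((g (x + t *\<^sub>R ?e) - g x) / t)) =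
      (LBINT x. grad g x $ j * ((f (x + - t *\<^sub>R ?e) - f x) / - t))" if t: "t \<noteq> 0" for t :: real
  proof -
    let ?T = "\<lambda>x. x + t *\<^sub>R ?e"
    have der: "(g \<circ> ?T has_derivative frechet_derivative g (at (?T x)) \<circ> (\<lambda>x. x)) (at x)" for x
      by (rule diff_chain_at) (auto intro!: derivative_eq_intros
        simp: frechet_derivative_works[symmetric] C1c_differentiable[OF g])
    have gT: "(\<lambda>x. g (?T x)) differentiable (at x)" "grad (\<lambda>x. g (?T x)) x $ k = grad g (?T x) $ k" for x k
      using der[of x] grad_eq[OF der[of x], of k] by (auto simp: o_def differentiable_def grad_def)
    have cT: "continuous_on UNIV (\<lambda>x. g (?T x))" "continuous_on UNIV (\<lambda>x. grad g (?T x) $ k)" for k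
      by (rule continuous_on_compose2[OF C1c_continuous[OF g]] continuous_on_compose2[OF C1c_continuous_grad[OF g]];
        auto intro!: continuous_on_add)+
    have C1_on: "C1_on UNIV (\<lambda>x. g (?T x))" "C1_on UNIV g"
      using g unfolding C1c_def by (simp_all add: C1_on_def gT cT)
    have C1: "C1c UNIV (\<lambda>x. g (?T x) * f x)" "C1c UNIV (\<lambda>x. g x * f x)"
      by (rule C1c_mult_weight[OF open_UNIV C1_on(1) f] C1c_mult_weight[OF open_UNIV C1_on(2) f])+
    note cg = C1c_continuous[OF g] C1c_continuous_grad[OF g, of j]
    have int: "integrable lborel (\<lambda>x. g (?T x) * grad f x $ j)" "integrable lborel (\<lambda>x. g x * grad f x $ j)"
      "integrable lborel (\<lambda>x. grad g (?T x) $ j * f x)" "integrable lborel (\<lambda>x. grad g x $ j * f x)"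
      by (intro C1c_mult_grad[OF f] cT cg)+
    have g1: "(LBINT x. g (?T x) * grad f x $ j) = - (LBINT x. grad g (?T x) $ j * f x)"
      using integral_grad_eq_0[OF C1(1), of j] int
      by (simp add: grad_mult[OF gT(1) C1c_differentiable[OF f]] gT(2))
    have g2: "(LBINT x. g x * grad f x $ j) = - (LBINT x. grad g x $ j * f x)"
      using integral_grad_eq_0[OF C1(2), of j] int
      by (simp add: grad_mult[OF C1c_differentiable[OF g] C1c_differentiable[OF f]])
    have m: "(\<lambda>x. grad g x $ j * f (x + - t *\<^sub>R ?e)) \<in> borel_measurable borel"
      by (intro borel_measurable_continuous_onI continuous_on_mult cg
        continuous_on_compose2[OF C1c_continuous[OF f]] continuous_intros) auto
    have g3: "(LBINT x. grad g (?T x) $ j * f x) = (LBINT x. grad g x $ j * f (x + - t *\<^sub>R ?e))"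
      using lborel_integral_translate[OF m, of "t *\<^sub>R ?e"] by simp
    have int': "integrable lborel (\<lambda>x. grad g x $ j * f (x + - t *\<^sub>R ?e))"
      using lborel_integrable_translate[OF int(3), of "- t *\<^sub>R ?e"] by simp
    have "(LBINT x. grad f x $ j * ((g (?T x) - g x) / t)) =
        (LBINT x. (g (?T x) * grad f x $ j - g x * grad f x $ j) / t)"
      by (intro Bochner_Integration.integral_cong) (auto simp: algebra_simps diff_divide_distrib)
    also have "\<dots> = ((LBINT x. g (?T x) * grad f x $ j) - (LBINT x. g x * grad f x $ j)) / t"
      by (simp add: Bochner_Integration.integral_diff[OF int(1,2)])
    also have "\<dots> = ((LBINT x. grad g x $ j * f (x + - t *\<^sub>R ?e)) - (LBINT x. grad g x $ j * f x)) / - t"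
      unfolding g1 g2 g3 by (simp add: diff_divide_distrib)
    also have "\<dots> = (LBINT x. (grad g x $ j * f (x + - t *\<^sub>R ?e) - grad g x $ j * f x) / - t)"
      by (subst Bochner_Integration.integral_diff[OF int' int(4), symmetric]) simp
    also have "\<dots> = (LBINT x. grad g x $ j * ((f (x + - t *\<^sub>R ?e) - f x) / - t))"
      by (intro Bochner_Integration.integral_cong) (auto simp: algebra_simps diff_divide_distrib)
    finally show ?thesis .
  qed
  have "(LBINT x. grad f x $ j * ((g (x + ?h n *\<^sub>R ?e) - g x) / ?h n)) =
      (LBINT x. grad g x $ j * ((f (x + - ?h n *\<^sub>R ?e) - f x) / - ?h n))" for n
    by (rule quotient_swap) simp
  from 2[folded this] have "(\<lambda>n. LBINT x. grad f x $ j * ((g (x + ?h n *\<^sub>R ?e) - g x) / ?h n))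
      \<longlonglongrightarrow> (LBINT x. grad g x $ j * grad f x $ i)" .
  from LIMSEQ_unique[OF this 1] show ?thesis
    by (simp add: mult.commute)
qed

section \<open>Square integrable functions\<close>

lemma real_discriminant:
  fixes a b c :: real
  assumes "\<And>t. 0 \<le> a + 2 * b * t + c * t\<^sup>2" "0 \<le> c"
  shows "b\<^sup>2 \<le> a * c"
proof (cases "c = 0")
  case True
  have "b = 0"
  proof (rule ccontr)
    assume "b \<noteq> 0"
    \<comment> \<open>At this argument the affine function has the value -1.\<close>
    then show False using assms(1)[of "- (a + 1) / (2 * b)"] True by simp
  qed
  with True show ?thesis by simp
next
  case False
  then have c: "0 < c" using assms(2) by simp
  have "0 \<le> c * (a + 2 * b * (- b / c) + c * (- b / c)\<^sup>2)"
    by (intro mult_nonneg_nonneg assms)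
  also have "\<dots> = a * c - b\<^sup>2"
    using c by (simp add: field_simps power2_eq_square)
  finally show ?thesis by simp
qed

lemma L2_real_iff: "f \<in> L2 \<Omega> \<longleftrightarrow> f \<in> borel_measurable (lebesgue_on \<Omega>) \<and> integrable (lebesgue_on \<Omega>) (\<lambda>x. (f x)\<^sup>2)"
  for f :: "real^'d \<Rightarrow> real"
  by (simp add: L2_def)

lemma L2_mult_integrable:
  fixes f g :: "real^'d \<Rightarrow> real"
  assumes "f \<in> L2 \<Omega>" "g \<in> L2 \<Omega>"
  shows "integrable (lebesgue_on \<Omega>) (\<lambda>x. f x * g x)"
proof (rule Bochner_Integration.integrable_bound)
  show "integrable (lebesgue_on \<Omega>) (\<lambda>x. (f x)\<^sup>2 + (g x)\<^sup>2)"
    using assms by (simp add: L2_real_iff)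
  have "\<bar>a * b\<bar> \<le> a\<^sup>2 + b\<^sup>2" for a b :: real
    using sum_squares_bound[of a b] sum_squares_bound[of a "- b"] by (auto simp: abs_if)
  then show "AE x in lebesgue_on \<Omega>. norm (f x * g x) \<le> norm ((f x)\<^sup>2 + (g x)\<^sup>2)"
    by simp
qed (use assms in \<open>auto simp: L2_real_iff\<close>)

lemma L2_add:
  fixes f g :: "real^'d \<Rightarrow> real"
  assumes "f \<in> L2 \<Omega>" "g \<in> L2 \<Omega>"
  shows "(\<lambda>x. f x + g x) \<in> L2 \<Omega>"
  using assms L2_mult_integrable[OF assms] by (auto simp: L2_real_iff power2_sum mult.assoc intro!: borel_measurable_add)

lemma L2_cmult: "f \<in> L2 \<Omega> \<Longrightarrow> (\<lambda>x. r * f x) \<in> L2 \<Omega>" for f :: "real^'d \<Rightarrow> real"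
  by (auto simp: L2_real_iff power_mult_distrib intro!: borel_measurable_times)

lemma L2_diff: "f \<in> L2 \<Omega> \<Longrightarrow> g \<in> L2 \<Omega> \<Longrightarrow> (\<lambda>x. f x - g x) \<in> L2 \<Omega>" for f g :: "real^'d \<Rightarrow> real"
  using L2_add[of f \<Omega> "\<lambda>x. -1 * g x"] L2_cmult[of g \<Omega> "-1"] by simp

lemma L2_zero: "(\<lambda>x. 0 :: real) \<in> L2 \<Omega>"
  by (simp add: L2_real_iff)

lemma L2_sum: "(\<And>i. i \<in> I \<Longrightarrow> f i \<in> L2 \<Omega>) \<Longrightarrow> (\<lambda>x. \<Sum>i\<in>I. f i x) \<in> L2 \<Omega>" for f :: "_ \<Rightarrow> real^'d \<Rightarrow> real"
  by (induction I rule: infinite_finite_induct) (auto intro: L2_zero L2_add)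

lemma L2_bounded_mult:
  fixes w f :: "real^'d \<Rightarrow> real"
  assumes w: "w \<in> borel_measurable (lebesgue_on \<Omega>)" "AE x in lebesgue_on \<Omega>. \<bar>w x\<bar> \<le> B" and f: "f \<in> L2 \<Omega>"
  shows "(\<lambda>x. w x * f x) \<in> L2 \<Omega>"
proof -
  have "integrable (lebesgue_on \<Omega>) (\<lambda>x. (w x * f x)\<^sup>2)"
  proof (rule Bochner_Integration.integrable_bound)
    show "integrable (lebesgue_on \<Omega>) (\<lambda>x. B\<^sup>2 * (f x)\<^sup>2)"
      using f by (simp add: L2_real_iff)
    show "AE x in lebesgue_on \<Omega>. norm ((w x * f x)\<^sup>2) \<le> norm (B\<^sup>2 * (f x)\<^sup>2)"
      using w(2)
    proof eventually_elim
      case (elim x)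
      then have "(w x)\<^sup>2 \<le> B\<^sup>2"
        using abs_le_square_iff[of "w x" B] by auto
      then show ?case by (simp add: power_mult_distrib mult_right_mono)
    qed
  qed (use w f in \<open>auto simp: L2_real_iff\<close>)
  then show ?thesis
    using w f by (auto simp: L2_real_iff intro!: borel_measurable_times)
qed

lemma l2_norm_eq: "l2_norm \<Omega> f = sqrt (LINT x|lebesgue_on \<Omega>. (f x)\<^sup>2)" for f :: "real^'d \<Rightarrow> real"
  by (simp add: l2_norm_def l2_inner_def power2_eq_square)

lemma l2_norm_nonneg [simp]: "0 \<le> l2_norm \<Omega> f"
  by (simp add: l2_norm_def l2_inner_def)

lemma l2_norm_sq: "(l2_norm \<Omega> f)\<^sup>2 = (LINT x|lebesgue_on \<Omega>. (f x)\<^sup>2)" for f :: "real^'d \<Rightarrow> real"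
  by (simp add: l2_norm_eq)

lemma l2_inner_Cauchy_Schwarz:
  fixes f g :: "real^'d \<Rightarrow> real"
  assumes "f \<in> L2 \<Omega>" "g \<in> L2 \<Omega>"
  shows "\<bar>LINT x|lebesgue_on \<Omega>. f x * g x\<bar> \<le> l2_norm \<Omega> f * l2_norm \<Omega> g"
proof -
  let ?I = "integral\<^sup>L (lebesgue_on \<Omega>)"
  have int: "integrable (lebesgue_on \<Omega>) (\<lambda>x. f x * g x)" "integrable (lebesgue_on \<Omega>) (\<lambda>x. (f x)\<^sup>2)"
    "integrable (lebesgue_on \<Omega>) (\<lambda>x. (g x)\<^sup>2)"
    using assms L2_mult_integrable[OF assms] by (auto simp: L2_real_iff)
  have "0 \<le> ?I (\<lambda>x. (f x)\<^sup>2) + 2 * ?I (\<lambda>x. f x * g x) * t + ?I (\<lambda>x. (g x)\<^sup>2) * t\<^sup>2" for t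
  proof -
    have "0 \<le> ?I (\<lambda>x. (f x + t * g x)\<^sup>2)" by simp
    also have "?I (\<lambda>x. (f x + t * g x)\<^sup>2) = ?I (\<lambda>x. (f x)\<^sup>2 + 2 * t * (f x * g x) + t\<^sup>2 * (g x)\<^sup>2)"
      by (simp add: power2_sum power_mult_distrib algebra_simps)
    also have "\<dots> = ?I (\<lambda>x. (f x)\<^sup>2) + 2 * t * ?I (\<lambda>x. f x * g x) + t\<^sup>2 * ?I (\<lambda>x. (g x)\<^sup>2)"
      using int by simp
    finally show ?thesis by (simp add: algebra_simps)
  qed
  then have "(?I (\<lambda>x. f x * g x))\<^sup>2 \<le> ?I (\<lambda>x. (f x)\<^sup>2) * ?I (\<lambda>x. (g x)\<^sup>2)"
    by (rule real_discriminant) simp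
  also have "\<dots> = (l2_norm \<Omega> f * l2_norm \<Omega> g)\<^sup>2"
    by (simp add: power_mult_distrib l2_norm_sq)
  finally show ?thesis
    by (simp add: abs_le_square_iff[symmetric])
qed

lemma l2_norm_cmult: "l2_norm \<Omega> (\<lambda>x. r * f x) = \<bar>r\<bar> * l2_norm \<Omega> f" for f :: "real^'d \<Rightarrow> real"
  by (simp add: l2_norm_eq power_mult_distrib real_sqrt_mult)

lemma l2_norm_triangle:
  fixes f g :: "real^'d \<Rightarrow> real"
  assumes "f \<in> L2 \<Omega>" "g \<in> L2 \<Omega>"
  shows "l2_norm \<Omega> (\<lambda>x. f x + g x) \<le> l2_norm \<Omega> f + l2_norm \<Omega> g"
proof (rule power2_le_imp_le)
  have int: "integrable (lebesgue_on \<Omega>) (\<lambda>x. f x * g x)" "integrable (lebesgue_on \<Omega>) (\<lambda>x. (f x)\<^sup>2)"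
    "integrable (lebesgue_on \<Omega>) (\<lambda>x. (g x)\<^sup>2)"
    using assms L2_mult_integrable[OF assms] by (auto simp: L2_real_iff)
  have "(l2_norm \<Omega> (\<lambda>x. f x + g x))\<^sup>2 =
      (l2_norm \<Omega> f)\<^sup>2 + (l2_norm \<Omega> g)\<^sup>2 + 2 * (LINT x|lebesgue_on \<Omega>. f x * g x)"
    using int by (simp add: l2_norm_sq power2_sum mult.assoc)
  also have "\<dots> \<le> (l2_norm \<Omega> f + l2_norm \<Omega> g)\<^sup>2"
    using l2_inner_Cauchy_Schwarz[OF assms] by (simp add: power2_sum)
  finally show "(l2_norm \<Omega> (\<lambda>x. f x + g x))\<^sup>2 \<le> (l2_norm \<Omega> f + l2_norm \<Omega> g)\<^sup>2" .
qed simp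

lemma l2_norm_AE_mono:
  fixes f :: "real^'d \<Rightarrow> real" and g :: "real^'d \<Rightarrow> real"
  assumes "f \<in> L2 \<Omega>" "g \<in> L2 \<Omega>" "AE x in lebesgue_on \<Omega>. \<bar>f x\<bar> \<le> \<bar>g x\<bar>"
  shows "l2_norm \<Omega> f \<le> l2_norm \<Omega> g"
  unfolding l2_norm_eq
  using assms by (intro real_sqrt_le_mono integral_mono_AE) (auto simp: L2_real_iff abs_le_square_iff)

lemma weighted_Cauchy_Schwarz:
  fixes w f g :: "real^'d \<Rightarrow> real"
  assumes w: "w \<in> borel_measurable (lebesgue_on \<Omega>)" "AE x in lebesgue_on \<Omega>. \<bar>w x\<bar> \<le> B"
    and f: "f \<in> L2 \<Omega>" and g: "g \<in> L2 \<Omega>"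
  shows "\<bar>LINT x|lebesgue_on \<Omega>. w x * f x * g x\<bar> \<le> \<bar>B\<bar> * l2_norm \<Omega> f * l2_norm \<Omega> g"
proof -
  have wf: "(\<lambda>x. w x * f x) \<in> L2 \<Omega>" by (rule L2_bounded_mult[OF w f])
  have "l2_norm \<Omega> (\<lambda>x. w x * f x) \<le> l2_norm \<Omega> (\<lambda>x. B * f x)"
    using w(2) by (intro l2_norm_AE_mono wf L2_cmult f) (auto simp: abs_mult intro!: mult_right_mono elim!: eventually_mono)
  also have "\<dots> = \<bar>B\<bar> * l2_norm \<Omega> f" by (rule l2_norm_cmult)
  finally have "l2_norm \<Omega> (\<lambda>x. w x * f x) * l2_norm \<Omega> g \<le> \<bar>B\<bar> * l2_norm \<Omega> f * l2_norm \<Omega> g"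
    by (rule mult_right_mono) simp
  then show ?thesis
    using l2_inner_Cauchy_Schwarz[OF wf g] by simp
qed

text \<open>The difference of the products is split as (f - f')(g - g') + (f - f') g' + f' (g - g'),
  and each term is bounded by the weighted Cauchy-Schwarz inequality. This is the passage from
  \<open>C1c\<close> functions to limits in the identities below.\<close>

lemma l2_limit:
  fixes f g :: "nat \<Rightarrow> real^'d \<Rightarrow> real" and f' g' w :: "real^'d \<Rightarrow> real"
  assumes w: "w \<in> borel_measurable (lebesgue_on \<Omega>)" "AE x in lebesgue_on \<Omega>. \<bar>w x\<bar> \<le> B"
    and f: "\<And>j. f j \<in> L2 \<Omega>" "f' \<in> L2 \<Omega>" "(\<lambda>j. l2_norm \<Omega> (\<lambda>x. f j x - f' x)) \<longlonglongrightarrow> 0"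
    and g: "\<And>j. g j \<in> L2 \<Omega>" "g' \<in> L2 \<Omega>" "(\<lambda>j. l2_norm \<Omega> (\<lambda>x. g j x - g' x)) \<longlonglongrightarrow> 0"
  shows "(\<lambda>j. LINT x|lebesgue_on \<Omega>. w x * f j x * g j x) \<longlonglongrightarrow> (LINT x|lebesgue_on \<Omega>. w x * f' x * g' x)"
proof -
  let ?I = "\<lambda>f g. LINT x|lebesgue_on \<Omega>. w x * f x * g x"
  let ?a = "\<lambda>j. l2_norm \<Omega> (\<lambda>x. f j x - f' x)" and ?b = "\<lambda>j. l2_norm \<Omega> (\<lambda>x. g j x - g' x)"
  have int: "integrable (lebesgue_on \<Omega>) (\<lambda>x. w x * f x * g x)" if "f \<in> L2 \<Omega>" "g \<in> L2 \<Omega>" for f g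
    by (rule L2_mult_integrable[OF L2_bounded_mult[OF w that(1)] that(2)])
  have bound: "\<bar>?I (f j) (g j) - ?I f' g'\<bar> \<le> \<bar>B\<bar> * ?a j * ?b j + \<bar>B\<bar> * ?a j * l2_norm \<Omega> g' + \<bar>B\<bar> * l2_norm \<Omega> f' * ?b j" for j
  proof -
    have d: "(\<lambda>x. f j x - f' x) \<in> L2 \<Omega>" "(\<lambda>x. g j x - g' x) \<in> L2 \<Omega>"
      by (intro L2_diff f g)+
    have "?I (f j) (g j) - ?I f' g' = (LINT x|lebesgue_on \<Omega>. w x * f j x * g j x - w x * f' x * g' x)"
      by (simp add: int f g)
    also have "\<dots> = (LINT x|lebesgue_on \<Omega>. w x * (f j x - f' x) * (g j x - g' x) +
        w x * (f j x - f' x) * g' x + w x * f' x * (g j x - g' x))"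
      by (rule Bochner_Integration.integral_cong) (auto simp: algebra_simps)
    also have "\<dots> = ?I (\<lambda>x. f j x - f' x) (\<lambda>x. g j x - g' x) + ?I (\<lambda>x. f j x - f' x) g' + ?I f' (\<lambda>x. g j x - g' x)"
      by (simp add: int[OF d] int[OF d(1) g(2)] int[OF f(2) d(2)])
    finally show ?thesis
      using weighted_Cauchy_Schwarz[OF w d] weighted_Cauchy_Schwarz[OF w d(1) g(2)]
        weighted_Cauchy_Schwarz[OF w f(2) d(2)] by linarith
  qed
  have lim: "(\<lambda>j. \<bar>B\<bar> * ?a j * ?b j + \<bar>B\<bar> * ?a j * l2_norm \<Omega> g' + \<bar>B\<bar> * l2_norm \<Omega> f' * ?b j) \<longlonglongrightarrow>
      \<bar>B\<bar> * 0 * 0 + \<bar>B\<bar> * 0 * l2_norm \<Omega> g' + \<bar>B\<bar> * l2_norm \<Omega> f' * 0"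
    by (intro tendsto_intros f(3) g(3))
  have "(\<lambda>j. ?I (f j) (g j) - ?I f' g') \<longlonglongrightarrow> 0"
  proof (rule Lim_null_comparison[OF always_eventually tendsto_eq_rhs[OF lim]])
    show "\<forall>j. norm (?I (f j) (g j) - ?I f' g') \<le> \<bar>B\<bar> * ?a j * ?b j + \<bar>B\<bar> * ?a j * l2_norm \<Omega> g' + \<bar>B\<bar> * l2_norm \<Omega> f' * ?b j"
      unfolding real_norm_def using bound by blast
  qed simp
  then show ?thesis by (rule LIM_zero_cancel)
qed

text \<open>Links integrals over \<open>\<Omega>\<close> to integrals over the whole space, where
  translation invariance is available.\<close>

lemma lebesgue_on_lborel:
  fixes f :: "real^'d \<Rightarrow> real"
  assumes "open \<Omega>" and f: "f \<in> borel_measurable borel" "\<And>x. x \<notin> \<Omega> \<Longrightarrow> f x = 0"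
  shows "(LINT x|lebesgue_on \<Omega>. f x) = (LBINT x. f x)"
    and "integrable lborel f \<Longrightarrow> integrable (lebesgue_on \<Omega>) f"
proof -
  have \<Omega>: "\<Omega> \<inter> space lebesgue \<in> sets lebesgue" using assms(1) by simp
  have "(\<lambda>x. indicat_real \<Omega> x *\<^sub>R f x) = f" using f(2) by (auto simp: indicator_def fun_eq_iff)
  then show "(LINT x|lebesgue_on \<Omega>. f x) = (LBINT x. f x)"
    "integrable lborel f \<Longrightarrow> integrable (lebesgue_on \<Omega>) f"
    using f(1) by (simp_all add: integral_restrict_space[OF \<Omega>] integrable_restrict_space[OF \<Omega>]
      integral_completion integrable_completion)
qed

lemma C1c_L2:
  fixes \<Omega> :: "(real^'d) set"
  assumes \<Omega>: "open \<Omega>" and f: "C1c \<Omega> f"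
  shows "f \<in> L2 \<Omega>" "(\<lambda>x. grad f x $ i) \<in> L2 \<Omega>"
proof -
  obtain K where K: "compact K" "K \<subseteq> \<Omega>" "\<And>x. x \<notin> K \<Longrightarrow> f x = 0" "\<And>x. x \<notin> K \<Longrightarrow> grad f x = 0"
    using C1c_support[OF f] by metis
  have "h \<in> L2 \<Omega>" if h: "continuous_on UNIV h" "\<And>x. x \<notin> K \<Longrightarrow> h x = 0" for h :: "real^'d \<Rightarrow> real"
  proof -
    have m: "h \<in> borel_measurable borel" by (rule borel_measurable_continuous_onI[OF h(1)])
    have "integrable lborel (\<lambda>x. (h x)\<^sup>2)"
      by (rule integrable_compact_support[OF _ K(1)]) (auto intro!: continuous_on_power h)
    then have "integrable (lebesgue_on \<Omega>) (\<lambda>x. (h x)\<^sup>2)"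
      using m K(2) h(2) by (intro lebesgue_on_lborel(2)[OF \<Omega>]) auto
    moreover have "h \<in> borel_measurable (lebesgue_on \<Omega>)"
      using m by (intro measurable_restrict_space1 measurable_completion) simp
    ultimately show ?thesis by (simp add: L2_real_iff)
  qed
  then show "f \<in> L2 \<Omega>" "(\<lambda>x. grad f x $ i) \<in> L2 \<Omega>"
    using C1c_continuous[OF f] C1c_continuous_grad[OF f] K by auto
qed

lemma C1c_integral_grad:
  fixes \<Omega> :: "(real^'d) set"
  assumes "open \<Omega>" "C1c \<Omega> f"
  shows "(LINT x|lebesgue_on \<Omega>. grad f x $ i) = 0"
proof -
  have "grad f x = 0" if "x \<notin> \<Omega>" for x
    using that C1c_support[OF assms(2)] by (metis subsetD)
  then show ?thesis
    using C1c_continuous_grad[OF assms(2)] integral_grad_eq_0[OF C1c_mono[OF assms(2)], of i]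
    by (subst lebesgue_on_lborel(1)[OF assms(1)]) (auto intro: borel_measurable_continuous_onI)
qed

lemma C1c_integral_grad_swap:
  fixes \<Omega> :: "(real^'d) set"
  assumes "open \<Omega>" "C1c \<Omega> f" "C1c \<Omega> g"
  shows "(LINT x|lebesgue_on \<Omega>. grad f x $ i * grad g x $ j) = (LINT x|lebesgue_on \<Omega>. grad f x $ j * grad g x $ i)"
proof -
  have "grad f x = 0" if "x \<notin> \<Omega>" for x
    using that C1c_support[OF assms(2)] by (metis subsetD)
  moreover have "(\<lambda>x. grad f x $ a * grad g x $ b) \<in> borel_measurable borel" for a b
    by (intro borel_measurable_continuous_onI continuous_on_mult C1c_continuous_grad[OF assms(2)] C1c_continuous_grad[OF assms(3)])
  ultimately show ?thesis
    using integral_grad_swap[OF C1c_mono[OF assms(2)] C1c_mono[OF assms(3)], of i j]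
    by (subst (1 2) lebesgue_on_lborel(1)[OF assms(1)]) auto
qed

section \<open>Functions that vanish on the boundary\<close>

text \<open>Unlike \<open>weak_grad\<close>, which is a choice, this relation is closed under linear combinations.\<close>

definition h10_pair :: "(real^'d) set \<Rightarrow> (real^'d \<Rightarrow> real) \<Rightarrow> (real^'d \<Rightarrow> real^'d) \<Rightarrow> bool" where
  "h10_pair \<Omega> u g \<longleftrightarrow> u \<in> L2 \<Omega> \<and> (\<forall>i. (\<lambda>x. g x $ i) \<in> L2 \<Omega>) \<and>
     (\<exists>f :: nat \<Rightarrow> real^'d \<Rightarrow> real. (\<forall>j. C1c \<Omega> (f j)) \<and>
       (\<lambda>j. l2_norm \<Omega> (\<lambda>x. f j x - u x)) \<longlonglongrightarrow> 0 \<and>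
       (\<forall>i. (\<lambda>j. l2_norm \<Omega> (\<lambda>x. grad (f j) x $ i - g x $ i)) \<longlonglongrightarrow> 0))"

lemma h10_pairD: "h10_pair \<Omega> u g \<Longrightarrow> u \<in> L2 \<Omega>" "h10_pair \<Omega> u g \<Longrightarrow> (\<lambda>x. g x $ i) \<in> L2 \<Omega>"
  by (auto simp: h10_pair_def)

lemma h10_pair_approx:
  fixes \<Omega> :: "(real^'d) set"
  assumes "open \<Omega>" "h10_pair \<Omega> u g"
  obtains f where "\<And>j. C1c \<Omega> (f j)" "(\<lambda>j. l2_norm \<Omega> (\<lambda>x. f j x - u x)) \<longlonglongrightarrow> 0"
    "\<And>i. (\<lambda>j. l2_norm \<Omega> (\<lambda>x. grad (f j) x $ i - g x $ i)) \<longlonglongrightarrow> 0"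
    "\<And>j. f j \<in> L2 \<Omega>" "\<And>i j. (\<lambda>x. grad (f j) x $ i) \<in> L2 \<Omega>"
proof -
  obtain f :: "nat \<Rightarrow> real^'d \<Rightarrow> real" where f: "\<forall>j. C1c \<Omega> (f j)"
    "(\<lambda>j. l2_norm \<Omega> (\<lambda>x. f j x - u x)) \<longlonglongrightarrow> 0"
    "\<forall>i. (\<lambda>j. l2_norm \<Omega> (\<lambda>x. grad (f j) x $ i - g x $ i)) \<longlonglongrightarrow> 0"
    using assms(2) unfolding h10_pair_def by blast
  then show thesis
    using C1c_L2[OF assms(1)] by (intro that[of f]) auto
qed

lemma test_function_C1c:
  assumes "f \<in> test_functions \<Omega>"
  shows "C1c \<Omega> f"
proof -
  have "Ck_on 1 UNIV f"
    using assms by (simp add: test_functions_def smooth_on_def)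
  then have "C1_on UNIV f"
    by (simp add: C1_on_def grad_def)
  then show ?thesis
    using assms by (auto simp: test_functions_def C1c_def)
qed

lemma L2_vec_nth:
  fixes g :: "real^'d \<Rightarrow> real^'e"
  assumes "g \<in> L2 \<Omega>"
  shows "(\<lambda>x. g x $ i) \<in> L2 \<Omega>"
proof -
  have m: "(\<lambda>x. g x $ i) \<in> borel_measurable (lebesgue_on \<Omega>)"
    using assms unfolding L2_def
    by (auto intro!: borel_measurable_continuous_on[of "\<lambda>v. v $ i"] continuous_on_component continuous_on_id)
  have "integrable (lebesgue_on \<Omega>) (\<lambda>x. (g x $ i)\<^sup>2)"
  proof (rule Bochner_Integration.integrable_bound)
    show "integrable (lebesgue_on \<Omega>) (\<lambda>x. (norm (g x))\<^sup>2)"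
      using assms by (simp add: L2_def)
    show "AE x in lebesgue_on \<Omega>. norm ((g x $ i)\<^sup>2) \<le> norm ((norm (g x))\<^sup>2)"
      by (rule AE_I2) (simp add: component_le_norm_cart abs_le_square_iff[symmetric])
  qed (use m in auto)
  then show ?thesis using m by (simp add: L2_real_iff)
qed

lemma l2_norm_nth_le:
  fixes g :: "real^'d \<Rightarrow> real^'e"
  assumes "\<And>k. (\<lambda>x. g x $ k) \<in> L2 \<Omega>"
  shows "l2_norm \<Omega> (\<lambda>x. g x $ i) \<le> l2_norm \<Omega> g"
proof -
  have int: "integrable (lebesgue_on \<Omega>) (\<lambda>x. (g x $ k)\<^sup>2)" for k
    using assms by (simp add: L2_real_iff)
  have "(LINT x|lebesgue_on \<Omega>. (g x $ i)\<^sup>2) \<le> (LINT x|lebesgue_on \<Omega>. (\<Sum>k\<in>UNIV. (g x $ k)\<^sup>2))"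
    using int by (intro integral_mono) (auto intro!: member_le_sum)
  then show ?thesis
    by (simp add: l2_norm_eq l2_norm_def[of _ g] l2_inner_def inner_vec_def power2_eq_square)
qed

text \<open>The choice made by \<open>weak_grad\<close> is a weak gradient because one exists, and
  the norm of a component is at most that of the whole gradient.\<close>

lemma H10_pair:
  fixes \<Omega> :: "(real^'d) set"
  assumes \<Omega>: "open \<Omega>" and v: "v \<in> H10 \<Omega>"
  shows "h10_pair \<Omega> v (weak_grad \<Omega> v)"
proof -
  obtain g where "is_weak_grad \<Omega> v g"
    using v unfolding H10_def H1_def by blast
  then have "is_weak_grad \<Omega> v (weak_grad \<Omega> v)"
    unfolding weak_grad_def by (rule someI[of "is_weak_grad \<Omega> v"])
  then have wg: "(\<lambda>x. weak_grad \<Omega> v x $ i) \<in> L2 \<Omega>" for i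
    by (auto simp: is_weak_grad_def intro: L2_vec_nth)
  obtain f where f: "\<And>j. f j \<in> test_functions \<Omega>"
    "(\<lambda>j. l2_norm \<Omega> (\<lambda>x. f j x - v x)) \<longlonglongrightarrow> 0"
    "(\<lambda>j. l2_norm \<Omega> (\<lambda>x. grad (f j) x - weak_grad \<Omega> v x)) \<longlonglongrightarrow> 0"
    using v unfolding H10_def by blast
  have C: "C1c \<Omega> (f j)" for j by (rule test_function_C1c[OF f(1)])
  have "(\<lambda>j. l2_norm \<Omega> (\<lambda>x. grad (f j) x $ i - weak_grad \<Omega> v x $ i)) \<longlonglongrightarrow> 0" for i
  proof (rule tendsto_sandwich[OF _ _ tendsto_const f(3)])
    show "\<forall>\<^sub>F j in sequentially. l2_norm \<Omega> (\<lambda>x. grad (f j) x $ i - weak_grad \<Omega> v x $ i)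
        \<le> l2_norm \<Omega> (\<lambda>x. grad (f j) x - weak_grad \<Omega> v x)"
    proof (intro always_eventually allI)
      fix j
      have "(\<lambda>x. (grad (f j) x - weak_grad \<Omega> v x) $ k) \<in> L2 \<Omega>" for k
        unfolding vector_minus_component by (intro L2_diff C1c_L2[OF \<Omega> C] wg)
      from l2_norm_nth_le[OF this, of i]
      show "l2_norm \<Omega> (\<lambda>x. grad (f j) x $ i - weak_grad \<Omega> v x $ i)
          \<le> l2_norm \<Omega> (\<lambda>x. grad (f j) x - weak_grad \<Omega> v x)"
        by simp
    qed
  qed simp
  moreover have "v \<in> L2 \<Omega>" using v by (simp add: H10_def H1_def)
  ultimately show ?thesis
    unfolding h10_pair_def using wg C f(2) by blast
qed

lemma h10_pair_linear:
  fixes \<Omega> :: "(real^'d) set"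
  assumes \<Omega>: "open \<Omega>" and u: "h10_pair \<Omega> u g" and v: "h10_pair \<Omega> v h"
  shows "h10_pair \<Omega> (\<lambda>x. u x + r * v x) (\<lambda>x. g x + r *\<^sub>R h x)"
proof -
  obtain f where f: "\<And>j. C1c \<Omega> (f j)" "(\<lambda>j. l2_norm \<Omega> (\<lambda>x. f j x - u x)) \<longlonglongrightarrow> 0"
    "\<And>i. (\<lambda>j. l2_norm \<Omega> (\<lambda>x. grad (f j) x $ i - g x $ i)) \<longlonglongrightarrow> 0"
    "\<And>j. f j \<in> L2 \<Omega>" "\<And>i j. (\<lambda>x. grad (f j) x $ i) \<in> L2 \<Omega>"
    by (rule h10_pair_approx[OF \<Omega> u]) (rule that)
  obtain f' where f': "\<And>j. C1c \<Omega> (f' j)" "(\<lambda>j. l2_norm \<Omega> (\<lambda>x. f' j x - v x)) \<longlonglongrightarrow> 0"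
    "\<And>i. (\<lambda>j. l2_norm \<Omega> (\<lambda>x. grad (f' j) x $ i - h x $ i)) \<longlonglongrightarrow> 0"
    "\<And>j. f' j \<in> L2 \<Omega>" "\<And>i j. (\<lambda>x. grad (f' j) x $ i) \<in> L2 \<Omega>"
    by (rule h10_pair_approx[OF \<Omega> v]) (rule that)
  have lim: "(\<lambda>j. l2_norm \<Omega> (\<lambda>x. (p j x + r * p' j x) - (q x + r * q' x))) \<longlonglongrightarrow> 0"
    if p: "\<And>j. p j \<in> L2 \<Omega>" "q \<in> L2 \<Omega>" "(\<lambda>j. l2_norm \<Omega> (\<lambda>x. p j x - q x)) \<longlonglongrightarrow> 0"
      and p': "\<And>j. p' j \<in> L2 \<Omega>" "q' \<in> L2 \<Omega>" "(\<lambda>j. l2_norm \<Omega> (\<lambda>x. p' j x - q' x)) \<longlonglongrightarrow> 0"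
    for p p' :: "nat \<Rightarrow> real^'d \<Rightarrow> real" and q q'
  proof (rule tendsto_sandwich[OF _ _ tendsto_const])
    show "\<forall>\<^sub>F j in sequentially. l2_norm \<Omega> (\<lambda>x. (p j x + r * p' j x) - (q x + r * q' x)) \<le>
        l2_norm \<Omega> (\<lambda>x. p j x - q x) + \<bar>r\<bar> * l2_norm \<Omega> (\<lambda>x. p' j x - q' x)"
    proof (intro always_eventually allI)
      fix j
      have d: "(\<lambda>x. p j x - q x) \<in> L2 \<Omega>" "(\<lambda>x. p' j x - q' x) \<in> L2 \<Omega>"
        by (intro L2_diff p p')+
      have "(\<lambda>x. (p j x + r * p' j x) - (q x + r * q' x)) = (\<lambda>x. (p j x - q x) + r * (p' j x - q' x))"
        by (simp add: algebra_simps fun_eq_iff)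
      then show "l2_norm \<Omega> (\<lambda>x. (p j x + r * p' j x) - (q x + r * q' x)) \<le>
          l2_norm \<Omega> (\<lambda>x. p j x - q x) + \<bar>r\<bar> * l2_norm \<Omega> (\<lambda>x. p' j x - q' x)"
        using l2_norm_triangle[OF d(1) L2_cmult[OF d(2), of r]] by (simp only: l2_norm_cmult)
    qed
    have "(\<lambda>j. l2_norm \<Omega> (\<lambda>x. p j x - q x) + \<bar>r\<bar> * l2_norm \<Omega> (\<lambda>x. p' j x - q' x)) \<longlonglongrightarrow> 0 + \<bar>r\<bar> * 0"
      by (intro tendsto_intros p p')
    then show "(\<lambda>j. l2_norm \<Omega> (\<lambda>x. p j x - q x) + \<bar>r\<bar> * l2_norm \<Omega> (\<lambda>x. p' j x - q' x)) \<longlonglongrightarrow> 0"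
      by simp
  qed simp
  have gr: "grad (\<lambda>x. f j x + r * f' j x) x $ i = grad (f j) x $ i + r * grad (f' j) x $ i" for j x i
    using C1c_differentiable[OF f(1)] C1c_differentiable[OF f'(1)]
    by (simp add: grad_add grad_cmult)
  show ?thesis
    unfolding h10_pair_def
  proof (intro conjI allI exI[of _ "\<lambda>j x. f j x + r * f' j x"])
    show "(\<lambda>x. u x + r * v x) \<in> L2 \<Omega>"
      by (intro L2_add L2_cmult h10_pairD(1)[OF u] h10_pairD(1)[OF v])
    show "(\<lambda>x. (g x + r *\<^sub>R h x) $ i) \<in> L2 \<Omega>" for i
      unfolding vector_add_component vector_scaleR_component
      by (simp only: real_scaleR_def) (intro L2_add L2_cmult h10_pairD(2)[OF u] h10_pairD(2)[OF v])
    show "C1c \<Omega> (\<lambda>x. f j x + r * f' j x)" for j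
      by (intro C1c_add C1c_cmult f f')
    show "(\<lambda>j. l2_norm \<Omega> (\<lambda>x. f j x + r * f' j x - (u x + r * v x))) \<longlonglongrightarrow> 0"
      by (rule lim[OF f(4) h10_pairD(1)[OF u] f(2) f'(4) h10_pairD(1)[OF v] f'(2)])
    show "(\<lambda>j. l2_norm \<Omega> (\<lambda>x. grad (\<lambda>x. f j x + r * f' j x) x $ i - (g x + r *\<^sub>R h x) $ i)) \<longlonglongrightarrow> 0" for i
      using lim[OF f(5) h10_pairD(2)[OF u] f(3) f'(5) h10_pairD(2)[OF v] f'(3), of i i]
      by (simp add: gr)
  qed
qed

lemma h10_pair_zero: "h10_pair \<Omega> (\<lambda>x. 0) (\<lambda>x. 0)"
  unfolding h10_pair_def
  by (auto intro!: exI[of _ "\<lambda>j x. 0"] C1c_zero L2_zero simp: grad_zero l2_norm_eq)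

lemma h10_pair_sum:
  fixes \<Omega> :: "(real^'d) set" and n :: nat
  assumes "open \<Omega>" "\<And>l. l < n \<Longrightarrow> h10_pair \<Omega> (u l) (g l)"
  shows "h10_pair \<Omega> (\<lambda>x. \<Sum>l<n. c l * u l x) (\<lambda>x. \<Sum>l<n. c l *\<^sub>R g l x)"
  using assms(2)
proof (induction n)
  case (Suc n)
  then show ?case
    using h10_pair_linear[OF assms(1) Suc.IH, of "u n" "g n" "c n"] by simp
qed (simp add: h10_pair_zero)

lemma const_one_L2:
  fixes \<Omega> :: "(real^'d) set"
  assumes "open \<Omega>" "bounded \<Omega>"
  shows "(\<lambda>x. 1 :: real) \<in> L2 \<Omega>"
proof -
  have "emeasure lebesgue \<Omega> < \<infinity>"
    using emeasure_bounded_finite[OF assms(2)] assms(1) by (simp add: emeasure_completion)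
  then show ?thesis
    using assms(1) by (simp add: L2_real_iff integrable_restrict_space)
qed

lemma h10_grad_swap:
  fixes \<Omega> :: "(real^'d) set"
  assumes \<Omega>: "open \<Omega>" and u: "h10_pair \<Omega> u g" and v: "h10_pair \<Omega> v h"
  shows "(LINT x|lebesgue_on \<Omega>. g x $ i * h x $ k) = (LINT x|lebesgue_on \<Omega>. g x $ k * h x $ i)"
proof -
  obtain f where f: "\<And>j. C1c \<Omega> (f j)" "(\<lambda>j. l2_norm \<Omega> (\<lambda>x. f j x - u x)) \<longlonglongrightarrow> 0"
    "\<And>i. (\<lambda>j. l2_norm \<Omega> (\<lambda>x. grad (f j) x $ i - g x $ i)) \<longlonglongrightarrow> 0"
    "\<And>j. f j \<in> L2 \<Omega>" "\<And>i j. (\<lambda>x. grad (f j) x $ i) \<in> L2 \<Omega>"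
    by (rule h10_pair_approx[OF \<Omega> u]) (rule that)
  obtain f' where f': "\<And>j. C1c \<Omega> (f' j)" "(\<lambda>j. l2_norm \<Omega> (\<lambda>x. f' j x - v x)) \<longlonglongrightarrow> 0"
    "\<And>i. (\<lambda>j. l2_norm \<Omega> (\<lambda>x. grad (f' j) x $ i - h x $ i)) \<longlonglongrightarrow> 0"
    "\<And>j. f' j \<in> L2 \<Omega>" "\<And>i j. (\<lambda>x. grad (f' j) x $ i) \<in> L2 \<Omega>"
    by (rule h10_pair_approx[OF \<Omega> v]) (rule that)
  have lim: "(\<lambda>j. LINT x|lebesgue_on \<Omega>. 1 * grad (f j) x $ i * grad (f' j) x $ k)
      \<longlonglongrightarrow> (LINT x|lebesgue_on \<Omega>. 1 * g x $ i * h x $ k)" for i k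
    by (rule l2_limit[where B=1, OF _ _ f(5) h10_pairD(2)[OF u] f(3) f'(5) h10_pairD(2)[OF v] f'(3)]) auto
  have "(LINT x|lebesgue_on \<Omega>. 1 * grad (f j) x $ i * grad (f' j) x $ k) =
      (LINT x|lebesgue_on \<Omega>. 1 * grad (f j) x $ k * grad (f' j) x $ i)" for j
    using C1c_integral_grad_swap[OF \<Omega> f(1) f'(1), of j i j k] by simp
  from LIMSEQ_unique[OF lim[of i k, unfolded this] lim[of k i]] show ?thesis by simp
qed

section \<open>Poincare inequality and skew-symmetry of the convection term\<close>

lemma C1_on_coordinate: "C1_on S (\<lambda>x :: real^'d. x $ i)"
  and grad_coordinate: "grad (\<lambda>x :: real^'d. x $ i) x $ k = (if k = i then 1 else 0)"
proof -
  have d: "((\<lambda>x. x $ i) has_derivative (\<lambda>x. x $ i)) (at x)" for x :: "real^'d"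
    by (rule bounded_linear_imp_has_derivative[OF bounded_linear_vec_nth])
  show g: "grad (\<lambda>x :: real^'d. x $ i) x $ k = (if k = i then 1 else 0)" for x k
    unfolding grad_eq[OF d] by (simp add: axis_def)
  show "C1_on S (\<lambda>x :: real^'d. x $ i)"
    unfolding C1_on_def g using d by (auto simp: differentiable_def)
qed

lemma borel_measurable_lebesgue_on_continuous:
  fixes w :: "real^'d \<Rightarrow> real"
  shows "open \<Omega> \<Longrightarrow> continuous_on \<Omega> w \<Longrightarrow> w \<in> borel_measurable (lebesgue_on \<Omega>)"
  by (rule continuous_imp_measurable_on_sets_lebesgue) auto

text \<open>The derivative of \<open>x $ i * f x * f x\<close> in direction i integrates to 0, so
  the integral of the square of f is -2 times that of \<open>x $ i * f x * grad f x $ i\<close>. As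
  \<open>\<bar>x $ i\<bar> \<le> R\<close>, Cauchy-Schwarz and division by one norm of u yield the
  constant \<open>2 * \<bar>R\<bar>\<close>.\<close>

lemma Poincare_inequality:
  fixes \<Omega> :: "(real^'d) set"
  assumes \<Omega>: "open \<Omega>" and R: "\<And>x. x \<in> \<Omega> \<Longrightarrow> norm x \<le> R" and u: "h10_pair \<Omega> u g"
  shows "l2_norm \<Omega> u \<le> 2 * \<bar>R\<bar> * l2_norm \<Omega> (\<lambda>x. g x $ i)"
proof -
  obtain f where f: "\<And>j. C1c \<Omega> (f j)" "(\<lambda>j. l2_norm \<Omega> (\<lambda>x. f j x - u x)) \<longlonglongrightarrow> 0"
    "\<And>i. (\<lambda>j. l2_norm \<Omega> (\<lambda>x. grad (f j) x $ i - g x $ i)) \<longlonglongrightarrow> 0"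
    "\<And>j. f j \<in> L2 \<Omega>" "\<And>i j. (\<lambda>x. grad (f j) x $ i) \<in> L2 \<Omega>"
    by (rule h10_pair_approx[OF \<Omega> u]) (rule that)
  have w: "(\<lambda>x. x $ i) \<in> borel_measurable (lebesgue_on \<Omega>)" "AE x in lebesgue_on \<Omega>. \<bar>x $ i\<bar> \<le> R"
    using R component_le_norm_cart[of _ i] \<Omega>
    by (auto intro!: borel_measurable_lebesgue_on_continuous AE_I2 continuous_intros) (meson order_trans)
  have lim1: "(\<lambda>j. LINT x|lebesgue_on \<Omega>. 1 * f j x * f j x) \<longlonglongrightarrow> (LINT x|lebesgue_on \<Omega>. 1 * u x * u x)"
    by (rule l2_limit[where B=1, OF _ _ f(4) h10_pairD(1)[OF u] f(2) f(4) h10_pairD(1)[OF u] f(2)]) auto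
  have lim2: "(\<lambda>j. LINT x|lebesgue_on \<Omega>. x $ i * f j x * grad (f j) x $ i)
      \<longlonglongrightarrow> (LINT x|lebesgue_on \<Omega>. x $ i * u x * g x $ i)"
    by (rule l2_limit[OF w f(4) h10_pairD(1)[OF u] f(2) f(5) h10_pairD(2)[OF u] f(3)])
  have eq: "(LINT x|lebesgue_on \<Omega>. 1 * f j x * f j x) = -2 * (LINT x|lebesgue_on \<Omega>. x $ i * f j x * grad (f j) x $ i)" for j
  proof -
    have fd: "f j differentiable (at x)" "(\<lambda>x::real^'d. x $ i) differentiable (at x)" for x
      using C1c_differentiable[OF f(1)] C1_on_coordinate[of UNIV i] by (auto simp: C1_on_def)
    have "C1_on \<Omega> (\<lambda>x. x $ i * f j x)"
      using f(1)[of j] by (intro C1_on_mult C1_on_coordinate) (auto simp: C1c_def intro: C1_on_subset)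
    then have "C1c \<Omega> (\<lambda>x. x $ i * f j x * f j x)"
      by (rule C1c_mult_weight[OF \<Omega> _ f(1)])
    from C1c_integral_grad[OF \<Omega> this, of i]
    have "0 = (LINT x|lebesgue_on \<Omega>. f j x * f j x + 2 * (x $ i * f j x * grad (f j) x $ i))"
      using fd by (simp add: grad_mult grad_coordinate algebra_simps)
    also have "\<dots> = (LINT x|lebesgue_on \<Omega>. f j x * f j x) + 2 * (LINT x|lebesgue_on \<Omega>. x $ i * f j x * grad (f j) x $ i)"
      using L2_mult_integrable[OF f(4) f(4), of j j] L2_mult_integrable[OF L2_bounded_mult[OF w f(4)] f(5)]
      by simp
    finally show ?thesis by simp
  qed
  have "(LINT x|lebesgue_on \<Omega>. 1 * u x * u x) = -2 * (LINT x|lebesgue_on \<Omega>. x $ i * u x * g x $ i)"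
    by (rule LIMSEQ_unique[OF lim1]) (unfold eq, intro tendsto_mult tendsto_const lim2)
  then have "(l2_norm \<Omega> u)\<^sup>2 = -2 * (LINT x|lebesgue_on \<Omega>. x $ i * u x * g x $ i)"
    unfolding l2_norm_sq by (simp add: power2_eq_square)
  also have "\<dots> \<le> 2 * (\<bar>R\<bar> * l2_norm \<Omega> u * l2_norm \<Omega> (\<lambda>x. g x $ i))"
    using weighted_Cauchy_Schwarz[OF w h10_pairD(1)[OF u] h10_pairD(2)[OF u], of i] by linarith
  finally have "l2_norm \<Omega> u * l2_norm \<Omega> u \<le> (2 * \<bar>R\<bar> * l2_norm \<Omega> (\<lambda>x. g x $ i)) * l2_norm \<Omega> u"
    by (simp add: power2_eq_square mult_ac)
  then show ?thesis
    using l2_norm_nonneg[of \<Omega> u] by (cases "l2_norm \<Omega> u = 0") (auto simp: mult_le_cancel_right less_le)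
qed

lemma convection_fieldD:
  fixes a :: "real^'d \<Rightarrow> real^'d"
  assumes \<Omega>: "open \<Omega>" and a: "convection_field \<Omega> a"
  shows "C1_on \<Omega> (\<lambda>x. a x $ k)" "\<And>x. x \<in> \<Omega> \<Longrightarrow> (\<Sum>k\<in>UNIV. grad (\<lambda>x. a x $ k) x $ k) = 0"
    "(\<lambda>x. a x $ k) \<in> borel_measurable (lebesgue_on \<Omega>)"
    "AE x in lebesgue_on \<Omega>. norm (a x) \<le> 1" "AE x in lebesgue_on \<Omega>. \<bar>a x $ k\<bar> \<le> 1"
proof -
  have "Ck_on 1 \<Omega> a" using a by (simp add: convection_field_def smooth_on_def)
  then have d: "\<And>x. x \<in> \<Omega> \<Longrightarrow> a differentiable (at x)"
    and c: "\<And>i. continuous_on \<Omega> (\<lambda>x. frechet_derivative a (at x) (axis i 1))" by auto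
  have dk: "((\<lambda>x. a x $ k) has_derivative (\<lambda>v. frechet_derivative a (at x) v $ k)) (at x)" if "x \<in> \<Omega>" for x k
    using d[OF that] by (intro bounded_linear.has_derivative[OF bounded_linear_vec_nth])
      (simp add: frechet_derivative_works)
  have g: "grad (\<lambda>x. a x $ k) x $ i = frechet_derivative a (at x) (axis i 1) $ k" if "x \<in> \<Omega>" for x k i
    by (rule grad_eq[OF dk[OF that]])
  show C1: "C1_on \<Omega> (\<lambda>x. a x $ k)" for k
    unfolding C1_on_def
  proof (intro conjI ballI allI)
    show "(\<lambda>x. a x $ k) differentiable (at x)" if "x \<in> \<Omega>" for x
      using dk[OF that] by (auto simp: differentiable_def)
    show "continuous_on \<Omega> (\<lambda>x. grad (\<lambda>x. a x $ k) x $ i)" for i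
      by (rule continuous_on_eq[OF continuous_on_component[OF c[of i], of k]]) (simp add: g)
  qed
  show "(\<Sum>k\<in>UNIV. grad (\<lambda>x. a x $ k) x $ k) = 0" if "x \<in> \<Omega>" for x
    using a that by (simp add: g convection_field_def)
  show "(\<lambda>x. a x $ k) \<in> borel_measurable (lebesgue_on \<Omega>)"
    by (rule borel_measurable_lebesgue_on_continuous[OF \<Omega> C1_on_continuous[OF C1]])
  have "AE x in lebesgue_on \<Omega>. ereal (norm (a x)) \<le> 1"
    using esssup_AE[of "\<lambda>x. ereal (norm (a x))" "lebesgue_on \<Omega>"] a by (simp add: convection_field_def)
  then show b: "AE x in lebesgue_on \<Omega>. norm (a x) \<le> 1" by simp
  then show "AE x in lebesgue_on \<Omega>. \<bar>a x $ k\<bar> \<le> 1"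
    by eventually_elim (metis component_le_norm_cart order_trans)
qed

text \<open>The field a f f' has compact support, so its divergence integrates to 0. The product
  rule leaves div a times f f', which vanishes only after summation over k; hence the identity holds
  for the sum.\<close>

lemma convection_skew:
  fixes \<Omega> :: "(real^'d) set"
  assumes \<Omega>: "open \<Omega>" and a: "convection_field \<Omega> a" and u: "h10_pair \<Omega> u g" and v: "h10_pair \<Omega> v h"
  shows "(\<Sum>k\<in>UNIV. LINT x|lebesgue_on \<Omega>. a x $ k * g x $ k * v x) =
    - (\<Sum>k\<in>UNIV. LINT x|lebesgue_on \<Omega>. a x $ k * u x * h x $ k)"
proof -
  note A = convection_fieldD[OF \<Omega> a]
  obtain f where f: "\<And>j. C1c \<Omega> (f j)" "(\<lambda>j. l2_norm \<Omega> (\<lambda>x. f j x - u x)) \<longlonglongrightarrow> 0"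
    "\<And>i. (\<lambda>j. l2_norm \<Omega> (\<lambda>x. grad (f j) x $ i - g x $ i)) \<longlonglongrightarrow> 0"
    "\<And>j. f j \<in> L2 \<Omega>" "\<And>i j. (\<lambda>x. grad (f j) x $ i) \<in> L2 \<Omega>"
    by (rule h10_pair_approx[OF \<Omega> u]) (rule that)
  obtain f' where f': "\<And>j. C1c \<Omega> (f' j)" "(\<lambda>j. l2_norm \<Omega> (\<lambda>x. f' j x - v x)) \<longlonglongrightarrow> 0"
    "\<And>i. (\<lambda>j. l2_norm \<Omega> (\<lambda>x. grad (f' j) x $ i - h x $ i)) \<longlonglongrightarrow> 0"
    "\<And>j. f' j \<in> L2 \<Omega>" "\<And>i j. (\<lambda>x. grad (f' j) x $ i) \<in> L2 \<Omega>"
    by (rule h10_pair_approx[OF \<Omega> v]) (rule that)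
  have lim1: "(\<lambda>j. \<Sum>k\<in>UNIV. LINT x|lebesgue_on \<Omega>. a x $ k * grad (f j) x $ k * f' j x)
      \<longlonglongrightarrow> (\<Sum>k\<in>UNIV. LINT x|lebesgue_on \<Omega>. a x $ k * g x $ k * v x)"
    by (intro tendsto_sum l2_limit[OF A(3,5) f(5) h10_pairD(2)[OF u] f(3) f'(4) h10_pairD(1)[OF v] f'(2)])
  have lim2: "(\<lambda>j. \<Sum>k\<in>UNIV. LINT x|lebesgue_on \<Omega>. a x $ k * f j x * grad (f' j) x $ k)
      \<longlonglongrightarrow> (\<Sum>k\<in>UNIV. LINT x|lebesgue_on \<Omega>. a x $ k * u x * h x $ k)"
    by (intro tendsto_sum l2_limit[OF A(3,5) f(4) h10_pairD(1)[OF u] f(2) f'(5) h10_pairD(2)[OF v] f'(3)])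
  have eq: "(\<Sum>k\<in>UNIV. LINT x|lebesgue_on \<Omega>. a x $ k * grad (f j) x $ k * f' j x) =
      - (\<Sum>k\<in>UNIV. LINT x|lebesgue_on \<Omega>. a x $ k * f j x * grad (f' j) x $ k)" for j
  proof -
    have fd: "f j differentiable (at x)" "f' j differentiable (at x)" for x
      using C1c_differentiable[OF f(1)] C1c_differentiable[OF f'(1)] by auto
    have ad: "(\<lambda>x. a x $ k) differentiable (at x)" if "x \<in> \<Omega>" for x k
      using A(1)[of k] that by (simp add: C1_on_def)
    let ?F = "\<lambda>k x. a x $ k * f j x * f' j x"
    have "C1_on \<Omega> (\<lambda>x. a x $ k * f j x)" for k
      using f(1)[of j] by (intro C1_on_mult A(1)) (auto simp: C1c_def intro: C1_on_subset)
    then have C: "C1c \<Omega> (?F k)" for k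
      by (rule C1c_mult_weight[OF \<Omega> _ f'(1)])
    have gr: "grad (?F k) x $ k = grad (\<lambda>x. a x $ k) x $ k * (f j x * f' j x) +
        (a x $ k * grad (f j) x $ k * f' j x + a x $ k * f j x * grad (f' j) x $ k)" if "x \<in> \<Omega>" for k x
      using fd ad[OF that] by (simp add: grad_mult algebra_simps)
    have int: "integrable (lebesgue_on \<Omega>) (\<lambda>x. a x $ k * grad (f j) x $ k * f' j x)"
      "integrable (lebesgue_on \<Omega>) (\<lambda>x. a x $ k * f j x * grad (f' j) x $ k)" for k
      by (rule L2_mult_integrable[OF L2_bounded_mult[OF A(3,5) f(5)] f'(4)]
        L2_mult_integrable[OF L2_bounded_mult[OF A(3,5) f(4)] f'(5)])+
    have "grad (?F k) x = 0" if "x \<notin> \<Omega>" for k x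
      using that C1c_support[OF C[of k]] by (metis subsetD)
    then have z: "x \<notin> \<Omega> \<Longrightarrow> grad (?F k) x $ k = 0" for k x by simp
    have i: "integrable lborel (\<lambda>x. grad (?F k) x $ k)" for k
      using C1c_mult_grad(1)[OF C[of k], of "\<lambda>x. 1" k] by simp
    have intF: "integrable (lebesgue_on \<Omega>) (\<lambda>x. grad (?F k) x $ k)" for k
      by (rule lebesgue_on_lborel(2)[OF \<Omega> borel_measurable_continuous_onI[OF C1c_continuous_grad[OF C]] z i])
    have "0 = (\<Sum>k\<in>UNIV. LINT x|lebesgue_on \<Omega>. grad (?F k) x $ k)"
      using C1c_integral_grad[OF \<Omega> C] by simp
    also have "\<dots> = (LINT x|lebesgue_on \<Omega>. (\<Sum>k\<in>UNIV. grad (?F k) x $ k))"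
      using intF by simp
    also have "\<dots> = (LINT x|lebesgue_on \<Omega>. (\<Sum>k\<in>UNIV. a x $ k * grad (f j) x $ k * f' j x + a x $ k * f j x * grad (f' j) x $ k))"
    proof (rule Bochner_Integration.integral_cong[OF refl])
      fix x assume "x \<in> space (lebesgue_on \<Omega>)"
      then have x: "x \<in> \<Omega>" by simp
      show "(\<Sum>k\<in>UNIV. grad (?F k) x $ k) = (\<Sum>k\<in>UNIV. a x $ k * grad (f j) x $ k * f' j x + a x $ k * f j x * grad (f' j) x $ k)"
        unfolding gr[OF x] sum.distrib sum_distrib_right[symmetric] A(2)[OF x] by simp
    qed
    also have "\<dots> = (\<Sum>k\<in>UNIV. LINT x|lebesgue_on \<Omega>. a x $ k * grad (f j) x $ k * f' j x) +
        (\<Sum>k\<in>UNIV. LINT x|lebesgue_on \<Omega>. a x $ k * f j x * grad (f' j) x $ k)"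
      using int by (simp add: sum.distrib)
    finally show ?thesis by simp
  qed
  show ?thesis
    by (rule LIMSEQ_unique[OF lim1]) (unfold eq, intro tendsto_minus lim2)
qed

section \<open>Uniqueness of the gradient\<close>

text \<open>Squaring makes the function continuously differentiable at 0, and
  \<open>ramp (n * t)\<close> converges boundedly to the indicator of the positive
  half-line.\<close>

definition ramp :: "real \<Rightarrow> real" where
  "ramp t = (max 0 t)\<^sup>2 / (1 + (max 0 t)\<^sup>2)"

lemma ramp_derivative: "(ramp has_real_derivative 2 * max 0 t / (1 + (max 0 t)\<^sup>2)\<^sup>2) (at t)"
proof -
  have "((\<lambda>t. (max 0 t)\<^sup>2) has_real_derivative 2 * max 0 t) (at t)"
  proof (cases "t = 0")
    case True
    have "(\<lambda>h. ((max 0 h)\<^sup>2) / h) \<midarrow>0\<rightarrow> (0::real)"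
    proof (rule Lim_null_comparison)
      show "\<forall>\<^sub>F h :: real in at 0. norm ((max 0 h)\<^sup>2 / h) \<le> \<bar>h\<bar>"
        by (intro always_eventually allI) (auto simp: max_def power2_eq_square)
      show "(\<lambda>h :: real. \<bar>h\<bar>) \<midarrow>0\<rightarrow> 0" by (rule tendsto_rabs_zero) (rule tendsto_ident_at)
    qed
    with True show ?thesis by (simp add: DERIV_def)
  next
    case False
    show ?thesis
    proof (cases "0 < t")
      case True
      have "((\<lambda>t. t\<^sup>2) has_real_derivative 2 * t) (at t)" by (auto intro!: derivative_eq_intros)
      then have "((\<lambda>t. (max 0 t)\<^sup>2) has_real_derivative 2 * t) (at t)"
        by (rule has_field_derivative_transform_within_open[of _ _ _ "{0<..}"]) (use True in auto)
      with True show ?thesis by (simp add: max_absorb2)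
    next
      case neg: False
      have "((\<lambda>t. 0) has_real_derivative 0) (at t)" by simp
      then have "((\<lambda>t. (max 0 t)\<^sup>2) has_real_derivative 0) (at t)"
        by (rule has_field_derivative_transform_within_open[of _ _ _ "{..<0}"]) (use False neg in auto)
      with neg show ?thesis by (simp add: max_absorb1)
    qed
  qed
  note d = this
  have nz: "1 + (max 0 t)\<^sup>2 \<noteq> 0" by (rule not_sym, rule less_imp_neq, rule add_pos_nonneg) auto
  have "((\<lambda>t. 1 + (max 0 t)\<^sup>2) has_real_derivative 0 + 2 * max 0 t) (at t)"
    by (intro DERIV_add DERIV_const d)
  from DERIV_divide[OF d this nz] show ?thesis
    unfolding ramp_def[abs_def] by (rule DERIV_cong) (simp add: power2_eq_square algebra_simps)
qed

lemma ramp_bounds: "0 \<le> ramp t" "ramp t \<le> 1"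
  by (auto simp: ramp_def divide_simps add_pos_nonneg)

lemma ramp_tendsto: "(\<lambda>n. ramp (real n * t)) \<longlonglongrightarrow> indicat_real {0<..} t"
proof (cases "0 < t")
  case True
  have "(\<lambda>n. (real n * t)\<^sup>2 / (1 + (real n * t)\<^sup>2)) \<longlonglongrightarrow> 1"
    using True by real_asymp
  with True show ?thesis by (simp add: ramp_def max_def)
next
  case False
  then have "max 0 (real n * t) = 0" for n
    using mult_nonneg_nonpos[of "real n" t] by (simp add: max_absorb1)
  with False show ?thesis by (simp add: ramp_def)
qed

lemma C1_on_ramp:
  fixes a :: "real^'d"
  shows "C1_on UNIV (\<lambda>x. ramp (r * (x $ k - a $ k)))"
proof -
  let ?D = "\<lambda>t. 2 * max 0 t / (1 + (max 0 t)\<^sup>2)\<^sup>2"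
  have d: "((\<lambda>x. ramp (r * (x $ k - a $ k))) has_derivative (\<lambda>v. ?D (r * (x $ k - a $ k)) * (r * v $ k))) (at x)" for x :: "real^'d"
  proof -
    have "((\<lambda>x. x $ k) has_derivative (\<lambda>v. v $ k)) (at x)"
      by (rule bounded_linear_imp_has_derivative[OF bounded_linear_vec_nth])
    then have i: "((\<lambda>x. r * (x $ k - a $ k)) has_derivative (\<lambda>v. r * v $ k)) (at x)"
      by (auto intro!: derivative_eq_intros)
    have "(ramp has_derivative (*) (?D (r * (x $ k - a $ k)))) (at (r * (x $ k - a $ k)))"
      using ramp_derivative by (simp add: has_field_derivative_def)
    from diff_chain_at[OF i this] show ?thesis by (simp add: o_def)
  qed
  have nz: "1 + (max 0 t)\<^sup>2 \<noteq> 0" for t :: real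
    by (rule not_sym, rule less_imp_neq, rule add_pos_nonneg) auto
  have "continuous_on UNIV (\<lambda>x :: real^'d. ?D (r * (x $ k - a $ k)) * (r * axis i 1 $ k))" for i :: 'd
    by (intro continuous_intros continuous_on_max continuous_on_component continuous_on_id) (simp add: nz)
  then show ?thesis
    unfolding C1_on_def grad_eq[OF d] using d by (auto simp: differentiable_def)
qed

lemma C1_on_prod: "finite I \<Longrightarrow> (\<And>k. k \<in> I \<Longrightarrow> C1_on S (f k)) \<Longrightarrow> C1_on S (\<lambda>x. \<Prod>k\<in>I. f k x)"
  by (induction I rule: finite_induct) (auto intro: C1_on_const C1_on_mult)

lemma borel_eq_orthants: "borel = sigma UNIV (range (\<lambda>a :: real^'d. {x. \<forall>k. a $ k < x $ k}))"
proof -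
  have "{x. eucl_less a x} = {x :: real^'d. \<forall>k. a $ k < x $ k}" for a
    by (auto simp: eucl_less_def Basis_vec_def inner_axis)
  then show ?thesis
    using borel_eq_greaterThan[where 'a="real^'d"] by simp
qed

text \<open>Products of dilated ramps converge boundedly to indicators of open orthants. These sets
  form an intersection-stable generator of the Borel sets, so the integral over every Borel set
  vanishes, in particular over the sets where a Borel representative has one sign.\<close>

lemma AE_zero_if_orthogonal_C1:
  fixes \<Omega> :: "(real^'d) set" and g :: "real^'d \<Rightarrow> real"
  assumes \<Omega>: "open \<Omega>" and g: "integrable (lebesgue_on \<Omega>) g"
    and orth: "\<And>\<phi>. C1_on UNIV \<phi> \<Longrightarrow> (LINT x|lebesgue_on \<Omega>. \<phi> x * g x) = 0"
  shows "AE x in lebesgue_on \<Omega>. g x = 0"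
proof -
  \<comment> \<open>Extension by zero, so that Borel sets of the whole space can be used.\<close>
  define f where "f x = indicat_real \<Omega> x * g x" for x
  have \<Omega>': "\<Omega> \<inter> space lebesgue \<in> sets lebesgue" using \<Omega> by simp
  have f: "integrable lebesgue f"
    using g unfolding f_def integrable_restrict_space[OF \<Omega>'] by simp
  have to_f: "(LINT x|lebesgue_on \<Omega>. \<phi> x * g x) = (LINT x|lebesgue. \<phi> x * f x)" for \<phi>
    unfolding f_def integral_restrict_space[OF \<Omega>'] by (simp add: mult_ac)
  have orthant: "(LINT x|lebesgue. indicat_real {x. \<forall>k. a $ k < x $ k} x * f x) = 0" for a :: "real^'d"
  proof -
    let ?\<phi> = "\<lambda>n x :: real^'d. \<Prod>k\<in>UNIV. ramp (real n * (x $ k - a $ k))"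
    have C1: "C1_on UNIV (?\<phi> n)" for n
      by (intro C1_on_prod C1_on_ramp) simp
    have m: "?\<phi> n \<in> borel_measurable lebesgue" for n
      using borel_measurable_continuous_onI[OF C1_on_continuous[OF C1]] by (intro measurable_completion) simp
    have open_orthant: "open {x :: real^'d. \<forall>k. a $ k < x $ k}"
    proof -
      have "{x :: real^'d. \<forall>k. a $ k < x $ k} = (\<Inter>k. {x. a $ k < x $ k})" by auto
      then show ?thesis
        by (simp only:) (intro open_INT ballI finite open_Collect_less continuous_intros)
    qed
    have lim: "(\<lambda>n. LINT x|lebesgue. ?\<phi> n x * f x) \<longlonglongrightarrow> (LINT x|lebesgue. indicat_real {x. \<forall>k. a $ k < x $ k} x * f x)"
    proof (rule integral_dominated_convergence[where w="\<lambda>x. \<bar>f x\<bar>"])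
      show "AE x in lebesgue. (\<lambda>n. ?\<phi> n x * f x) \<longlonglongrightarrow> indicat_real {x. \<forall>k. a $ k < x $ k} x * f x"
      proof (intro AE_I2 tendsto_mult tendsto_const)
        fix x :: "real^'d"
        have "(\<lambda>n. ?\<phi> n x) \<longlonglongrightarrow> (\<Prod>k\<in>UNIV. indicat_real {0<..} (x $ k - a $ k))"
          by (intro tendsto_prod ramp_tendsto)
        moreover have "(\<Prod>k\<in>UNIV. indicat_real {0<..} (x $ k - a $ k)) = indicat_real {x. \<forall>k. a $ k < x $ k} x"
          by (auto simp: indicator_def prod_zero_iff not_less)
        ultimately show "(\<lambda>n. ?\<phi> n x) \<longlonglongrightarrow> indicat_real {x. \<forall>k. a $ k < x $ k} x" by simp
      qed
      show "AE x in lebesgue. norm (?\<phi> n x * f x) \<le> \<bar>f x\<bar>" for n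
      proof (rule AE_I2)
        fix x :: "real^'d"
        have "\<bar>?\<phi> n x\<bar> \<le> 1"
          by (auto simp: abs_prod ramp_bounds intro!: prod_le_1)
        then have "\<bar>?\<phi> n x\<bar> * \<bar>f x\<bar> \<le> 1 * \<bar>f x\<bar>" by (intro mult_right_mono) auto
        then show "norm (?\<phi> n x * f x) \<le> \<bar>f x\<bar>" by (simp add: abs_mult)
      qed
      show "(\<lambda>x. indicat_real {x. \<forall>k. a $ k < x $ k} x * f x) \<in> borel_measurable lebesgue"
        using f open_orthant by (intro borel_measurable_times borel_measurable_indicator) auto
      show "(\<lambda>x. ?\<phi> n x * f x) \<in> borel_measurable lebesgue" for n
        using f by (intro borel_measurable_times m) auto
    qed (use f in auto)
    have zero: "(LINT x|lebesgue. ?\<phi> n x * f x) = 0" for n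
      using orth[OF C1] by (simp only: to_f)
    show ?thesis
      using LIMSEQ_unique[OF lim[unfolded zero] tendsto_const] by simp
  qed
  have borel: "(LINT x|lebesgue. indicat_real S x * f x) = 0" if "S \<in> sets borel" for S
  proof -
    let ?G = "range (\<lambda>a :: real^'d. {x. \<forall>k. a $ k < x $ k})"
    have gen: "sets (borel :: (real^'d) measure) = sigma_sets UNIV ?G"
      by (subst borel_eq_orthants) simp
    have int: "integrable lebesgue (\<lambda>x. indicat_real A x * f x)" if "A \<in> sets borel" for A
      using integrable_mult_indicator[of A lebesgue f] f that by simp
    have S: "S \<in> sigma_sets UNIV ?G" using that by (simp add: gen)
    show ?thesis
      using _ _ S
    proof (rule sigma_sets_induct_disjoint)
      show "Int_stable ?G"
      proof (rule Int_stableI_image)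
        fix a b :: "real^'d"
        have "{x. \<forall>k. a $ k < x $ k} \<inter> {x. \<forall>k. b $ k < x $ k} = {x. \<forall>k. (\<chi> k. max (a $ k) (b $ k)) $ k < x $ k}"
          by auto
        then show "\<exists>c\<in>UNIV. {x. \<forall>k. a $ k < x $ k} \<inter> {x. \<forall>k. b $ k < x $ k} = {x. \<forall>k. c $ k < x $ k}"
          by blast
      qed
    next
      fix A assume "A \<in> sigma_sets UNIV ?G" and IH: "(LINT x|lebesgue. indicat_real A x * f x) = 0"
      then have "A \<in> sets borel" by (simp add: gen)
      \<comment> \<open>Complements need the total integral to vanish, which is orthogonality to the
        constant 1.\<close>
      have "(LINT x|lebesgue. f x) = 0"
        using orth[OF C1_on_const[of _ 1]] to_f[of "\<lambda>x. 1"] by simp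
      moreover have "(LINT x|lebesgue. indicat_real (UNIV - A) x * f x) = (LINT x|lebesgue. f x - indicat_real A x * f x)"
        by (intro Bochner_Integration.integral_cong) (auto simp: indicator_def)
      ultimately show "(LINT x|lebesgue. indicat_real (UNIV - A) x * f x) = 0"
        using IH f int[OF \<open>A \<in> sets borel\<close>] by simp
    next
      fix A :: "nat \<Rightarrow> (real^'d) set"
      assume A: "disjoint_family A" "range A \<subseteq> sigma_sets UNIV ?G"
        and IH: "\<And>i. (LINT x|lebesgue. indicat_real (A i) x * f x) = 0"
      have sets: "A i \<in> sets lebesgue" "A i \<in> sets borel" for i
        using A(2) by (auto simp: gen[symmetric])
      have "set_integrable lebesgue (\<Union>i. A i) f"
        unfolding set_integrable_def using int[of "\<Union>i. A i"] sets(2) by auto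
      from lebesgue_integral_countable_add[OF sets(1) _ this]
      show "(LINT x|lebesgue. indicat_real (\<Union>i. A i) x * f x) = 0"
        using A(1) IH by (simp add: disjoint_family_on_def set_lebesgue_integral_def)
    qed (auto simp: orthant)
  qed
  \<comment> \<open>f is only Lebesgue measurable, so the sets where it has one sign need not be
    Borel; those of h are.\<close>
  obtain h where h: "h \<in> borel_measurable lborel" "AE x in lborel. f x = h x"
    using completion_ex_borel_measurable_real[of f lborel] f by auto
  have fh: "AE x in lebesgue. f x = h x" by (rule AE_completion[OF h(2)])
  have h_int: "integrable lebesgue h"
    using f fh h(1) by (subst integrable_cong_AE[of _ _ f]) (auto intro: measurable_completion)
  \<comment> \<open>The factor s is 1 or -1 in the two applications and makes the integrand
    nonnegative, so that a zero integral forces it to vanish.\<close>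
  have "AE x in lebesgue. indicat_real {x. P (h x)} x * h x = 0"
    if P: "{x. P (h x)} \<in> sets borel" and s: "\<And>x. P x \<Longrightarrow> 0 \<le> s * x" and "s \<noteq> 0" for P and s :: real
  proof -
    let ?k = "\<lambda>x. s * (indicat_real {x. P (h x)} x * h x)"
    have int: "integrable lebesgue ?k"
      using integrable_mult_indicator[of "{x. P (h x)}" lebesgue h] h_int P by simp
    have "(LINT x|lebesgue. indicat_real {x. P (h x)} x * h x) = (LINT x|lebesgue. indicat_real {x. P (h x)} x * f x)"
      using fh P f h(1) by (intro integral_cong_AE) (auto intro!: borel_measurable_times intro: measurable_completion elim: eventually_mono)
    then have "(LINT x|lebesgue. ?k x) = 0" using borel[OF P] by simp
    then have "AE x in lebesgue. ?k x = 0"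
      using int s by (subst (asm) integral_nonneg_eq_0_iff_AE) (auto simp: indicator_def)
    then show ?thesis using \<open>s \<noteq> 0\<close> by simp
  qed
  note vanish = this
  have m: "{x. 0 \<le> h x} \<in> sets borel" "{x. h x \<le> 0} \<in> sets borel"
    using h(1) by measurable
  have "AE x in lebesgue. indicat_real {x. 0 \<le> h x} x * h x = 0"
    "AE x in lebesgue. indicat_real {x. h x \<le> 0} x * h x = 0"
    using vanish[OF m(1), of 1] vanish[OF m(2), of "-1"] by simp_all
  with fh have "AE x in lebesgue. f x = 0"
    by eventually_elim (auto simp: indicator_def split: if_splits)
  then show ?thesis
    using \<Omega> by (subst AE_restrict_space_iff) (auto simp: f_def elim!: eventually_mono)
qed

lemma bounded_continuous_L2:
  fixes \<Omega> :: "(real^'d) set"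
  assumes \<Omega>: "open \<Omega>" "bounded \<Omega>" and \<phi>: "continuous_on UNIV (\<phi> :: real^'d \<Rightarrow> real)"
  shows "\<phi> \<in> L2 \<Omega>"
proof -
  have "compact (closure \<Omega>)" using \<Omega>(2) by simp
  then have "bounded (\<phi> ` closure \<Omega>)"
    by (intro compact_imp_bounded compact_continuous_image continuous_on_subset[OF \<phi>]) auto
  then obtain B where B: "\<And>x. x \<in> \<Omega> \<Longrightarrow> \<bar>\<phi> x\<bar> \<le> B"
    using closure_subset by (force simp: bounded_iff)
  have "(\<lambda>x. \<phi> x * 1) \<in> L2 \<Omega>"
    by (rule L2_bounded_mult[OF _ _ const_one_L2[OF \<Omega>]])
      (use B in \<open>auto intro!: AE_I2 borel_measurable_lebesgue_on_continuous \<Omega> continuous_on_subset[OF \<phi>]\<close>)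
  then show ?thesis by simp
qed

text \<open>The approximants have compact support, so for every \<open>C1\<close> function \<phi>,
  without any condition at the boundary, the integral of \<phi> times a component of g is minus that
  of u times a derivative of \<phi>, hence 0. For the difference of a velocity and its basis
  expansion this shows that the two gradients agree almost everywhere.\<close>

lemma h10_gradient_unique:
  fixes \<Omega> :: "(real^'d) set"
  assumes \<Omega>: "open \<Omega>" "bounded \<Omega>" and u: "h10_pair \<Omega> u g" and u0: "AE x in lebesgue_on \<Omega>. u x = 0"
  shows "AE x in lebesgue_on \<Omega>. g x = 0"
proof -
  obtain f where f: "\<And>j. C1c \<Omega> (f j)" "(\<lambda>j. l2_norm \<Omega> (\<lambda>x. f j x - u x)) \<longlonglongrightarrow> 0"
    "\<And>i. (\<lambda>j. l2_norm \<Omega> (\<lambda>x. grad (f j) x $ i - g x $ i)) \<longlonglongrightarrow> 0"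
    "\<And>j. f j \<in> L2 \<Omega>" "\<And>i j. (\<lambda>x. grad (f j) x $ i) \<in> L2 \<Omega>"
    by (rule h10_pair_approx[OF \<Omega>(1) u]) (rule that)
  have "AE x in lebesgue_on \<Omega>. g x $ i = 0" for i
  proof (rule AE_zero_if_orthogonal_C1[OF \<Omega>(1)])
    show "integrable (lebesgue_on \<Omega>) (\<lambda>x. g x $ i)"
      using L2_mult_integrable[OF h10_pairD(2)[OF u] const_one_L2[OF \<Omega>], of i] by simp
    fix \<phi> :: "real^'d \<Rightarrow> real" assume \<phi>: "C1_on UNIV \<phi>"
    have L: "\<phi> \<in> L2 \<Omega>" "(\<lambda>x. grad \<phi> x $ i) \<in> L2 \<Omega>"
      using \<phi> C1_on_continuous[OF \<phi>] by (auto simp: C1_on_def intro!: bounded_continuous_L2 \<Omega>)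
    have const: "(\<lambda>j :: nat. l2_norm \<Omega> (\<lambda>x. \<psi> x - \<psi> x)) \<longlonglongrightarrow> 0" for \<psi> :: "real^'d \<Rightarrow> real"
      by (simp add: l2_norm_eq)
    have lim1: "(\<lambda>j. LINT x|lebesgue_on \<Omega>. 1 * \<phi> x * grad (f j) x $ i) \<longlonglongrightarrow> (LINT x|lebesgue_on \<Omega>. 1 * \<phi> x * g x $ i)"
      by (rule l2_limit[where B=1, OF _ _ L(1) L(1) const f(5) h10_pairD(2)[OF u] f(3)]) auto
    have lim2: "(\<lambda>j. LINT x|lebesgue_on \<Omega>. 1 * grad \<phi> x $ i * f j x) \<longlonglongrightarrow> (LINT x|lebesgue_on \<Omega>. 1 * grad \<phi> x $ i * u x)"
      by (rule l2_limit[where B=1, OF _ _ L(2) L(2) const f(4) h10_pairD(1)[OF u] f(2)]) auto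
    have eq: "(LINT x|lebesgue_on \<Omega>. 1 * \<phi> x * grad (f j) x $ i) = - (LINT x|lebesgue_on \<Omega>. 1 * grad \<phi> x $ i * f j x)" for j
    proof -
      have "C1c \<Omega> (\<lambda>x. \<phi> x * f j x)"
        using \<phi> by (intro C1c_mult_weight[OF \<Omega>(1) _ f(1)]) (auto intro: C1_on_subset)
      from C1c_integral_grad[OF \<Omega>(1) this, of i]
      have "0 = (LINT x|lebesgue_on \<Omega>. \<phi> x * grad (f j) x $ i + grad \<phi> x $ i * f j x)"
        using \<phi> C1c_differentiable[OF f(1)] by (simp add: grad_mult C1_on_def)
      then show ?thesis
        using L2_mult_integrable[OF L(1) f(5)] L2_mult_integrable[OF L(2) f(4)] by simp
    qed
    have "(LINT x|lebesgue_on \<Omega>. 1 * \<phi> x * g x $ i) = - (LINT x|lebesgue_on \<Omega>. 1 * grad \<phi> x $ i * u x)"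
      by (rule LIMSEQ_unique[OF lim1]) (unfold eq, intro tendsto_minus lim2)
    also have "(LINT x|lebesgue_on \<Omega>. 1 * grad \<phi> x $ i * u x) = 0"
      using u0 by (intro integral_eq_zero_AE) (auto elim: eventually_mono)
    finally show "(LINT x|lebesgue_on \<Omega>. \<phi> x * g x $ i) = 0" by simp
  qed
  then show ?thesis
    by (simp add: Finite_Cartesian_Product.vec_eq_iff AE_all_countable)
qed

section \<open>Matrices\<close>

definition trivial_kernel :: "nat \<Rightarrow> real mat \<Rightarrow> bool" where
  "trivial_kernel n F \<longleftrightarrow> F \<in> carrier_mat n n \<and>
     (\<forall>v \<in> carrier_vec n. F *\<^sub>v v = 0\<^sub>v n \<longrightarrow> v = 0\<^sub>v n)"

text \<open>A trivial kernel gives a nonzero determinant, so \<open>mat_inverse\<close> returns a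
  matrix and \<open>inv_mat\<close> is a genuine inverse.\<close>

lemma inv_matD:
  assumes inj: "trivial_kernel n F"
  shows "invertible_mat F" "inv_mat F \<in> carrier_mat n n"
    "F * inv_mat F = 1\<^sub>m n" "inv_mat F * F = 1\<^sub>m n"
proof -
  have F: "F \<in> carrier_mat n n" using inj by (simp add: trivial_kernel_def)
  have "det F \<noteq> 0"
    using inj det_0_iff_vec_prod_zero[OF F] unfolding trivial_kernel_def by blast
  then obtain G where G: "mat_inverse F = Some G"
    using det_non_zero_imp_unit[OF F, of "()"] mat_inverse(1)[OF F, of "()"] by fastforce
  from mat_inverse(2)[OF F G]
  show "inv_mat F \<in> carrier_mat n n" "F * inv_mat F = 1\<^sub>m n" "inv_mat F * F = 1\<^sub>m n"
    by (auto simp: inv_mat_def G)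
  then show "invertible_mat F"
    using F unfolding invertible_mat_def inverts_mat_def square_mat.simps by (metis carrier_matD)
qed

lemma inv_mat_mult_vec:
  assumes inj: "trivial_kernel n F"
    and v: "v \<in> carrier_vec n"
  shows "F *\<^sub>v (inv_mat F *\<^sub>v v) = v" "inv_mat F *\<^sub>v (F *\<^sub>v v) = v" "inv_mat F *\<^sub>v v \<in> carrier_vec n"
proof -
  have F: "F \<in> carrier_mat n n" using inj by (simp add: trivial_kernel_def)
  note I = inv_matD[OF inj]
  show "F *\<^sub>v (inv_mat F *\<^sub>v v) = v"
    by (subst assoc_mult_mat_vec[OF F I(2) v, symmetric]) (use I(3) v in auto)
  show "inv_mat F *\<^sub>v (F *\<^sub>v v) = v"
    by (subst assoc_mult_mat_vec[OF I(2) F v, symmetric]) (use I(4) v in auto)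
  show "inv_mat F *\<^sub>v v \<in> carrier_vec n"
    using I(2) v by auto
qed

lemma scalar_prod_mult_transpose:
  fixes F :: "real mat"
  assumes F: "F \<in> carrier_mat nr nc" and x: "x \<in> carrier_vec nc" and y: "y \<in> carrier_vec nr"
  shows "(F *\<^sub>v x) \<bullet>\<^sub>v y = x \<bullet>\<^sub>v (transpose_mat F *\<^sub>v y)"
proof -
  have "(F *\<^sub>v x) \<bullet>\<^sub>v y = y \<bullet>\<^sub>v (F *\<^sub>v x)"
    using F x y by (intro comm_scalar_prod[where n=nr]) auto
  also have "\<dots> = (transpose_mat F *\<^sub>v y) \<bullet>\<^sub>v x"
    using transpose_vec_mult_scalar[OF F x y] by simp
  also have "\<dots> = x \<bullet>\<^sub>v (transpose_mat F *\<^sub>v y)"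
    using F x y by (intro comm_scalar_prod[where n=nc]) auto
  finally show ?thesis .
qed

lemma carrier_vec_appendE:
  assumes "z \<in> carrier_vec (n + m)"
  obtains v q where "z = v @\<^sub>v q" "v \<in> carrier_vec n" "q \<in> carrier_vec m"
  using assms by (metis vec_first_last_append vec_first_carrier vec_last_carrier)

lemma smult_mat_mult_vec:
  fixes F :: "real mat"
  assumes "F \<in> carrier_mat nr nc" "x \<in> carrier_vec nc"
  shows "(k \<cdot>\<^sub>m F) *\<^sub>v x = k \<cdot>\<^sub>v (F *\<^sub>v x)"
  using assms by (intro eq_vecI) (auto simp: scalar_prod_def sum_distrib_left mult.assoc)

lemma zero_mult_mat_vec:
  fixes x :: "real Matrix.vec"
  shows "x \<in> carrier_vec nc \<Longrightarrow> 0\<^sub>m nr nc *\<^sub>v x = 0\<^sub>v nr"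
  by (intro eq_vecI) (auto simp: scalar_prod_def)

lemma mult_mat_vec_uminus:
  fixes F :: "real mat"
  assumes "F \<in> carrier_mat nr nc" "x \<in> carrier_vec nc"
  shows "F *\<^sub>v (- x) = - (F *\<^sub>v x)"
  using assms by (intro eq_vecI) (auto simp: scalar_prod_def sum_negf)

lemma eq_mat_on_vecI:
  fixes F G :: "real mat"
  assumes F: "F \<in> carrier_mat nr nc" and G: "G \<in> carrier_mat nr nc"
    and eq: "\<And>x. x \<in> carrier_vec nc \<Longrightarrow> F *\<^sub>v x = G *\<^sub>v x"
  shows "F = G"
proof (rule eq_matI)
  fix i j assume "i < dim_row G" "j < dim_col G"
  then have ij: "i < nr" "j < nc" using G by auto
  then have "vec_index (F *\<^sub>v unit_vec nc j) i = vec_index (G *\<^sub>v unit_vec nc j) i"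
    using eq[of "unit_vec nc j"] by simp
  then show "F $$ (i, j) = G $$ (i, j)"
    using F G ij by simp
qed (use F G in auto)

lemma append_vec_eq_zero_iff:
  assumes "v \<in> carrier_vec n" "q \<in> carrier_vec m"
  shows "v @\<^sub>v q = 0\<^sub>v (n + m) \<longleftrightarrow> v = 0\<^sub>v n \<and> q = 0\<^sub>v m"
proof -
  have "0\<^sub>v (n + m) = 0\<^sub>v n @\<^sub>v (0\<^sub>v m :: 'a vec)"
    by (intro eq_vecI) auto
  then show ?thesis
    using assms append_vec_eq[of v n "0\<^sub>v n"] by auto
qed

lemma mu_eq_pairs:
  assumes "dim_row X = n + m"
  shows "mu W X = (INF (v, q)\<in>{(v, q). v \<in> carrier_vec n \<and> q \<in> carrier_vec m \<and> (v, q) \<noteq> (0\<^sub>v n, 0\<^sub>v m)}.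
    ip W (X *\<^sub>v (v @\<^sub>v q)) (v @\<^sub>v q) / ip W (v @\<^sub>v q) (v @\<^sub>v q))"
proof -
  let ?Z = "{(v, q). v \<in> carrier_vec n \<and> q \<in> carrier_vec m \<and> (v, q) \<noteq> (0\<^sub>v n, 0\<^sub>v m :: real vec)}"
  have "{z \<in> carrier_vec (dim_row X). z \<noteq> 0\<^sub>v (dim_row X)} = (\<lambda>(v, q). v @\<^sub>v q) ` ?Z"
    unfolding assms
    by (auto simp: image_iff append_vec_eq_zero_iff elim!: carrier_vec_appendE)
  then show ?thesis
    unfolding mu_def by (simp add: image_image case_prod_unfold)
qed

section \<open>Residuals of GMRES\<close>

lemma poly_mat_mult_vec:
  assumes X: "X \<in> carrier_mat n n" and v: "v \<in> carrier_vec n" and i: "i < n"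
  shows "vec_index (poly_mat p X *\<^sub>v v) i = (\<Sum>l\<le>degree p. coeff p l * vec_index ((X ^\<^sub>m l) *\<^sub>v v) i)"
proof -
  have P: "X ^\<^sub>m l \<in> carrier_mat n n" for l using X by simp
  have row: "(\<Sum>j = 0..<n. (X ^\<^sub>m l) $$ (i, j) * vec_index v j) = vec_index ((X ^\<^sub>m l) *\<^sub>v v) i" for l
    using carrier_matD[OF P[of l]] v i by (simp add: scalar_prod_def)
  have "vec_index (poly_mat p X *\<^sub>v v) i =
      (\<Sum>j = 0..<n. (\<Sum>l\<le>degree p. coeff p l * (X ^\<^sub>m l) $$ (i, j)) * vec_index v j)"
    using X v i by (auto simp: poly_mat_def scalar_prod_def intro!: sum.cong)
  also have "\<dots> = (\<Sum>j = 0..<n. \<Sum>l\<le>degree p. coeff p l * ((X ^\<^sub>m l) $$ (i, j) * vec_index v j))"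
    by (simp add: sum_distrib_right mult.assoc)
  also have "\<dots> = (\<Sum>l\<le>degree p. coeff p l * (\<Sum>j = 0..<n. (X ^\<^sub>m l) $$ (i, j) * vec_index v j))"
    by (subst sum.swap) (simp add: sum_distrib_left)
  finally show ?thesis by (simp add: row)
qed

lemma poly_mat_mult_vec_bound:
  assumes X: "X \<in> carrier_mat n n" and v: "v \<in> carrier_vec n" and i: "i < n" and d: "degree p \<le> d"
  shows "vec_index (poly_mat p X *\<^sub>v v) i = (\<Sum>l\<le>d. coeff p l * vec_index ((X ^\<^sub>m l) *\<^sub>v v) i)"
  unfolding poly_mat_mult_vec[OF X v i]
  by (intro sum.mono_neutral_left) (use d in \<open>auto simp: coeff_eq_0\<close>)

lemma pow_mat_Suc:
  fixes X :: "real mat"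
  assumes X: "X \<in> carrier_mat n n"
  shows "X ^\<^sub>m Suc l = X * X ^\<^sub>m l"
proof (induction l)
  case (Suc l)
  have P: "X ^\<^sub>m l \<in> carrier_mat n n" using X by simp
  have "X ^\<^sub>m Suc (Suc l) = X * X ^\<^sub>m l * X" using Suc by simp
  also have "\<dots> = X * X ^\<^sub>m Suc l" using assoc_mult_mat[OF X P X] by simp
  finally show ?case .
qed (use X in simp)

lemma poly_mat_linear_factor:
  assumes X: "X \<in> carrier_mat n n" and v: "v \<in> carrier_vec n"
  shows "poly_mat ([:1, - a:] * p) X *\<^sub>v v =
    poly_mat p X *\<^sub>v v - a \<cdot>\<^sub>v (X *\<^sub>v (poly_mat p X *\<^sub>v v))"
proof (rule eq_vecI)
  have PM: "poly_mat q X \<in> carrier_mat n n" for q using X by (simp add: poly_mat_def)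
  fix i assume "i < dim_vec (poly_mat p X *\<^sub>v v - a \<cdot>\<^sub>v (X *\<^sub>v (poly_mat p X *\<^sub>v v)))"
  then have i: "i < n" using X by simp
  let ?u = "\<lambda>l. vec_index ((X ^\<^sub>m l) *\<^sub>v v)"
  let ?d = "Suc (degree p)"
  have Xu: "(\<Sum>j = 0..<n. X $$ (i, j) * ?u l j) = ?u (Suc l) i" for l
  proof -
    have "(X ^\<^sub>m Suc l) *\<^sub>v v = X *\<^sub>v ((X ^\<^sub>m l) *\<^sub>v v)"
      using assoc_mult_mat_vec[OF X pow_carrier_mat[OF X] v] by (simp only: pow_mat_Suc[OF X])
    then show ?thesis
      using X i by (auto simp: scalar_prod_def intro!: sum.cong)
  qed
  have "vec_index (X *\<^sub>v (poly_mat p X *\<^sub>v v)) i =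
      (\<Sum>j = 0..<n. X $$ (i, j) * vec_index (poly_mat p X *\<^sub>v v) j)"
    using X PM[of p] i by (auto simp: scalar_prod_def intro!: sum.cong)
  also have "\<dots> = (\<Sum>j = 0..<n. X $$ (i, j) * (\<Sum>l\<le>degree p. coeff p l * ?u l j))"
    by (intro sum.cong) (auto simp: poly_mat_mult_vec[OF X v])
  also have "\<dots> = (\<Sum>l\<le>degree p. coeff p l * (\<Sum>j = 0..<n. X $$ (i, j) * ?u l j))"
    unfolding sum_distrib_left by (subst sum.swap) (simp add: mult_ac)
  finally have XP: "vec_index (X *\<^sub>v (poly_mat p X *\<^sub>v v)) i = (\<Sum>l\<le>degree p. coeff p l * ?u (Suc l) i)"
    unfolding Xu .
  have deg: "degree ([:1, - a:] * p) \<le> ?d"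
    by (rule order_trans[OF degree_mult_le]) auto
  have "vec_index (poly_mat ([:1, - a:] * p) X *\<^sub>v v) i = (\<Sum>l\<le>?d. coeff ([:1, - a:] * p) l * ?u l i)"
    by (rule poly_mat_mult_vec_bound[OF X v i deg])
  \<comment> \<open>The coefficient of degree l in the product is that of p minus \<open>a\<close>
    times the preceding one, which is 0 for l = 0; the bound \<open>?d\<close> leaves room for the
    shift.\<close>
  also have "\<dots> = (\<Sum>l\<le>?d. coeff p l * ?u l i) - a * (\<Sum>l\<le>?d. (case l of 0 \<Rightarrow> 0 | Suc l \<Rightarrow> coeff p l) * ?u l i)"
    unfolding sum_distrib_left sum_subtractf[symmetric]
    by (intro sum.cong) (auto simp: coeff_pCons algebra_simps split: nat.splits)
  also have "(\<Sum>l\<le>?d. coeff p l * ?u l i) = vec_index (poly_mat p X *\<^sub>v v) i"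
    by (rule poly_mat_mult_vec_bound[OF X v i, symmetric]) simp
  also have "(\<Sum>l\<le>?d. (case l of 0 \<Rightarrow> 0 | Suc l \<Rightarrow> coeff p l) * ?u l i) = (\<Sum>l\<le>degree p. coeff p l * ?u (Suc l) i)"
    by (subst sum.atMost_Suc_shift) simp
  finally show "vec_index (poly_mat ([:1, - a:] * p) X *\<^sub>v v) i =
      vec_index (poly_mat p X *\<^sub>v v - a \<cdot>\<^sub>v (X *\<^sub>v (poly_mat p X *\<^sub>v v))) i"
    using X PM[of p] i XP by simp
qed (use X in \<open>auto simp: poly_mat_def\<close>)

text \<open>One GMRES step does at least as well as the factor \<open>1 - \<alpha> x\<close>.\<close>

lemma gmres_contraction:
  assumes X: "K * inv_mat P \<in> carrier_mat N N" and r0: "b - K *\<^sub>v x0 \<in> carrier_vec N"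
    and red: "\<And>z. z \<in> carrier_vec N \<Longrightarrow> nrm W (z - \<alpha> \<cdot>\<^sub>v ((K * inv_mat P) *\<^sub>v z)) \<le> \<rho> * nrm W z"
    and "0 \<le> \<rho>" and r: "gmres_residuals W K P b x0 r"
  shows "nrm W (r j) \<le> \<rho> ^ j * nrm W (r 0)"
proof (induction j)
  case (Suc j)
  let ?X = "K * inv_mat P"
  have r0': "r 0 \<in> carrier_vec N" using r r0 by (simp add: gmres_residuals_def)
  obtain p where p: "degree p \<le> j" "poly p 0 = 1" "r j = poly_mat p ?X *\<^sub>v r 0"
    using r unfolding gmres_residuals_def by blast
  \<comment> \<open>With p the polynomial of \<open>r j\<close>, the product is admissible for the
    next residual, and its value is \<open>r j\<close> after one step of fixed length
    \<alpha>.\<close>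
  have "degree ([:1, - \<alpha>:] * p) \<le> Suc j"
    by (rule order_trans[OF degree_mult_le]) (use p(1) in auto)
  moreover have "poly ([:1, - \<alpha>:] * p) 0 = 1" using p(2) by simp
  ultimately have "nrm W (r (Suc j)) \<le> nrm W (poly_mat ([:1, - \<alpha>:] * p) ?X *\<^sub>v r 0)"
    using r unfolding gmres_residuals_def by blast
  also have "\<dots> = nrm W (r j - \<alpha> \<cdot>\<^sub>v (?X *\<^sub>v r j))"
    unfolding p(3) poly_mat_linear_factor[OF X r0'] ..
  also have "\<dots> \<le> \<rho> * nrm W (r j)"
    using X unfolding p(3) poly_mat_def by (intro red mult_mat_vec_carrier[where n=N] r0') auto
  also have "\<dots> \<le> \<rho> * (\<rho> ^ j * nrm W (r 0))"
    by (intro mult_left_mono Suc.IH \<open>0 \<le> \<rho>\<close>)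
  finally show ?case by simp
qed simp

section \<open>Block triangular preconditioning of a saddle point matrix\<close>

text \<open>In \<open>pressure_control\<close> the vector \<open>w\<close> is the adjoint velocity belonging to the pressure \<open>p\<close>:
  it absorbs the nonsymmetric off-diagonal terms of both fields of values.\<close>

locale saddle_point =
  fixes n m :: nat and A B C T :: "real mat" and \<tau> :: real
  assumes A [simp]: "A \<in> carrier_mat n n"
    and B [simp]: "B \<in> carrier_mat m n"
    and C [simp]: "C \<in> carrier_mat m m"
    and T [simp]: "T \<in> carrier_mat m m"
    and A_pos: "\<And>v. v \<in> carrier_vec n \<Longrightarrow> v \<noteq> 0\<^sub>v n \<Longrightarrow> 0 < A *\<^sub>v v \<bullet>\<^sub>v v"
    and C_sym: "transpose_mat C = C"
    and C_nonneg: "\<And>p. p \<in> carrier_vec m \<Longrightarrow> 0 \<le> C *\<^sub>v p \<bullet>\<^sub>v p"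
    and T_sym: "transpose_mat T = T"
    and T_pos: "\<And>p. p \<in> carrier_vec m \<Longrightarrow> p \<noteq> 0\<^sub>v m \<Longrightarrow> 0 < T *\<^sub>v p \<bullet>\<^sub>v p"
    and divergence_bound: "\<And>w p. w \<in> carrier_vec n \<Longrightarrow> p \<in> carrier_vec m \<Longrightarrow>
      2 * (B *\<^sub>v w \<bullet>\<^sub>v p) \<le> A *\<^sub>v w \<bullet>\<^sub>v w + (T *\<^sub>v p \<bullet>\<^sub>v p - C *\<^sub>v p \<bullet>\<^sub>v p)"
    and pressure_control: "\<And>w p. w \<in> carrier_vec n \<Longrightarrow> p \<in> carrier_vec m \<Longrightarrow>
      transpose_mat A *\<^sub>v w = transpose_mat B *\<^sub>v p \<Longrightarrow>
      \<tau> * (T *\<^sub>v p \<bullet>\<^sub>v p) \<le> A *\<^sub>v w \<bullet>\<^sub>v w / 2 + C *\<^sub>v p \<bullet>\<^sub>v p"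
    and tau_pos: "0 < \<tau>" and tau_le: "\<tau> \<le> 1 / 2"
begin

definition As where "As = (1/2) \<cdot>\<^sub>m (A + transpose_mat A)"
definition K where "K = four_block_mat A (transpose_mat B) B (- C)"
definition S where "S = B * inv_mat A * transpose_mat B + C"
definition E where "E = four_block_mat As (0\<^sub>m n m) (0\<^sub>m m n) T"
definition W where "W = inv_mat E"
definition P where "P = four_block_mat A (transpose_mat B) (0\<^sub>m m n) (- T)"
text \<open>\<open>L\<close> and \<open>R\<close> will turn out to be \<open>K * inv_mat P\<close>
  and \<open>P * inv_mat K\<close>, hence inverse to each other.\<close>

definition L where "L = four_block_mat (1\<^sub>m n) (0\<^sub>m n m) (B * inv_mat A) (S * inv_mat T)"
definition R where "R = four_block_mat (1\<^sub>m n) (0\<^sub>m n m)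
  (- (T * inv_mat S * B * inv_mat A)) (T * inv_mat S)"

lemma carriers [simp]:
  "transpose_mat A \<in> carrier_mat n n" "transpose_mat B \<in> carrier_mat n m" "As \<in> carrier_mat n n"
  "K \<in> carrier_mat (n + m) (n + m)" "P \<in> carrier_mat (n + m) (n + m)"
  "E \<in> carrier_mat (n + m) (n + m)"
  by (auto simp: As_def K_def P_def E_def)

lemma mult_carriers [simp]:
  "v \<in> carrier_vec n \<Longrightarrow> A *\<^sub>v v \<in> carrier_vec n"
  "v \<in> carrier_vec n \<Longrightarrow> transpose_mat A *\<^sub>v v \<in> carrier_vec n"
  "v \<in> carrier_vec n \<Longrightarrow> As *\<^sub>v v \<in> carrier_vec n"
  "v \<in> carrier_vec n \<Longrightarrow> B *\<^sub>v v \<in> carrier_vec m"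
  "p \<in> carrier_vec m \<Longrightarrow> transpose_mat B *\<^sub>v p \<in> carrier_vec n"
  "p \<in> carrier_vec m \<Longrightarrow> C *\<^sub>v p \<in> carrier_vec m"
  "p \<in> carrier_vec m \<Longrightarrow> T *\<^sub>v p \<in> carrier_vec m"
  by (rule mult_mat_vec_carrier[rotated], assumption, simp)+

lemma A_form: "v \<in> carrier_vec n \<Longrightarrow> u \<in> carrier_vec n \<Longrightarrow>
    A *\<^sub>v v \<bullet>\<^sub>v u = v \<bullet>\<^sub>v (transpose_mat A *\<^sub>v u)"
  and B_form: "v \<in> carrier_vec n \<Longrightarrow> p \<in> carrier_vec m \<Longrightarrow>
    B *\<^sub>v v \<bullet>\<^sub>v p = v \<bullet>\<^sub>v (transpose_mat B *\<^sub>v p)"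
  by (rule scalar_prod_mult_transpose[OF A] scalar_prod_mult_transpose[OF B], assumption+)+

lemma C_form: "q \<in> carrier_vec m \<Longrightarrow> p \<in> carrier_vec m \<Longrightarrow> C *\<^sub>v q \<bullet>\<^sub>v p = q \<bullet>\<^sub>v (C *\<^sub>v p)"
  and T_form: "q \<in> carrier_vec m \<Longrightarrow> p \<in> carrier_vec m \<Longrightarrow> T *\<^sub>v q \<bullet>\<^sub>v p = q \<bullet>\<^sub>v (T *\<^sub>v p)"
  using scalar_prod_mult_transpose[OF C, of q p] scalar_prod_mult_transpose[OF T, of q p]
  by (auto simp: C_sym T_sym)

lemma As_mult: "v \<in> carrier_vec n \<Longrightarrow> As *\<^sub>v v = (1/2) \<cdot>\<^sub>v (A *\<^sub>v v + transpose_mat A *\<^sub>v v)"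
  unfolding As_def
  by (subst smult_mat_mult_vec[where nr=n and nc=n]) (auto simp: add_mult_distrib_mat_vec[where nr=n and nc=n])

lemma As_form:
  assumes [simp]: "v \<in> carrier_vec n" "u \<in> carrier_vec n"
  shows "As *\<^sub>v v \<bullet>\<^sub>v u = (A *\<^sub>v v \<bullet>\<^sub>v u + A *\<^sub>v u \<bullet>\<^sub>v v) / 2"
proof -
  have "transpose_mat A *\<^sub>v v \<bullet>\<^sub>v u = A *\<^sub>v u \<bullet>\<^sub>v v"
    using transpose_vec_mult_scalar[OF A, of u v] by (simp add: comm_scalar_prod[of v n])
  then show ?thesis
    by (simp add: As_mult add_scalar_prod_distrib[where n=n] smult_scalar_prod_distrib[where n=n])
qed

lemma As_sym: "v \<in> carrier_vec n \<Longrightarrow> u \<in> carrier_vec n \<Longrightarrow> As *\<^sub>v v \<bullet>\<^sub>v u = v \<bullet>\<^sub>v (As *\<^sub>v u)"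
  by (simp add: As_form comm_scalar_prod[of v n "As *\<^sub>v u"])

lemma A_nonneg: "v \<in> carrier_vec n \<Longrightarrow> 0 \<le> A *\<^sub>v v \<bullet>\<^sub>v v"
  using A_pos[of v] by (cases "v = 0\<^sub>v n") auto

text \<open>Nonnegativity of the form at v + u and at v - u. \<open>As\<close> appears only in the
  mixed term, since \<open>A\<close> and \<open>As\<close> have the same quadratic form.\<close>

lemma As_young:
  assumes [simp]: "v \<in> carrier_vec n" "u \<in> carrier_vec n"
  shows "2 * \<bar>As *\<^sub>v v \<bullet>\<^sub>v u\<bar> \<le> A *\<^sub>v v \<bullet>\<^sub>v v + A *\<^sub>v u \<bullet>\<^sub>v u"
proof -
  have "0 \<le> A *\<^sub>v (v + u) \<bullet>\<^sub>v (v + u)" "0 \<le> A *\<^sub>v (v - u) \<bullet>\<^sub>v (v - u)"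
    by (intro A_nonneg; simp)+
  then show ?thesis
    by (simp add: abs_le_iff As_form mult_add_distrib_mat_vec[OF A] mult_minus_distrib_mat_vec[OF A]
      add_scalar_prod_distrib[where n=n] scalar_prod_add_distrib[where n=n]
      minus_scalar_prod_distrib[where n=n] scalar_prod_minus_distrib[where n=n])
qed

lemma A_inj: "v \<in> carrier_vec n \<Longrightarrow> A *\<^sub>v v = 0\<^sub>v n \<Longrightarrow> v = 0\<^sub>v n"
  using A_pos[of v] by fastforce

lemma At_inj: "v \<in> carrier_vec n \<Longrightarrow> transpose_mat A *\<^sub>v v = 0\<^sub>v n \<Longrightarrow> v = 0\<^sub>v n"
  using A_pos[of v] A_form[of v v] by fastforce

lemma As_inj: "v \<in> carrier_vec n \<Longrightarrow> As *\<^sub>v v = 0\<^sub>v n \<Longrightarrow> v = 0\<^sub>v n"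
  using A_pos[of v] As_form[of v v] by fastforce

lemma T_inj: "p \<in> carrier_vec m \<Longrightarrow> T *\<^sub>v p = 0\<^sub>v m \<Longrightarrow> p = 0\<^sub>v m"
  using T_pos[of p] by fastforce

text \<open>For such a pressure w = 0 is the adjoint velocity, and \<open>pressure_control\<close>
  bounds the positive form of \<open>T\<close> at p by 0.\<close>

lemma pressure_zero:
  assumes p: "p \<in> carrier_vec m" "transpose_mat B *\<^sub>v p = 0\<^sub>v n" "C *\<^sub>v p \<bullet>\<^sub>v p = 0"
  shows "p = 0\<^sub>v m"
proof (rule ccontr)
  assume "p \<noteq> 0\<^sub>v m"
  have At0: "transpose_mat A *\<^sub>v 0\<^sub>v n = 0\<^sub>v n" "A *\<^sub>v 0\<^sub>v n = 0\<^sub>v n"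
    by (auto intro!: eq_vecI simp: carrier_matD[OF A])
  have "\<tau> * (T *\<^sub>v p \<bullet>\<^sub>v p) \<le> 0"
    using pressure_control[of "0\<^sub>v n" p] p by (simp add: At0)
  moreover have "0 < \<tau> * (T *\<^sub>v p \<bullet>\<^sub>v p)"
    by (intro mult_pos_pos tau_pos T_pos p \<open>p \<noteq> 0\<^sub>v m\<close>)
  ultimately show False by simp
qed

lemma A_kernel: "trivial_kernel n A" and At_kernel: "trivial_kernel n (transpose_mat A)"
  and T_kernel: "trivial_kernel m T"
  unfolding trivial_kernel_def using A carriers(1) T A_inj At_inj T_inj by blast+

lemmas inv_A = inv_matD[OF A_kernel] and inv_A_vec = inv_mat_mult_vec[OF A_kernel]
lemmas inv_T = inv_matD[OF T_kernel] and inv_T_vec = inv_mat_mult_vec[OF T_kernel]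

section \<open>The Schur complement and adjoint velocities\<close>

lemma S_carrier [simp]: "S \<in> carrier_mat m m"
  unfolding S_def
  by (intro add_carrier_mat C mult_carrier_mat[OF mult_carrier_mat[OF B inv_A(2)] carriers(2)])

lemma S_mult: "p \<in> carrier_vec m \<Longrightarrow> S *\<^sub>v p = B *\<^sub>v (inv_mat A *\<^sub>v (transpose_mat B *\<^sub>v p)) + C *\<^sub>v p"
proof -
  assume p: "p \<in> carrier_vec m"
  have BA: "B * inv_mat A \<in> carrier_mat m n" by (rule mult_carrier_mat[OF B inv_A(2)])
  show ?thesis
    unfolding S_def add_mult_distrib_mat_vec[OF mult_carrier_mat[OF BA carriers(2)] C p]
      assoc_mult_mat_vec[OF BA carriers(2) p] assoc_mult_mat_vec[OF B inv_A(2) mult_carriers(5)[OF p]]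
    by (rule refl)
qed

lemma S_mult_carrier [simp]: "p \<in> carrier_vec m \<Longrightarrow> S *\<^sub>v p \<in> carrier_vec m"
  by (rule mult_mat_vec_carrier[OF S_carrier])

text \<open>If \<open>A *\<^sub>v u = transpose_mat B *\<^sub>v q\<close>, the forms B u . p, u .
  A^T w, A u . w and B w . q coincide. The adjoint velocity thus replaces the inverse of
  \<open>A\<close> inside \<open>S\<close>.\<close>

lemma S_form:
  assumes [simp]: "q \<in> carrier_vec m" "p \<in> carrier_vec m" "w \<in> carrier_vec n"
    and w: "transpose_mat A *\<^sub>v w = transpose_mat B *\<^sub>v p"
  shows "S *\<^sub>v q \<bullet>\<^sub>v p = B *\<^sub>v w \<bullet>\<^sub>v q + C *\<^sub>v q \<bullet>\<^sub>v p"
proof -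
  let ?u = "inv_mat A *\<^sub>v (transpose_mat B *\<^sub>v q)"
  have u [simp]: "?u \<in> carrier_vec n" and Au: "A *\<^sub>v ?u = transpose_mat B *\<^sub>v q"
    using inv_A_vec[of "transpose_mat B *\<^sub>v q"] by auto
  have "B *\<^sub>v ?u \<bullet>\<^sub>v p = A *\<^sub>v ?u \<bullet>\<^sub>v w"
    by (simp add: B_form A_form w)
  also have "\<dots> = B *\<^sub>v w \<bullet>\<^sub>v q"
    by (simp add: Au B_form comm_scalar_prod[of w n])
  finally show ?thesis
    by (simp add: S_mult add_scalar_prod_distrib[where n=m])
qed

lemma S_form_self:
  assumes [simp]: "p \<in> carrier_vec m" "w \<in> carrier_vec n"
    and w: "transpose_mat A *\<^sub>v w = transpose_mat B *\<^sub>v p"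
  shows "S *\<^sub>v p \<bullet>\<^sub>v p = A *\<^sub>v w \<bullet>\<^sub>v w + C *\<^sub>v p \<bullet>\<^sub>v p"
  using S_form[OF assms(1) assms] by (simp add: A_form B_form w)

lemma S_inv_A:
  assumes [simp]: "v \<in> carrier_vec n" "p \<in> carrier_vec m" "w \<in> carrier_vec n"
    and w: "transpose_mat A *\<^sub>v w = transpose_mat B *\<^sub>v p"
  shows "B *\<^sub>v (inv_mat A *\<^sub>v v) \<bullet>\<^sub>v p = v \<bullet>\<^sub>v w"
proof -
  have u [simp]: "inv_mat A *\<^sub>v v \<in> carrier_vec n" and Au: "A *\<^sub>v (inv_mat A *\<^sub>v v) = v"
    using inv_A_vec[of v] by auto
  show ?thesis
    using A_form[of "inv_mat A *\<^sub>v v" w] by (simp add: B_form w[symmetric] Au)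
qed

lemma adjoint_velocity:
  assumes "p \<in> carrier_vec m"
  obtains w where "w \<in> carrier_vec n" "transpose_mat A *\<^sub>v w = transpose_mat B *\<^sub>v p"
  using inv_mat_mult_vec(1,3)[OF At_kernel, of "transpose_mat B *\<^sub>v p"] assms that by auto

text \<open>By \<open>S_form_self\<close> the form of \<open>S\<close> at p is a sum of two
  nonnegative terms. Both vanish, so the adjoint velocity is 0 and with it
  \<open>transpose_mat B *\<^sub>v p\<close>.\<close>

lemma S_inj:
  assumes p: "p \<in> carrier_vec m" "S *\<^sub>v p = 0\<^sub>v m"
  shows "p = 0\<^sub>v m"
proof -
  obtain w where w: "w \<in> carrier_vec n" "transpose_mat A *\<^sub>v w = transpose_mat B *\<^sub>v p"
    using adjoint_velocity p(1) by blast
  have "A *\<^sub>v w \<bullet>\<^sub>v w + C *\<^sub>v p \<bullet>\<^sub>v p = 0"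
    using S_form_self[OF p(1) w] p by simp
  then have 0: "A *\<^sub>v w \<bullet>\<^sub>v w = 0" "C *\<^sub>v p \<bullet>\<^sub>v p = 0"
    using A_nonneg[OF w(1)] C_nonneg[OF p(1)] by auto
  then have "w = 0\<^sub>v n" using A_pos[OF w(1)] by fastforce
  then have "transpose_mat B *\<^sub>v p = 0\<^sub>v n"
    unfolding w(2)[symmetric] by (auto intro!: eq_vecI simp: carrier_matD[OF A])
  then show ?thesis using pressure_zero p 0 by blast
qed

lemma S_kernel: "trivial_kernel m S"
  unfolding trivial_kernel_def using S_carrier S_inj by blast

text \<open>The range of \<open>S\<close> is the whole space, and p is orthogonal to it.\<close>

lemma St_inj:
  assumes p: "p \<in> carrier_vec m" "transpose_mat S *\<^sub>v p = 0\<^sub>v m"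
  shows "p = 0\<^sub>v m"
proof -
  let ?x = "inv_mat S *\<^sub>v p"
  have x: "?x \<in> carrier_vec m" "S *\<^sub>v ?x = p"
    using inv_mat_mult_vec[OF S_kernel p(1)] by auto
  have "p \<bullet>\<^sub>v p = S *\<^sub>v ?x \<bullet>\<^sub>v p" using x by simp
  also have "\<dots> = 0" using scalar_prod_mult_transpose[OF S_carrier x(1) p(1)] p(2) x(1) by simp
  finally have "\<forall>i\<in>{0..<m}. vec_index p i * vec_index p i = 0"
    using p(1) by (subst sum_nonneg_eq_0_iff[symmetric]) (auto simp: scalar_prod_def)
  then show ?thesis
    using p(1) by (intro eq_vecI) auto
qed

lemmas inv_S = inv_matD[OF S_kernel] and inv_S_vec = inv_mat_mult_vec[OF S_kernel]

section \<open>The block matrices, their kernels and their products\<close>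

lemma E_mult: "u \<in> carrier_vec n \<Longrightarrow> p \<in> carrier_vec m \<Longrightarrow> E *\<^sub>v (u @\<^sub>v p) = (As *\<^sub>v u) @\<^sub>v (T *\<^sub>v p)"
  unfolding E_def by (rule mult_mat_vec_split) auto

lemma P_mult: "u \<in> carrier_vec n \<Longrightarrow> p \<in> carrier_vec m \<Longrightarrow>
    P *\<^sub>v (u @\<^sub>v p) = (A *\<^sub>v u + transpose_mat B *\<^sub>v p) @\<^sub>v (- (T *\<^sub>v p))"
  using uminus_mult_mat_vec[of p T] unfolding P_def
  by (subst four_block_mat_mult_vec[where ?nr1.0=n and ?nc1.0=n and ?nr2.0=m and ?nc2.0=m])
    (auto simp: zero_mult_mat_vec carrier_matD[OF T])

lemma K_mult: "u \<in> carrier_vec n \<Longrightarrow> p \<in> carrier_vec m \<Longrightarrow>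
    K *\<^sub>v (u @\<^sub>v p) = (A *\<^sub>v u + transpose_mat B *\<^sub>v p) @\<^sub>v (B *\<^sub>v u - C *\<^sub>v p)"
  using uminus_mult_mat_vec[of p C] unfolding K_def
  by (subst four_block_mat_mult_vec[where ?nr1.0=n and ?nc1.0=n and ?nr2.0=m and ?nc2.0=m])
    (auto simp: minus_add_uminus_vec[of _ m] carrier_matD[OF C])

lemma E_inj: "z \<in> carrier_vec (n + m) \<Longrightarrow> E *\<^sub>v z = 0\<^sub>v (n + m) \<Longrightarrow> z = 0\<^sub>v (n + m)"
  by (erule carrier_vec_appendE) (use As_inj T_inj in \<open>simp add: E_mult append_vec_eq_zero_iff\<close>)

lemma P_inj:
  assumes "z \<in> carrier_vec (n + m)" "P *\<^sub>v z = 0\<^sub>v (n + m)"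
  shows "z = 0\<^sub>v (n + m)"
proof -
  obtain u p where z: "z = u @\<^sub>v p" and [simp]: "u \<in> carrier_vec n" "p \<in> carrier_vec m"
    using carrier_vec_appendE[OF assms(1)] by blast
  have *: "A *\<^sub>v u + transpose_mat B *\<^sub>v p = 0\<^sub>v n" "- (T *\<^sub>v p) = 0\<^sub>v m"
    using assms(2) by (simp_all add: z P_mult append_vec_eq_zero_iff)
  have "T *\<^sub>v p = - (- (T *\<^sub>v p))" by simp
  also have "\<dots> = 0\<^sub>v m" unfolding *(2) by (intro eq_vecI) auto
  finally have p: "p = 0\<^sub>v m" by (rule T_inj[rotated]) simp
  have "transpose_mat B *\<^sub>v p = 0\<^sub>v n"
    unfolding p by (auto intro!: eq_vecI simp: carrier_matD[OF B])
  then have "u = 0\<^sub>v n"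
    using *(1) mult_carriers(1)[of u] A_inj[of u] by simp
  then show ?thesis by (simp add: z p append_vec_eq_zero_iff)
qed

text \<open>Testing the first row with u and the second with -p cancels the coupling terms and
  leaves a sum of two nonnegative terms.\<close>

lemma K_inj:
  assumes "z \<in> carrier_vec (n + m)" "K *\<^sub>v z = 0\<^sub>v (n + m)"
  shows "z = 0\<^sub>v (n + m)"
proof -
  obtain u p where z: "z = u @\<^sub>v p" and [simp]: "u \<in> carrier_vec n" "p \<in> carrier_vec m"
    using carrier_vec_appendE[OF assms(1)] by blast
  have *: "A *\<^sub>v u + transpose_mat B *\<^sub>v p = 0\<^sub>v n" "B *\<^sub>v u - C *\<^sub>v p = 0\<^sub>v m"
    using assms(2) by (simp_all add: z K_mult append_vec_eq_zero_iff)
  have "(A *\<^sub>v u + transpose_mat B *\<^sub>v p) \<bullet>\<^sub>v u = 0" "(B *\<^sub>v u - C *\<^sub>v p) \<bullet>\<^sub>v p = 0"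
    unfolding * by simp_all
  then have "A *\<^sub>v u \<bullet>\<^sub>v u + C *\<^sub>v p \<bullet>\<^sub>v p = 0"
    by (simp add: add_scalar_prod_distrib[where n=n] minus_scalar_prod_distrib[where n=m] B_form
      comm_scalar_prod[of u n])
  then have 0: "A *\<^sub>v u \<bullet>\<^sub>v u = 0" "C *\<^sub>v p \<bullet>\<^sub>v p = 0"
    using A_nonneg[of u] C_nonneg[of p] by auto
  then have u: "u = 0\<^sub>v n" using A_pos[of u] by fastforce
  have "A *\<^sub>v u = 0\<^sub>v n"
    unfolding u by (auto intro!: eq_vecI simp: carrier_matD[OF A])
  then have "transpose_mat B *\<^sub>v p = 0\<^sub>v n"
    using *(1) mult_carriers(5)[of p] by simp
  then show ?thesis using pressure_zero[of p] 0 by (simp add: z u append_vec_eq_zero_iff)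
qed

lemma E_kernel: "trivial_kernel (n + m) E" and P_kernel: "trivial_kernel (n + m) P"
  and K_kernel: "trivial_kernel (n + m) K"
  unfolding trivial_kernel_def using carriers(4-6) E_inj P_inj K_inj by blast+

lemmas inv_E = inv_matD[OF E_kernel] and inv_E_vec = inv_mat_mult_vec[OF E_kernel]
lemmas inv_P = inv_matD[OF P_kernel] and inv_P_vec = inv_mat_mult_vec[OF P_kernel]
lemmas inv_K = inv_matD[OF K_kernel] and inv_K_vec = inv_mat_mult_vec[OF K_kernel]

lemma L_carrier: "L \<in> carrier_mat (n + m) (n + m)" and R_carrier: "R \<in> carrier_mat (n + m) (n + m)"
  unfolding L_def R_def
  by (intro four_block_carrier_mat one_carrier_mat mult_carrier_mat[OF S_carrier inv_T(2)]
    mult_carrier_mat[OF T inv_S(2)])+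

lemma L_mult:
  assumes [simp]: "v \<in> carrier_vec n" "q \<in> carrier_vec m"
  shows "L *\<^sub>v (v @\<^sub>v q) = v @\<^sub>v (B *\<^sub>v (inv_mat A *\<^sub>v v) + S *\<^sub>v (inv_mat T *\<^sub>v q))"
proof -
  have c: "B * inv_mat A \<in> carrier_mat m n" "S * inv_mat T \<in> carrier_mat m m"
    by (rule mult_carrier_mat[OF B inv_A(2)] mult_carrier_mat[OF S_carrier inv_T(2)], assumption?)+
  show ?thesis
    unfolding L_def four_block_mat_mult_vec[OF one_carrier_mat zero_carrier_mat c assms]
      assoc_mult_mat_vec[OF B inv_A(2) assms(1)] assoc_mult_mat_vec[OF S_carrier inv_T(2) assms(2)]
    by (simp add: zero_mult_mat_vec)
qed

lemma R_mult:
  assumes [simp]: "v \<in> carrier_vec n" "q \<in> carrier_vec m"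
  shows "R *\<^sub>v (v @\<^sub>v q) = v @\<^sub>v (T *\<^sub>v (inv_mat S *\<^sub>v (q - B *\<^sub>v (inv_mat A *\<^sub>v v))))"
proof -
  have TS: "T * inv_mat S \<in> carrier_mat m m" by (rule mult_carrier_mat[OF T inv_S(2)])
  have TSB: "T * inv_mat S * B \<in> carrier_mat m n" by (rule mult_carrier_mat[OF TS B])
  have TSBA: "T * inv_mat S * B * inv_mat A \<in> carrier_mat m n" by (rule mult_carrier_mat[OF TSB inv_A(2)])
  have [simp]: "inv_mat A *\<^sub>v v \<in> carrier_vec n" by (rule inv_A_vec(3)[OF assms(1)])
  let ?w = "B *\<^sub>v (inv_mat A *\<^sub>v v)"
  have w: "?w \<in> carrier_vec m" by simp
  have "T * inv_mat S * B * inv_mat A *\<^sub>v v = T * inv_mat S *\<^sub>v ?w"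
    unfolding assoc_mult_mat_vec[OF TSB inv_A(2) assms(1)] by (rule assoc_mult_mat_vec[OF TS B]) simp
  moreover have "- (T * inv_mat S * B * inv_mat A) *\<^sub>v v = - (T * inv_mat S * B * inv_mat A *\<^sub>v v)"
    by (rule uminus_mult_mat_vec) (use carrier_matD[OF TSBA] in auto)
  ultimately have "R *\<^sub>v (v @\<^sub>v q) = v @\<^sub>v (- (T * inv_mat S *\<^sub>v ?w) + T * inv_mat S *\<^sub>v q)"
    unfolding R_def using four_block_mat_mult_vec[OF one_carrier_mat zero_carrier_mat
        uminus_carrier_mat[OF TSBA] TS assms]
    by (simp add: zero_mult_mat_vec)
  also have "- (T * inv_mat S *\<^sub>v ?w) + T * inv_mat S *\<^sub>v q = T * inv_mat S *\<^sub>v (q - ?w)"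
    unfolding mult_minus_distrib_mat_vec[OF TS assms(2) w] using TS by (intro eq_vecI) auto
  also have "\<dots> = T *\<^sub>v (inv_mat S *\<^sub>v (q - ?w))"
    by (rule assoc_mult_mat_vec[OF T inv_S(2)]) simp
  finally show ?thesis .
qed

text \<open>It suffices that \<open>L * P = K\<close>. In the second row the minus sign in
  \<open>P\<close> produces -S p; its part with the inverse of \<open>A\<close> cancels against the
  contribution of \<open>B * inv_mat A\<close>, which leaves -C p.\<close>

lemma K_inv_P: "K * inv_mat P = L"
proof -
  have LP: "L * P = K"
  proof (rule eq_mat_on_vecI[where nr="n + m" and nc="n + m"])
    fix z :: "real Matrix.vec" assume "z \<in> carrier_vec (n + m)"
    then obtain u p where z: "z = u @\<^sub>v p" and [simp]: "u \<in> carrier_vec n" "p \<in> carrier_vec m"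
      by (rule carrier_vec_appendE)
    have a: "inv_mat A *\<^sub>v (A *\<^sub>v u + transpose_mat B *\<^sub>v p) = u + inv_mat A *\<^sub>v (transpose_mat B *\<^sub>v p)"
      using inv_A_vec(2)[of u] by (simp add: mult_add_distrib_mat_vec[OF inv_A(2)])
    have t: "inv_mat T *\<^sub>v (- (T *\<^sub>v p)) = - p"
      using inv_T_vec(2)[of p] by (simp add: mult_mat_vec_uminus[OF inv_T(2)])
    have c: "inv_mat A *\<^sub>v (transpose_mat B *\<^sub>v p) \<in> carrier_vec n"
      by (rule inv_A_vec(3)) simp
    have "L *\<^sub>v (P *\<^sub>v z) = (A *\<^sub>v u + transpose_mat B *\<^sub>v p) @\<^sub>v
        (B *\<^sub>v u + B *\<^sub>v (inv_mat A *\<^sub>v (transpose_mat B *\<^sub>v p)) + - (S *\<^sub>v p))"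
      using c by (simp add: z P_mult L_mult a t mult_add_distrib_mat_vec[OF B] mult_mat_vec_uminus[OF S_carrier])
    also have "\<dots> = K *\<^sub>v z"
      using c mult_carriers(4)[of u] mult_carriers(4)[OF c] mult_carriers(6)[of p]
      by (simp add: z K_mult S_mult del: mult_carriers) (auto intro!: eq_vecI)
    finally show "(L * P) *\<^sub>v z = K *\<^sub>v z"
      using assoc_mult_mat_vec[OF L_carrier carriers(5) \<open>z \<in> carrier_vec (n + m)\<close>] by simp
  qed (use mult_carrier_mat[OF L_carrier carriers(5)] in auto)
  have "K * inv_mat P = L * (P * inv_mat P)"
    unfolding LP[symmetric] by (rule assoc_mult_mat[OF L_carrier carriers(5) inv_P(2)])
  then show ?thesis
    using L_carrier by (simp add: inv_P(3))
qed

text \<open>It suffices that \<open>R * K = P\<close>: eliminating the velocity from the second row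
  of \<open>K\<close> leaves -S p, which \<open>R\<close> turns into -T p.\<close>

lemma P_inv_K: "P * inv_mat K = R"
proof -
  have RK: "R * K = P"
  proof (rule eq_mat_on_vecI[where nr="n + m" and nc="n + m"])
    fix z :: "real Matrix.vec" assume "z \<in> carrier_vec (n + m)"
    then obtain u p where z: "z = u @\<^sub>v p" and [simp]: "u \<in> carrier_vec n" "p \<in> carrier_vec m"
      by (rule carrier_vec_appendE)
    have a: "inv_mat A *\<^sub>v (A *\<^sub>v u + transpose_mat B *\<^sub>v p) = u + inv_mat A *\<^sub>v (transpose_mat B *\<^sub>v p)"
      using inv_A_vec(2)[of u] by (simp add: mult_add_distrib_mat_vec[OF inv_A(2)])
    have c: "inv_mat A *\<^sub>v (transpose_mat B *\<^sub>v p) \<in> carrier_vec n"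
      by (rule inv_A_vec(3)) simp
    have "B *\<^sub>v u - C *\<^sub>v p - B *\<^sub>v (inv_mat A *\<^sub>v (A *\<^sub>v u + transpose_mat B *\<^sub>v p)) = - (S *\<^sub>v p)"
      using c mult_carriers(4)[of u] mult_carriers(4)[OF c] mult_carriers(6)[of p]
      by (simp add: a mult_add_distrib_mat_vec[OF B] S_mult del: mult_carriers)
        (auto intro!: eq_vecI simp: carrier_matD[OF B] carrier_matD[OF C])
    moreover have "inv_mat S *\<^sub>v (- (S *\<^sub>v p)) = - p"
      using inv_S_vec(2)[of p] by (simp add: mult_mat_vec_uminus[OF inv_S(2)])
    ultimately have "R *\<^sub>v (K *\<^sub>v z) = P *\<^sub>v z"
      by (simp add: z K_mult R_mult P_mult mult_mat_vec_uminus[OF T])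
    then show "(R * K) *\<^sub>v z = P *\<^sub>v z"
      using assoc_mult_mat_vec[OF R_carrier carriers(4) \<open>z \<in> carrier_vec (n + m)\<close>] by simp
  qed (use mult_carrier_mat[OF R_carrier carriers(4)] in auto)
  have "P * inv_mat K = R * (K * inv_mat K)"
    unfolding RK[symmetric] by (rule assoc_mult_mat[OF R_carrier carriers(4) inv_K(2)])
  then show ?thesis
    using R_carrier by (simp add: inv_K(3))
qed

lemma L_R: "z \<in> carrier_vec (n + m) \<Longrightarrow> R *\<^sub>v (L *\<^sub>v z) = z"
proof -
  assume z: "z \<in> carrier_vec (n + m)"
  have Pz: "inv_mat P *\<^sub>v z \<in> carrier_vec (n + m)" by (rule inv_P_vec(3)[OF z])
  have "L *\<^sub>v z = K *\<^sub>v (inv_mat P *\<^sub>v z)"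
    unfolding K_inv_P[symmetric] by (rule assoc_mult_mat_vec[OF carriers(4) inv_P(2) z])
  moreover have "R *\<^sub>v (K *\<^sub>v (inv_mat P *\<^sub>v z)) = P *\<^sub>v (inv_mat K *\<^sub>v (K *\<^sub>v (inv_mat P *\<^sub>v z)))"
    unfolding P_inv_K[symmetric]
    by (rule assoc_mult_mat_vec[OF carriers(5) inv_K(2)]) (rule mult_mat_vec_carrier[OF carriers(4) Pz])
  ultimately show ?thesis
    using inv_K_vec(2)[OF Pz] inv_P_vec(1)[OF z] by simp
qed

section \<open>The weighted inner product and the two fields of values\<close>

lemma W_carrier [simp]: "W \<in> carrier_mat (n + m) (n + m)"
  unfolding W_def by (rule inv_E(2))

text \<open>With z = E (u, p) the inverse hidden in \<open>W\<close> disappears, and weighted inner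
  products become plain forms in u and p.\<close>

lemma weighted_coordinates:
  assumes "z \<in> carrier_vec (n + m)"
  obtains u p where "u \<in> carrier_vec n" "p \<in> carrier_vec m" "z = (As *\<^sub>v u) @\<^sub>v (T *\<^sub>v p)"
    "W *\<^sub>v z = u @\<^sub>v p"
proof -
  obtain u p where "W *\<^sub>v z = u @\<^sub>v p" "u \<in> carrier_vec n" "p \<in> carrier_vec m"
    using carrier_vec_appendE[OF inv_E_vec(3)[OF assms]] unfolding W_def by metis
  with that inv_E_vec(1)[OF assms] E_mult show thesis
    unfolding W_def by metis
qed

lemma ip_W:
  assumes [simp]: "v \<in> carrier_vec n" "q \<in> carrier_vec m" "u \<in> carrier_vec n" "p \<in> carrier_vec m"
  shows "ip W (v @\<^sub>v q) ((As *\<^sub>v u) @\<^sub>v (T *\<^sub>v p)) = v \<bullet>\<^sub>v u + q \<bullet>\<^sub>v p"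
proof -
  have "v @\<^sub>v q \<in> carrier_vec (n + m)" by simp
  then obtain u' p' where [simp]: "u' \<in> carrier_vec n" "p' \<in> carrier_vec m"
    and eq: "v @\<^sub>v q = (As *\<^sub>v u') @\<^sub>v (T *\<^sub>v p')" and W: "W *\<^sub>v (v @\<^sub>v q) = u' @\<^sub>v p'"
    by (rule weighted_coordinates)
  have vq: "v = As *\<^sub>v u'" "q = T *\<^sub>v p'"
    using eq append_vec_eq[of v n "As *\<^sub>v u'"] by auto
  show ?thesis
    unfolding ip_def W by (simp add: scalar_prod_append[where ?n1.0=n and ?n2.0=m] vq As_sym T_form)
qed

lemma ip_W_self:
  assumes [simp]: "u \<in> carrier_vec n" "p \<in> carrier_vec m"
  shows "ip W ((As *\<^sub>v u) @\<^sub>v (T *\<^sub>v p)) ((As *\<^sub>v u) @\<^sub>v (T *\<^sub>v p)) = A *\<^sub>v u \<bullet>\<^sub>v u + T *\<^sub>v p \<bullet>\<^sub>v p"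
  by (simp add: ip_W As_form)

lemma T_nonneg: "p \<in> carrier_vec m \<Longrightarrow> 0 \<le> T *\<^sub>v p \<bullet>\<^sub>v p"
  using T_pos[of p] by (cases "p = 0\<^sub>v m") auto

lemma ip_W_sym:
  assumes "x \<in> carrier_vec (n + m)" "y \<in> carrier_vec (n + m)"
  shows "ip W x y = ip W y x"
proof -
  obtain u p where u: "u \<in> carrier_vec n" "p \<in> carrier_vec m" "x = (As *\<^sub>v u) @\<^sub>v (T *\<^sub>v p)"
    using weighted_coordinates[OF assms(1)] by metis
  obtain u' p' where u': "u' \<in> carrier_vec n" "p' \<in> carrier_vec m" "y = (As *\<^sub>v u') @\<^sub>v (T *\<^sub>v p')"
    using weighted_coordinates[OF assms(2)] by metis
  show ?thesis
    using u u' As_sym[of u u'] T_form[of p p']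
    by (simp add: ip_W comm_scalar_prod[of "As *\<^sub>v u'" n u] comm_scalar_prod[of "T *\<^sub>v p'" m p])
qed

lemma ip_W_pos:
  assumes "z \<in> carrier_vec (n + m)" "z \<noteq> 0\<^sub>v (n + m)"
  shows "0 < ip W z z"
proof -
  obtain u p where u: "u \<in> carrier_vec n" "p \<in> carrier_vec m" "z = (As *\<^sub>v u) @\<^sub>v (T *\<^sub>v p)"
    using weighted_coordinates[OF assms(1)] by metis
  then have "z = E *\<^sub>v (u @\<^sub>v p)" by (simp add: E_mult)
  then have "u @\<^sub>v p \<noteq> 0\<^sub>v (n + m)"
    using assms(2) by (auto simp: carrier_matD[OF carriers(6)])
  then have "u \<noteq> 0\<^sub>v n \<or> p \<noteq> 0\<^sub>v m"
    using u by (simp add: append_vec_eq_zero_iff)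
  then have "0 < A *\<^sub>v u \<bullet>\<^sub>v u + T *\<^sub>v p \<bullet>\<^sub>v p"
    using A_pos[of u] T_pos[of p] A_nonneg[of u] T_nonneg[of p] u by fastforce
  then show ?thesis using u by (simp add: ip_W_self)
qed

text \<open>In these coordinates the form is A u . u + As u . w + A w . w + C p . p. Young's
  inequality spends half of the first and of the third term on the mixed one;
  \<open>pressure_control\<close> bounds what is left of the third and fourth terms.\<close>

lemma L_bound:
  assumes z: "z \<in> carrier_vec (n + m)"
  shows "\<tau> * ip W z z \<le> ip W (L *\<^sub>v z) z"
proof -
  obtain u p where [simp]: "u \<in> carrier_vec n" "p \<in> carrier_vec m"
    and zu: "z = (As *\<^sub>v u) @\<^sub>v (T *\<^sub>v p)"
    using weighted_coordinates[OF z] by metis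
  obtain w where [simp]: "w \<in> carrier_vec n" and w: "transpose_mat A *\<^sub>v w = transpose_mat B *\<^sub>v p"
    using adjoint_velocity[of p] by auto
  have c [simp]: "inv_mat A *\<^sub>v (As *\<^sub>v u) \<in> carrier_vec n"
    by (rule inv_A_vec(3)) simp
  have "ip W (L *\<^sub>v z) z = As *\<^sub>v u \<bullet>\<^sub>v u + (As *\<^sub>v u \<bullet>\<^sub>v w + S *\<^sub>v p \<bullet>\<^sub>v p)"
    using S_inv_A[of "As *\<^sub>v u" p w] w inv_T_vec(2)[of p]
    by (simp add: zu L_mult ip_W add_scalar_prod_distrib[where n=m])
  also have "\<dots> = A *\<^sub>v u \<bullet>\<^sub>v u + As *\<^sub>v u \<bullet>\<^sub>v w + A *\<^sub>v w \<bullet>\<^sub>v w + C *\<^sub>v p \<bullet>\<^sub>v p"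
    using S_form_self[of p w] w by (simp add: As_form)
  finally have "ip W (L *\<^sub>v z) z \<ge> A *\<^sub>v u \<bullet>\<^sub>v u / 2 + \<tau> * (T *\<^sub>v p \<bullet>\<^sub>v p)"
    using As_young[of u w] pressure_control[of w p] w by simp
  moreover have "\<tau> * (A *\<^sub>v u \<bullet>\<^sub>v u) \<le> 1 / 2 * (A *\<^sub>v u \<bullet>\<^sub>v u)"
    by (intro mult_right_mono tau_le A_nonneg) simp
  ultimately show ?thesis by (simp add: zu ip_W_self algebra_simps)
qed

text \<open>The vector y with \<open>transpose_mat S *\<^sub>v y = T *\<^sub>v p\<close> removes the
  inverse of \<open>S\<close>. With w its adjoint velocity the form is A u . u - As u . w + A w . w
  + C y . y. Young's inequality leaves at least half of the three unmixed terms, and the last two of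
  these dominate T p . p.\<close>

lemma R_bound:
  assumes z: "z \<in> carrier_vec (n + m)"
  shows "1 / 2 * ip W z z \<le> ip W (R *\<^sub>v z) z"
proof -
  obtain u p where [simp]: "u \<in> carrier_vec n" "p \<in> carrier_vec m"
    and zu: "z = (As *\<^sub>v u) @\<^sub>v (T *\<^sub>v p)"
    using weighted_coordinates[OF z] by metis
  let ?q = "T *\<^sub>v p"
  obtain y where [simp]: "y \<in> carrier_vec m" and y: "transpose_mat S *\<^sub>v y = ?q"
  proof -
    have "trivial_kernel m (transpose_mat S)"
      unfolding trivial_kernel_def using St_inj by auto
    then show thesis
      using that inv_mat_mult_vec(1,3)[of m "transpose_mat S" ?q] by simp
  qed
  obtain w where [simp]: "w \<in> carrier_vec n" and w: "transpose_mat A *\<^sub>v w = transpose_mat B *\<^sub>v y"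
    using adjoint_velocity[of y] by auto
  have c [simp]: "inv_mat A *\<^sub>v (As *\<^sub>v u) \<in> carrier_vec n"
    by (rule inv_A_vec(3)) simp
  let ?x = "?q - B *\<^sub>v (inv_mat A *\<^sub>v (As *\<^sub>v u))"
  have x: "?x \<in> carrier_vec m" by simp
  have S_y: "S *\<^sub>v x \<bullet>\<^sub>v y = x \<bullet>\<^sub>v ?q" if "x \<in> carrier_vec m" for x
    using scalar_prod_mult_transpose[OF S_carrier that, of y] y by simp
  have Sx: "inv_mat S *\<^sub>v ?x \<in> carrier_vec m" "S *\<^sub>v (inv_mat S *\<^sub>v ?x) = ?x"
    using inv_S_vec[OF x] by auto
  have "T *\<^sub>v (inv_mat S *\<^sub>v ?x) \<bullet>\<^sub>v p = ?x \<bullet>\<^sub>v y"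
    using S_y[OF Sx(1)] Sx by (simp add: T_form)
  also have "\<dots> = ?q \<bullet>\<^sub>v y - As *\<^sub>v u \<bullet>\<^sub>v w"
    using S_inv_A[of "As *\<^sub>v u" y w] w by (simp add: minus_scalar_prod_distrib[where n=m])
  also have "?q \<bullet>\<^sub>v y = A *\<^sub>v w \<bullet>\<^sub>v w + C *\<^sub>v y \<bullet>\<^sub>v y"
    using S_y[of y] S_form_self[of y w] w by (simp add: comm_scalar_prod[of y m])
  finally have "ip W (R *\<^sub>v z) z =
      A *\<^sub>v u \<bullet>\<^sub>v u + (A *\<^sub>v w \<bullet>\<^sub>v w + C *\<^sub>v y \<bullet>\<^sub>v y - As *\<^sub>v u \<bullet>\<^sub>v w)"
    using Sx(1) by (simp add: zu R_mult ip_W As_form)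
  \<comment> \<open>Twice T p . p is 2 B w . p + 2 C p . y. The bound of the first term contains T p
    . p - C p . p and that of the second C p . p + C y . y, so one T p . p is absorbed and C p . p
    cancels.\<close>
  moreover have "T *\<^sub>v p \<bullet>\<^sub>v p \<le> A *\<^sub>v w \<bullet>\<^sub>v w + C *\<^sub>v y \<bullet>\<^sub>v y"
  proof -
    have "T *\<^sub>v p \<bullet>\<^sub>v p = B *\<^sub>v w \<bullet>\<^sub>v p + C *\<^sub>v p \<bullet>\<^sub>v y"
      using S_y[of p] S_form[of p y w] w by (simp add: comm_scalar_prod[of p m])
    moreover have "0 \<le> C *\<^sub>v (p - y) \<bullet>\<^sub>v (p - y)"
      by (intro C_nonneg) simp
    then have "2 * (C *\<^sub>v p \<bullet>\<^sub>v y) \<le> C *\<^sub>v p \<bullet>\<^sub>v p + C *\<^sub>v y \<bullet>\<^sub>v y"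
      using C_form[of y p]
      by (simp add: mult_minus_distrib_mat_vec[OF C] minus_scalar_prod_distrib[where n=m]
        scalar_prod_minus_distrib[where n=m] comm_scalar_prod[of y m])
    ultimately show ?thesis
      using divergence_bound[of w p] by simp
  qed
  ultimately show ?thesis
    using As_young[of u w] C_nonneg[of y] by (simp add: zu ip_W_self)
qed

text \<open>The squared norm of the new vector is that of z minus the form of \<open>L\<close> at z
  plus a quarter of the squared norm of \<open>L *\<^sub>v z\<close>. By \<open>R_bound\<close> at
  \<open>L *\<^sub>v z\<close> the last term takes back at most half of the form, and
  \<open>L_bound\<close> applies to the other half. For a step of length \<alpha> the gain would be
  2 \<alpha> (1 - \<alpha>) times the form, which is largest at 1/2.\<close>

lemma gmres_step:
  assumes z: "z \<in> carrier_vec (n + m)"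
  shows "nrm W (z - (1/2) \<cdot>\<^sub>v (L *\<^sub>v z)) \<le> sqrt (1 - \<tau> / 2) * nrm W z"
proof -
  have Lz: "L *\<^sub>v z \<in> carrier_vec (n + m)"
    by (rule mult_mat_vec_carrier[OF L_carrier z])
  have WL: "W *\<^sub>v z \<in> carrier_vec (n + m)" "W *\<^sub>v (L *\<^sub>v z) \<in> carrier_vec (n + m)"
    by (rule mult_mat_vec_carrier[OF W_carrier z] mult_mat_vec_carrier[OF W_carrier Lz])+
  have W': "W *\<^sub>v ((1/2) \<cdot>\<^sub>v (L *\<^sub>v z)) = (1/2) \<cdot>\<^sub>v (W *\<^sub>v (L *\<^sub>v z))"
    by (rule mult_mat_vec[OF W_carrier Lz])
  have "ip W (z - (1/2) \<cdot>\<^sub>v (L *\<^sub>v z)) (z - (1/2) \<cdot>\<^sub>v (L *\<^sub>v z)) =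
      ip W z z - ip W (L *\<^sub>v z) z / 2 - ip W z (L *\<^sub>v z) / 2 + ip W (L *\<^sub>v z) (L *\<^sub>v z) / 4"
    using z Lz WL unfolding ip_def
    by (simp add: mult_minus_distrib_mat_vec[OF W_carrier] W' minus_scalar_prod_distrib[where n="n+m"]
      scalar_prod_minus_distrib[where n="n+m"] algebra_simps)
  moreover have "1 / 2 * ip W (L *\<^sub>v z) (L *\<^sub>v z) \<le> ip W (L *\<^sub>v z) z"
    using R_bound[OF Lz] ip_W_sym[OF z Lz] by (simp add: L_R[OF z])
  ultimately have "ip W (z - (1/2) \<cdot>\<^sub>v (L *\<^sub>v z)) (z - (1/2) \<cdot>\<^sub>v (L *\<^sub>v z)) \<le> (1 - \<tau> / 2) * ip W z z"
    using L_bound[OF z] ip_W_sym[OF z Lz] by (simp add: algebra_simps)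
  then show ?thesis
    unfolding nrm_def by (metis real_sqrt_le_mono real_sqrt_mult)
qed

text \<open>A lower bound of a real infimum requires a nonempty index set; for \<open>0 < n\<close>
  a unit vector belongs to it.\<close>

lemma mu_ge:
  assumes X: "dim_row X = n + m" and n: "0 < n"
    and bound: "\<And>z. z \<in> carrier_vec (n + m) \<Longrightarrow> c * ip W z z \<le> ip W (X *\<^sub>v z) z"
  shows "c \<le> mu W X"
proof -
  have "unit_vec (n + m) 0 \<in> {z \<in> carrier_vec (n + m). z \<noteq> 0\<^sub>v (n + m)}"
    using n by simp
  then have "{z \<in> carrier_vec (n + m). z \<noteq> (0\<^sub>v (n + m) :: real Matrix.vec)} \<noteq> {}" by blast
  then show ?thesis
    unfolding mu_def X using bound ip_W_pos
    by (intro cINF_greatest) (auto simp: pos_le_divide_eq)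
qed

lemma gmres_bound:
  assumes b: "b \<in> carrier_vec (n + m)" "x0 \<in> carrier_vec (n + m)"
    and r: "gmres_residuals W K P b x0 r"
  shows "nrm W (r j) \<le> (1 - \<tau> / 2) powr (real j / 2) * nrm W (r 0)"
proof -
  have "nrm W (r j) \<le> sqrt (1 - \<tau> / 2) ^ j * nrm W (r 0)"
  proof (rule gmres_contraction[OF _ _ _ _ r, where N="n + m" and \<alpha>="1/2"])
    show "K * inv_mat P \<in> carrier_mat (n + m) (n + m)"
      unfolding K_inv_P by (rule L_carrier)
    show "b - K *\<^sub>v x0 \<in> carrier_vec (n + m)"
      using b mult_mat_vec_carrier[OF carriers(4) b(2)] by simp
  qed (use gmres_step tau_le in \<open>auto simp: K_inv_P\<close>)
  \<comment> \<open>\<open>powr\<close> agrees with powers for a positive base, and by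
    \<open>tau_le\<close> the base is at least 3/4.\<close>
  also have "sqrt (1 - \<tau> / 2) ^ j = (1 - \<tau> / 2) powr (real j / 2)"
    using tau_le by (simp add: powr_half_sqrt[symmetric] powr_realpow[symmetric] powr_powr)
  finally show ?thesis .
qed

end

section \<open>Finite element matrices\<close>

lemma integrable_inner_sum:
  fixes f :: "nat \<Rightarrow> real^'d \<Rightarrow> 'b::euclidean_space" and g :: "nat \<Rightarrow> real^'d \<Rightarrow> 'b"
  assumes "\<And>i j. i < n \<Longrightarrow> j < m \<Longrightarrow> integrable M (\<lambda>x. f i x \<bullet> g j x)"
  shows "(LINT x|M. (\<Sum>i<n. c i *\<^sub>R f i x) \<bullet> (\<Sum>j<m. d j *\<^sub>R g j x)) =
    (\<Sum>i<n. \<Sum>j<m. c i * d j * (LINT x|M. f i x \<bullet> g j x))"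
proof -
  have "(LINT x|M. (\<Sum>i<n. c i *\<^sub>R f i x) \<bullet> (\<Sum>j<m. d j *\<^sub>R g j x)) =
      (LINT x|M. (\<Sum>i<n. \<Sum>j<m. c i * d j * (f i x \<bullet> g j x)))"
    unfolding inner_sum_left inner_scaleR_left
    by (simp add: inner_sum_right sum_distrib_left mult.assoc)
  also have "\<dots> = (\<Sum>i<n. LINT x|M. (\<Sum>j<m. c i * d j * (f i x \<bullet> g j x)))"
    using assms by (intro Bochner_Integration.integral_sum) auto
  also have "\<dots> = (\<Sum>i<n. \<Sum>j<m. LINT x|M. c i * d j * (f i x \<bullet> g j x))"
    using assms by (intro sum.cong refl Bochner_Integration.integral_sum) auto
  finally show ?thesis by simp
qed

lemma mat_form:
  fixes \<beta> :: "nat \<Rightarrow> nat \<Rightarrow> real"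
  assumes "c \<in> carrier_vec nc" "d \<in> carrier_vec nr"
  shows "Matrix.mat nr nc (\<lambda>(i,j). \<beta> i j) *\<^sub>v c \<bullet>\<^sub>v d =
    (\<Sum>j<nc. \<Sum>i<nr. vec_index c j * vec_index d i * \<beta> i j)"
proof -
  have "Matrix.mat nr nc (\<lambda>(i,j). \<beta> i j) *\<^sub>v c \<bullet>\<^sub>v d =
      (\<Sum>i<nr. (\<Sum>j<nc. \<beta> i j * vec_index c j) * vec_index d i)"
    using assms by (simp add: scalar_prod_def lessThan_atLeast0)
  also have "\<dots> = (\<Sum>j<nc. \<Sum>i<nr. vec_index c j * vec_index d i * \<beta> i j)"
    unfolding sum_distrib_right by (subst sum.swap) (simp add: mult_ac)
  finally show ?thesis .
qed

locale velocity_basis =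
  fixes \<Omega> :: "(real^'d) set" and R :: real and n :: nat and \<psi> :: "nat \<Rightarrow> real^'d \<Rightarrow> real^'d"
    and V :: "(real^'d \<Rightarrow> real^'d) set"
  assumes \<Omega>: "open \<Omega>" "bounded \<Omega>" "\<And>x. x \<in> \<Omega> \<Longrightarrow> norm x \<le> R"
    and basis: "is_basis \<Omega> V n \<psi>"
    and V_H10: "\<And>v i. v \<in> V \<Longrightarrow> (\<lambda>x. v x $ i) \<in> H10 \<Omega>"
begin

section \<open>Velocities, gradients and divergences of coefficient vectors\<close>

definition vel :: "real Matrix.vec \<Rightarrow> real^'d \<Rightarrow> real^'d" where
  "vel c x = (\<Sum>l<n. vec_index c l *\<^sub>R \<psi> l x)"

text \<open>A combination of the gradients already chosen for the basis; for \<open>vel c\<close>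
  itself \<open>weak_grad\<close> would make an independent choice.\<close>

definition vgr :: "real Matrix.vec \<Rightarrow> real^'d \<Rightarrow> real^'d^'d" where
  "vgr c x = (\<Sum>l<n. vec_index c l *\<^sub>R vgrad \<Omega> (\<psi> l) x)"

definition vdiv :: "real Matrix.vec \<Rightarrow> real^'d \<Rightarrow> real" where
  "vdiv c x = (\<Sum>l<n. vec_index c l *\<^sub>R wdiv \<Omega> (\<psi> l) x)"

definition energy :: "real Matrix.vec \<Rightarrow> real" where
  "energy c = (\<Sum>i\<in>UNIV. \<Sum>k\<in>UNIV. (l2_norm \<Omega> (\<lambda>x. vgr c x $ i $ k))\<^sup>2)"

lemma V_pair: "v \<in> V \<Longrightarrow> h10_pair \<Omega> (\<lambda>x. v x $ i) (\<lambda>x. vgrad \<Omega> v x $ i)"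
  using H10_pair[OF \<Omega>(1) V_H10, of v i] by (simp add: vgrad_def)

lemma \<psi>_V: "l < n \<Longrightarrow> \<psi> l \<in> V"
  using basis by (simp add: is_basis_def)

lemma pair: "h10_pair \<Omega> (\<lambda>x. vel c x $ i) (\<lambda>x. vgr c x $ i)"
  using h10_pair_sum[OF \<Omega>(1), of n "\<lambda>l x. \<psi> l x $ i" "\<lambda>l x. vgrad \<Omega> (\<psi> l) x $ i" "vec_index c"] V_pair \<psi>_V
  by (simp add: vel_def vgr_def)

lemma vel_L2: "(\<lambda>x. vel c x $ i) \<in> L2 \<Omega>" and vgr_L2: "(\<lambda>x. vgr c x $ i $ k) \<in> L2 \<Omega>"
  using h10_pairD[OF pair] by auto

lemma \<psi>_L2: "l < n \<Longrightarrow> (\<lambda>x. \<psi> l x $ i) \<in> L2 \<Omega>"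
  and grad_\<psi>_L2: "l < n \<Longrightarrow> (\<lambda>x. vgrad \<Omega> (\<psi> l) x $ i $ k) \<in> L2 \<Omega>"
  using h10_pairD[OF V_pair[OF \<psi>_V]] by auto

lemma div_\<psi>_L2: "l < n \<Longrightarrow> wdiv \<Omega> (\<psi> l) \<in> L2 \<Omega>"
  unfolding wdiv_def[abs_def] by (intro L2_sum grad_\<psi>_L2)

lemma vdiv_eq: "vdiv c x = (\<Sum>i\<in>UNIV. vgr c x $ i $ i)"
  unfolding vdiv_def vgr_def wdiv_def
  by (simp add: sum_distrib_left) (rule sum.swap)

lemma vdiv_L2: "vdiv c \<in> L2 \<Omega>"
  unfolding vdiv_eq[abs_def] by (intro L2_sum vgr_L2)

lemma vgr_inner: "(LINT x|lebesgue_on \<Omega>. vgr c x \<bullet> vgr d x) =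
    (\<Sum>i\<in>UNIV. \<Sum>k\<in>UNIV. LINT x|lebesgue_on \<Omega>. vgr c x $ i $ k * vgr d x $ i $ k)"
  by (simp add: inner_vec_def Bochner_Integration.integrable_sum L2_mult_integrable[OF vgr_L2 vgr_L2])

lemma l2_norm_vgr: "(l2_norm \<Omega> (vgr c))\<^sup>2 = energy c"
proof -
  have "(l2_norm \<Omega> (vgr c))\<^sup>2 = (LINT x|lebesgue_on \<Omega>. vgr c x \<bullet> vgr c x)"
    by (simp add: l2_norm_def l2_inner_def)
  then show ?thesis
    unfolding energy_def l2_norm_sq vgr_inner by (simp add: power2_eq_square)
qed

lemma energy_nonneg [simp]: "0 \<le> energy c"
  by (simp add: energy_def sum_nonneg)

lemma l2_norm_component_le: "l2_norm \<Omega> (\<lambda>x. vgr c x $ i $ k) \<le> sqrt (energy c)"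
proof (rule real_le_rsqrt)
  have "(l2_norm \<Omega> (\<lambda>x. vgr c x $ i $ k))\<^sup>2 \<le> (\<Sum>k\<in>UNIV. (l2_norm \<Omega> (\<lambda>x. vgr c x $ i $ k))\<^sup>2)"
    by (rule member_le_sum) auto
  also have "\<dots> \<le> energy c"
    unfolding energy_def by (rule member_le_sum[of i UNIV "\<lambda>i. \<Sum>k\<in>UNIV. (l2_norm \<Omega> (\<lambda>x. vgr c x $ i $ k))\<^sup>2"])
      (auto intro: sum_nonneg)
  finally show "(l2_norm \<Omega> (\<lambda>x. vgr c x $ i $ k))\<^sup>2 \<le> energy c" .
qed

lemma l2_norm_vel_le: "l2_norm \<Omega> (\<lambda>x. vel c x $ i) \<le> 2 * \<bar>R\<bar> * sqrt (energy c)"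
proof -
  have "l2_norm \<Omega> (\<lambda>x. vel c x $ i) \<le> 2 * \<bar>R\<bar> * l2_norm \<Omega> (\<lambda>x. vgr c x $ i $ i)"
    by (rule Poincare_inequality[OF \<Omega>(1,3) pair])
  also have "\<dots> \<le> 2 * \<bar>R\<bar> * sqrt (energy c)"
    by (intro mult_left_mono l2_norm_component_le) auto
  finally show ?thesis .
qed

text \<open>By the Poincare inequality zero energy forces the velocity to vanish almost everywhere,
  against the linear independence of the basis.\<close>

lemma energy_pos:
  assumes c: "c \<in> carrier_vec n" "c \<noteq> 0\<^sub>v n"
  shows "0 < energy c"
proof (rule ccontr)
  assume "\<not> 0 < energy c"
  then have 0: "energy c = 0" using energy_nonneg[of c] by linarith
  have "AE x in lebesgue_on \<Omega>. vel c x $ i = 0" for i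
  proof -
    have "l2_norm \<Omega> (\<lambda>x. vel c x $ i) = 0"
      using l2_norm_vel_le[of c i] l2_norm_nonneg[of \<Omega> "\<lambda>x. vel c x $ i"] by (simp add: 0)
    then have "(LINT x|lebesgue_on \<Omega>. (vel c x $ i)\<^sup>2) = 0"
      using l2_norm_sq[of \<Omega> "\<lambda>x. vel c x $ i"] by simp
    then have "AE x in lebesgue_on \<Omega>. (vel c x $ i)\<^sup>2 = 0"
      using vel_L2[of c i] by (subst (asm) integral_nonneg_eq_0_iff_AE) (auto simp: L2_real_iff)
    then show ?thesis by simp
  qed
  then have "AE x in lebesgue_on \<Omega>. vel c x = 0"
    by (simp add: Finite_Cartesian_Product.vec_eq_iff AE_all_countable)
  then have "\<forall>l<n. vec_index c l = 0"
    using basis unfolding is_basis_def vel_def by blast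
  then have "c = 0\<^sub>v n" using c(1) by (intro eq_vecI) auto
  with c(2) show False by simp
qed

text \<open>The sharp constant 1, which \<open>divergence_bound\<close> needs, comes from exchanging the two
  derivatives: the square of the divergence integrates to \<open>g i k * g k i\<close>.\<close>

lemma div_le_energy: "(l2_norm \<Omega> (vdiv c))\<^sup>2 \<le> energy c"
proof -
  let ?I = "\<lambda>f. LINT x|lebesgue_on \<Omega>. f x" and ?g = "\<lambda>i k x. vgr c x $ i $ k"
  have int: "integrable (lebesgue_on \<Omega>) (\<lambda>x. ?g i k x * ?g i' k' x)" for i k i' k'
    by (intro L2_mult_integrable vgr_L2)
  have "(l2_norm \<Omega> (vdiv c))\<^sup>2 = ?I (\<lambda>x. (\<Sum>i\<in>UNIV. \<Sum>k\<in>UNIV. ?g i i x * ?g k k x))"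
    unfolding l2_norm_sq vdiv_eq by (simp add: power2_eq_square sum_product)
  also have "\<dots> = (\<Sum>i\<in>UNIV. \<Sum>k\<in>UNIV. ?I (\<lambda>x. ?g i i x * ?g k k x))"
    by (simp add: int Bochner_Integration.integrable_sum)
  also have "\<dots> = (\<Sum>i\<in>UNIV. \<Sum>k\<in>UNIV. ?I (\<lambda>x. ?g i k x * ?g k i x))"
    by (intro sum.cong refl h10_grad_swap[OF \<Omega>(1) pair pair])
  also have "\<dots> \<le> (\<Sum>i\<in>UNIV. \<Sum>k\<in>UNIV. (?I (\<lambda>x. ?g i k x * ?g i k x) + ?I (\<lambda>x. ?g k i x * ?g k i x)) / 2)"
  proof (intro sum_mono)
    fix i k
    have "?I (\<lambda>x. ?g i k x * ?g k i x) \<le> ?I (\<lambda>x. (?g i k x * ?g i k x + ?g k i x * ?g k i x) / 2)"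
    proof (rule integral_mono)
      fix x
      show "?g i k x * ?g k i x \<le> (?g i k x * ?g i k x + ?g k i x * ?g k i x) / 2"
        using sum_squares_bound[of "?g i k x" "?g k i x"] by (simp add: power2_eq_square)
    qed (use int in auto)
    also have "\<dots> = (?I (\<lambda>x. ?g i k x * ?g i k x) + ?I (\<lambda>x. ?g k i x * ?g k i x)) / 2"
      by (simp add: int)
    finally show "?I (\<lambda>x. ?g i k x * ?g k i x) \<le> (?I (\<lambda>x. ?g i k x * ?g i k x) + ?I (\<lambda>x. ?g k i x * ?g k i x)) / 2" .
  qed
  also have "\<dots> = ((\<Sum>i\<in>UNIV. \<Sum>k\<in>UNIV. ?I (\<lambda>x. ?g i k x * ?g i k x)) +
      (\<Sum>i\<in>UNIV. \<Sum>k\<in>UNIV. ?I (\<lambda>x. ?g k i x * ?g k i x))) / 2"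
    by (simp add: sum.distrib sum_divide_distrib add_divide_distrib)
  also have "(\<Sum>i\<in>UNIV. \<Sum>k\<in>UNIV. ?I (\<lambda>x. ?g k i x * ?g k i x)) = (\<Sum>i\<in>UNIV. \<Sum>k\<in>UNIV. ?I (\<lambda>x. ?g i k x * ?g i k x))"
    by (rule sum.swap)
  finally show ?thesis
    unfolding energy_def l2_norm_sq by (simp add: power2_eq_square)
qed

section \<open>The velocity matrices as bilinear forms and their bounds\<close>

lemma D_form:
  assumes "c \<in> carrier_vec n" "d \<in> carrier_vec n"
  shows "D_mat \<Omega> n \<psi> *\<^sub>v c \<bullet>\<^sub>v d = (\<Sum>i\<in>UNIV. \<Sum>k\<in>UNIV. LINT x|lebesgue_on \<Omega>. vgr c x $ i $ k * vgr d x $ i $ k)"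
proof -
  have "integrable (lebesgue_on \<Omega>) (\<lambda>x. vgrad \<Omega> (\<psi> j) x \<bullet> vgrad \<Omega> (\<psi> i) x)" if "j < n" "i < n" for i j
    using that by (auto simp: inner_vec_def intro!: Bochner_Integration.integrable_sum L2_mult_integrable grad_\<psi>_L2)
  from integrable_inner_sum[OF this, where n=n and m=n and c="vec_index c" and d="vec_index d"]
  show ?thesis
    unfolding D_mat_def l2_inner_def mat_form[OF assms] vgr_inner[symmetric]
    by (simp add: vgr_def inner_commute)
qed

lemma G_form:
  assumes "c \<in> carrier_vec n" "d \<in> carrier_vec n"
  shows "G_mat \<Omega> n \<psi> *\<^sub>v c \<bullet>\<^sub>v d = (LINT x|lebesgue_on \<Omega>. vdiv c x * vdiv d x)"
proof -
  have "integrable (lebesgue_on \<Omega>) (\<lambda>x. wdiv \<Omega> (\<psi> j) x \<bullet> wdiv \<Omega> (\<psi> i) x)" if "j < n" "i < n" for i j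
    using that by (simp add: L2_mult_integrable div_\<psi>_L2)
  from integrable_inner_sum[OF this, where n=n and m=n and c="vec_index c" and d="vec_index d"]
  show ?thesis
    unfolding G_mat_def l2_inner_def mat_form[OF assms]
    by (simp add: vdiv_def mult.commute)
qed

lemma N_form:
  assumes cf: "convection_field \<Omega> a" and cd: "c \<in> carrier_vec n" "d \<in> carrier_vec n"
  shows "N_mat \<Omega> a n \<psi> *\<^sub>v c \<bullet>\<^sub>v d =
    (\<Sum>i\<in>UNIV. \<Sum>k\<in>UNIV. LINT x|lebesgue_on \<Omega>. a x $ k * vgr c x $ i $ k * vel d x $ i)"
proof -
  note A = convection_fieldD(3,5)[OF \<Omega>(1) cf]
  have "integrable (lebesgue_on \<Omega>) (\<lambda>x. (vgrad \<Omega> (\<psi> j) x *v a x) \<bullet> \<psi> i x)" if "j < n" "i < n" for i j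
    using that unfolding inner_vec_def matrix_vector_mult_def
    by (auto simp: sum_distrib_right mult.commute[of "vgrad _ _ _ $ _ $ _"]
      intro!: Bochner_Integration.integrable_sum L2_mult_integrable L2_bounded_mult[OF A] grad_\<psi>_L2 \<psi>_L2)
  from integrable_inner_sum[OF this, where n=n and m=n and c="vec_index c" and d="vec_index d"]
  have int: "N_mat \<Omega> a n \<psi> *\<^sub>v c \<bullet>\<^sub>v d =
      (LINT x|lebesgue_on \<Omega>. (\<Sum>l<n. vec_index c l *\<^sub>R (vgrad \<Omega> (\<psi> l) x *v a x)) \<bullet> vel d x)"
    unfolding N_mat_def l2_inner_def mat_form[OF cd] vel_def by simp
  have mult_a: "(\<Sum>l<n. vec_index c l *\<^sub>R (vgrad \<Omega> (\<psi> l) x *v a x)) = vgr c x *v a x" for x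
    unfolding vgr_def
    by (induction n) (simp_all add: matrix_vector_mult_add_rdistrib scaleR_matrix_vector_assoc)
  from int have "N_mat \<Omega> a n \<psi> *\<^sub>v c \<bullet>\<^sub>v d = (LINT x|lebesgue_on \<Omega>. (vgr c x *v a x) \<bullet> vel d x)"
    unfolding mult_a .
  also have "\<dots> =
      (LINT x|lebesgue_on \<Omega>. (\<Sum>i\<in>UNIV. \<Sum>k\<in>UNIV. a x $ k * vgr c x $ i $ k * vel d x $ i))"
    unfolding inner_vec_def matrix_vector_mult_def by (simp add: sum_distrib_left mult_ac)
  also have "\<dots> = (\<Sum>i\<in>UNIV. \<Sum>k\<in>UNIV. LINT x|lebesgue_on \<Omega>. a x $ k * vgr c x $ i $ k * vel d x $ i)"
    by (simp add: Bochner_Integration.integrable_sum L2_mult_integrable[OF L2_bounded_mult[OF A vgr_L2] vel_L2])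
  finally show ?thesis .
qed

lemma N_skew:
  assumes cf: "convection_field \<Omega> a" and cd: "c \<in> carrier_vec n" "d \<in> carrier_vec n"
  shows "N_mat \<Omega> a n \<psi> *\<^sub>v c \<bullet>\<^sub>v d = - (N_mat \<Omega> a n \<psi> *\<^sub>v d \<bullet>\<^sub>v c)"
proof -
  have "(\<Sum>k\<in>UNIV. LINT x|lebesgue_on \<Omega>. a x $ k * vgr c x $ i $ k * vel d x $ i) =
      - (\<Sum>k\<in>UNIV. LINT x|lebesgue_on \<Omega>. a x $ k * vgr d x $ i $ k * vel c x $ i)" for i
    using convection_skew[OF \<Omega>(1) cf pair pair, of c i d i] by (simp add: mult_ac)
  then show ?thesis
    unfolding N_form[OF cf cd] N_form[OF cf cd(2,1)] by (simp add: sum_negf)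
qed

text \<open>One Poincare constant \<open>2 * \<bar>R\<bar>\<close> for each entry of the velocity
  gradient; the components of the convection field are bounded by 1.\<close>

definition conv_const :: real where
  "conv_const = (real CARD('d))\<^sup>2 * (2 * \<bar>R\<bar>)"

lemma N_bound:
  assumes cf: "convection_field \<Omega> a" and cd: "c \<in> carrier_vec n" "d \<in> carrier_vec n"
  shows "N_mat \<Omega> a n \<psi> *\<^sub>v c \<bullet>\<^sub>v d \<le> conv_const * sqrt (energy c) * sqrt (energy d)"
proof -
  note A = convection_fieldD(3,5)[OF \<Omega>(1) cf]
  have "(LINT x|lebesgue_on \<Omega>. a x $ k * vgr c x $ i $ k * vel d x $ i) \<le> sqrt (energy c) * (2 * \<bar>R\<bar> * sqrt (energy d))" for i k
  proof -
    have "(LINT x|lebesgue_on \<Omega>. a x $ k * vgr c x $ i $ k * vel d x $ i)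
        \<le> \<bar>1\<bar> * l2_norm \<Omega> (\<lambda>x. vgr c x $ i $ k) * l2_norm \<Omega> (\<lambda>x. vel d x $ i)"
      using weighted_Cauchy_Schwarz[OF A vgr_L2[of c i k] vel_L2[of d i], of k] by linarith
    also have "\<dots> \<le> sqrt (energy c) * (2 * \<bar>R\<bar> * sqrt (energy d))"
      using mult_mono[OF l2_norm_component_le[of c i k] l2_norm_vel_le[of d i]] by simp
    finally show ?thesis .
  qed
  then have "N_mat \<Omega> a n \<psi> *\<^sub>v c \<bullet>\<^sub>v d \<le> (\<Sum>i\<in>(UNIV::'d set). \<Sum>k\<in>(UNIV::'d set). sqrt (energy c) * (2 * \<bar>R\<bar> * sqrt (energy d)))"
    unfolding N_form[OF cf cd] by (intro sum_mono)
  also have "\<dots> = conv_const * sqrt (energy c) * sqrt (energy d)"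
    by (simp add: conv_const_def power2_eq_square)
  finally show ?thesis .
qed

text \<open>Cauchy-Schwarz entry by entry. The number of entries is not the sharp factor, but it
  only enters the final constant.\<close>

lemma D_bound:
  assumes cd: "c \<in> carrier_vec n" "d \<in> carrier_vec n"
  shows "D_mat \<Omega> n \<psi> *\<^sub>v c \<bullet>\<^sub>v d \<le> (real CARD('d))\<^sup>2 * sqrt (energy c) * sqrt (energy d)"
proof -
  have "(LINT x|lebesgue_on \<Omega>. vgr c x $ i $ k * vgr d x $ i $ k) \<le> sqrt (energy c) * sqrt (energy d)" for i k
  proof -
    have "(LINT x|lebesgue_on \<Omega>. vgr c x $ i $ k * vgr d x $ i $ k)
        \<le> l2_norm \<Omega> (\<lambda>x. vgr c x $ i $ k) * l2_norm \<Omega> (\<lambda>x. vgr d x $ i $ k)"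
      using l2_inner_Cauchy_Schwarz[OF vgr_L2[of c i k] vgr_L2[of d i k]] by linarith
    also have "\<dots> \<le> sqrt (energy c) * sqrt (energy d)"
      by (intro mult_mono l2_norm_component_le) auto
    finally show ?thesis .
  qed
  then have "D_mat \<Omega> n \<psi> *\<^sub>v c \<bullet>\<^sub>v d \<le> (\<Sum>i\<in>(UNIV::'d set). \<Sum>k\<in>(UNIV::'d set). sqrt (energy c) * sqrt (energy d))"
    unfolding D_form[OF cd] by (intro sum_mono)
  then show ?thesis by (simp add: power2_eq_square)
qed

lemma D_energy: "c \<in> carrier_vec n \<Longrightarrow> D_mat \<Omega> n \<psi> *\<^sub>v c \<bullet>\<^sub>v c = energy c"
  unfolding D_form energy_def l2_norm_sq by (simp add: power2_eq_square)

lemma G_norm: "c \<in> carrier_vec n \<Longrightarrow> G_mat \<Omega> n \<psi> *\<^sub>v c \<bullet>\<^sub>v c = (l2_norm \<Omega> (vdiv c))\<^sup>2"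
  unfolding G_form l2_norm_sq by (simp add: power2_eq_square)

text \<open>The first divergence is replaced by the gradient that normalizes the inf-sup quotient.
  The second one is kept, because \<gamma> times its square is part of the energy of the full
  velocity matrix.\<close>

lemma G_bound:
  assumes "c \<in> carrier_vec n" "d \<in> carrier_vec n"
  shows "G_mat \<Omega> n \<psi> *\<^sub>v c \<bullet>\<^sub>v d \<le> sqrt (energy c) * l2_norm \<Omega> (vdiv d)"
proof -
  have "G_mat \<Omega> n \<psi> *\<^sub>v c \<bullet>\<^sub>v d \<le> l2_norm \<Omega> (vdiv c) * l2_norm \<Omega> (vdiv d)"
    unfolding G_form[OF assms] using l2_inner_Cauchy_Schwarz[OF vdiv_L2[of c] vdiv_L2[of d]] by linarith
  also have "\<dots> \<le> sqrt (energy c) * l2_norm \<Omega> (vdiv d)"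
    by (intro mult_right_mono real_le_rsqrt div_le_energy) auto
  finally show ?thesis .
qed

text \<open>The inf-sup condition ranges over functions v, the estimates over coefficient vectors.
  The gradients match by \<open>h10_gradient_unique\<close>, applied to the components of v minus
  its expansion.\<close>

lemma V_coefficients:
  assumes v: "v \<in> V"
  obtains c where "c \<in> carrier_vec n" "AE x in lebesgue_on \<Omega>. v x = vel c x"
    "AE x in lebesgue_on \<Omega>. vgrad \<Omega> v x = vgr c x"
proof -
  obtain b where b: "AE x in lebesgue_on \<Omega>. v x = (\<Sum>l<n. b l *\<^sub>R \<psi> l x)"
    using basis v unfolding is_basis_def by blast
  define c where "c = Matrix.vec n b"
  have c: "c \<in> carrier_vec n" "AE x in lebesgue_on \<Omega>. v x = vel c x"
    using b by (auto simp: c_def vel_def)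
  have "AE x in lebesgue_on \<Omega>. vgrad \<Omega> v x $ i + (-1) *\<^sub>R vgr c x $ i = 0" for i
    using c(2) by (intro h10_gradient_unique[OF \<Omega>(1,2) h10_pair_linear[OF \<Omega>(1) V_pair[OF v] pair]])
      (auto elim: eventually_mono)
  then have "AE x in lebesgue_on \<Omega>. \<forall>i. vgrad \<Omega> v x $ i + (-1) *\<^sub>R vgr c x $ i = 0"
    by (simp add: AE_all_countable)
  then have "AE x in lebesgue_on \<Omega>. vgrad \<Omega> v x = vgr c x"
    by eventually_elim (simp add: Finite_Cartesian_Product.vec_eq_iff)
  with c show thesis by (rule that)
qed

end

section \<open>The preconditioned system\<close>

text \<open>\<open>Q_span\<close> asks for literal membership of all combinations, as the inf-sup
  condition is applied to the function \<open>pr p\<close> itself.\<close>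

locale stabilized_discretization = velocity_basis \<Omega> R n \<psi> V
  for \<Omega> :: "(real^'d) set" and R n \<psi> V +
  fixes a :: "real^'d \<Rightarrow> real^'d" and \<nu> \<gamma> \<delta> C0 :: real and Q :: "(real^'d \<Rightarrow> real) set"
    and m :: nat and \<phi> :: "nat \<Rightarrow> real^'d \<Rightarrow> real" and s :: "(real^'d \<Rightarrow> real) \<Rightarrow> (real^'d \<Rightarrow> real) \<Rightarrow> real"
  assumes cf: "convection_field \<Omega> a"
    and Q_basis: "is_basis \<Omega> Q m \<phi>"
    and Q_L2: "Q \<subseteq> L2 \<Omega>"
    and Q_span: "\<And>c. (\<lambda>x. \<Sum>l<m. c l * \<phi> l x) \<in> Q"
    and s: "psd_form \<Omega> s"
    and infsup: "inf_sup \<Omega> V Q s \<delta>"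
    and par: "0 < \<delta>" "0 < \<nu>" "0 \<le> \<gamma>" "\<nu> \<le> C0" "\<gamma> \<le> C0 / \<nu>"
begin

definition A where "A = \<nu> \<cdot>\<^sub>m D_mat \<Omega> n \<psi> + N_mat \<Omega> a n \<psi> + \<gamma> \<cdot>\<^sub>m G_mat \<Omega> n \<psi>"
definition B where "B = B_mat \<Omega> n \<psi> m \<phi>"
definition C where "C = C_mat \<nu> \<gamma> s m \<phi>"
definition T where "T = (1 / (\<nu> + \<gamma>)) \<cdot>\<^sub>m M_mat \<Omega> m \<phi> + C"

definition pr :: "real Matrix.vec \<Rightarrow> real^'d \<Rightarrow> real" where
  "pr p x = (\<Sum>l<m. vec_index p l * \<phi> l x)"

lemma mat_carriers [simp]:
  "D_mat \<Omega> n \<psi> \<in> carrier_mat n n" "N_mat \<Omega> a n \<psi> \<in> carrier_mat n n" "G_mat \<Omega> n \<psi> \<in> carrier_mat n n"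
  "M_mat \<Omega> m \<phi> \<in> carrier_mat m m"
  "A \<in> carrier_mat n n" "B \<in> carrier_mat m n" "C \<in> carrier_mat m m" "T \<in> carrier_mat m m"
  by (auto simp: A_def B_def C_def T_def D_mat_def N_mat_def G_mat_def M_mat_def B_mat_def C_mat_def)

lemma \<kappa>_pos: "0 < \<nu> + \<gamma>"
  using par by simp

lemma C0_pos: "0 < C0" using par by linarith

lemma \<phi>_L2: "l < m \<Longrightarrow> \<phi> l \<in> L2 \<Omega>"
  using Q_basis Q_L2 unfolding is_basis_def by blast

lemma pr_Q: "pr p \<in> Q"
  using Q_span[of "vec_index p"] by (simp add: pr_def[abs_def])

lemma pr_L2: "pr p \<in> L2 \<Omega>"
  using pr_Q Q_L2 by blast

section \<open>The matrices of the coupled system as bilinear forms\<close>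

lemma B_form':
  assumes "c \<in> carrier_vec n" "p \<in> carrier_vec m"
  shows "B *\<^sub>v c \<bullet>\<^sub>v p = - (LINT x|lebesgue_on \<Omega>. vdiv c x * pr p x)"
proof -
  have "integrable (lebesgue_on \<Omega>) (\<lambda>x. wdiv \<Omega> (\<psi> j) x \<bullet> \<phi> i x)" if "j < n" "i < m" for i j
    using that by (simp add: L2_mult_integrable div_\<psi>_L2 \<phi>_L2)
  from integrable_inner_sum[OF this, where n=n and m=m and c="vec_index c" and d="vec_index p"]
  show ?thesis
    unfolding B_def B_mat_def l2_inner_def mat_form[OF assms]
    by (simp add: vdiv_def pr_def mult.commute sum_negf)
qed

lemma M_form:
  assumes "q \<in> carrier_vec m" "p \<in> carrier_vec m"
  shows "M_mat \<Omega> m \<phi> *\<^sub>v q \<bullet>\<^sub>v p = (LINT x|lebesgue_on \<Omega>. pr q x * pr p x)"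
proof -
  have "integrable (lebesgue_on \<Omega>) (\<lambda>x. \<phi> j x \<bullet> \<phi> i x)" if "j < m" "i < m" for i j
    using that by (simp add: L2_mult_integrable \<phi>_L2)
  from integrable_inner_sum[OF this, where n=m and m=m and c="vec_index q" and d="vec_index p"]
  show ?thesis
    unfolding M_mat_def l2_inner_def mat_form[OF assms]
    by (simp add: pr_def mult.commute)
qed

lemma s_sym: "f \<in> L2 \<Omega> \<Longrightarrow> g \<in> L2 \<Omega> \<Longrightarrow> s f g = s g f"
  and s_nonneg: "f \<in> L2 \<Omega> \<Longrightarrow> 0 \<le> s f f"
  and s_add: "f \<in> L2 \<Omega> \<Longrightarrow> f' \<in> L2 \<Omega> \<Longrightarrow> g \<in> L2 \<Omega> \<Longrightarrow> s (\<lambda>x. f x + f' x) g = s f g + s f' g"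
  and s_cmult: "f \<in> L2 \<Omega> \<Longrightarrow> g \<in> L2 \<Omega> \<Longrightarrow> s (\<lambda>x. r * f x) g = r * s f g"
  using s unfolding psd_form_def by blast+

lemma s_sum:
  assumes g: "g \<in> L2 \<Omega>" and k: "k \<le> m"
  shows "s (\<lambda>x. \<Sum>l<k. c l * \<phi> l x) g = (\<Sum>l<k. c l * s (\<phi> l) g)"
  using k
proof (induction k)
  case 0
  show ?case using s_cmult[OF L2_zero g, of 0] by simp
next
  case (Suc k)
  have L: "(\<lambda>x. \<Sum>l<k. c l * \<phi> l x) \<in> L2 \<Omega>" "(\<lambda>x. c k * \<phi> k x) \<in> L2 \<Omega>" "\<phi> k \<in> L2 \<Omega>"
    using Suc.prems by (auto intro!: L2_sum L2_cmult \<phi>_L2)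
  have "s (\<lambda>x. (\<Sum>l<k. c l * \<phi> l x) + c k * \<phi> k x) g = s (\<lambda>x. \<Sum>l<k. c l * \<phi> l x) g + s (\<lambda>x. c k * \<phi> k x) g"
    by (rule s_add[OF L(1,2) g])
  moreover have "s (\<lambda>x. c k * \<phi> k x) g = c k * s (\<phi> k) g"
    by (rule s_cmult[OF L(3) g])
  ultimately show ?case using Suc by simp
qed

lemma C_form':
  assumes "q \<in> carrier_vec m" "p \<in> carrier_vec m"
  shows "C *\<^sub>v q \<bullet>\<^sub>v p = s (pr q) (pr p) / (\<nu> + \<gamma>)"
proof -
  have "s (pr q) (pr p) = (\<Sum>j<m. vec_index q j * s (\<phi> j) (pr p))"
    unfolding pr_def[of q, abs_def] by (rule s_sum[OF pr_L2 order_refl])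
  also have "\<dots> = (\<Sum>j<m. vec_index q j * s (pr p) (\<phi> j))"
    by (intro sum.cong refl) (simp add: s_sym[OF \<phi>_L2 pr_L2])
  also have "\<dots> = (\<Sum>j<m. vec_index q j * (\<Sum>i<m. vec_index p i * s (\<phi> i) (\<phi> j)))"
    unfolding pr_def[of p, abs_def] by (intro sum.cong refl) (simp add: s_sum[OF \<phi>_L2 order_refl])
  finally show ?thesis
    unfolding C_def C_mat_def mat_form[OF assms] by (simp add: sum_divide_distrib sum_distrib_left mult.assoc)
qed

lemma C_quadratic:
  assumes "p \<in> carrier_vec m"
  shows "0 \<le> C *\<^sub>v p \<bullet>\<^sub>v p" "s (pr p) (pr p) = (\<nu> + \<gamma>) * (C *\<^sub>v p \<bullet>\<^sub>v p)"
proof -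
  have "0 \<le> s (pr p) (pr p)" by (rule s_nonneg[OF pr_L2])
  then show "0 \<le> C *\<^sub>v p \<bullet>\<^sub>v p" "s (pr p) (pr p) = (\<nu> + \<gamma>) * (C *\<^sub>v p \<bullet>\<^sub>v p)"
    using \<kappa>_pos by (simp_all add: C_form'[OF assms assms])
qed

lemma A_form':
  assumes c: "c \<in> carrier_vec n" and d: "d \<in> carrier_vec n"
  shows "A *\<^sub>v c \<bullet>\<^sub>v d = \<nu> * (D_mat \<Omega> n \<psi> *\<^sub>v c \<bullet>\<^sub>v d) + N_mat \<Omega> a n \<psi> *\<^sub>v c \<bullet>\<^sub>v d + \<gamma> * (G_mat \<Omega> n \<psi> *\<^sub>v c \<bullet>\<^sub>v d)"
proof -
  have cr: "D_mat \<Omega> n \<psi> *\<^sub>v c \<in> carrier_vec n" "N_mat \<Omega> a n \<psi> *\<^sub>v c \<in> carrier_vec n" "G_mat \<Omega> n \<psi> *\<^sub>v c \<in> carrier_vec n"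
    using c by (auto intro: mult_mat_vec_carrier[of _ n n])
  have "A *\<^sub>v c = \<nu> \<cdot>\<^sub>v (D_mat \<Omega> n \<psi> *\<^sub>v c) + N_mat \<Omega> a n \<psi> *\<^sub>v c + \<gamma> \<cdot>\<^sub>v (G_mat \<Omega> n \<psi> *\<^sub>v c)"
    unfolding A_def
    by (subst add_mult_distrib_mat_vec[of _ n n], simp, simp, rule c,
        subst add_mult_distrib_mat_vec[of _ n n], simp, simp, rule c)
      (simp add: smult_mat_mult_vec[OF mat_carriers(1) c] smult_mat_mult_vec[OF mat_carriers(3) c])
  then show ?thesis
    using cr d by (simp add: add_scalar_prod_distrib[of _ n] smult_scalar_prod_distrib[of _ n])
qed

text \<open>Convection drops out by skew-symmetry.\<close>

lemma A_quadratic: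
  assumes c: "c \<in> carrier_vec n"
  shows "A *\<^sub>v c \<bullet>\<^sub>v c = \<nu> * energy c + \<gamma> * (l2_norm \<Omega> (vdiv c))\<^sup>2"
  using N_skew[OF cf c c] by (simp add: A_form'[OF c c] D_energy[OF c] G_norm[OF c])

lemma T_form':
  assumes q: "q \<in> carrier_vec m" and p: "p \<in> carrier_vec m"
  shows "T *\<^sub>v q \<bullet>\<^sub>v p = (LINT x|lebesgue_on \<Omega>. pr q x * pr p x) / (\<nu> + \<gamma>) + C *\<^sub>v q \<bullet>\<^sub>v p"
proof -
  have cr: "M_mat \<Omega> m \<phi> *\<^sub>v q \<in> carrier_vec m" "C *\<^sub>v q \<in> carrier_vec m"
    using q by (auto intro: mult_mat_vec_carrier[of _ m m])
  have "T *\<^sub>v q = (1 / (\<nu> + \<gamma>)) \<cdot>\<^sub>v (M_mat \<Omega> m \<phi> *\<^sub>v q) + C *\<^sub>v q"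
    unfolding T_def
    by (subst add_mult_distrib_mat_vec[of _ m m], simp, simp, rule q)
      (simp add: smult_mat_mult_vec[OF mat_carriers(4) q])
  then show ?thesis
    using cr p by (simp add: add_scalar_prod_distrib[of _ m] smult_scalar_prod_distrib[of _ m] M_form[OF q p])
qed

lemma T_quadratic:
  assumes "p \<in> carrier_vec m"
  shows "T *\<^sub>v p \<bullet>\<^sub>v p = (l2_norm \<Omega> (pr p))\<^sup>2 / (\<nu> + \<gamma>) + C *\<^sub>v p \<bullet>\<^sub>v p"
  unfolding T_form'[OF assms assms] l2_norm_sq by (simp add: power2_eq_square)

lemma pr_pos:
  assumes p: "p \<in> carrier_vec m" "p \<noteq> 0\<^sub>v m"
  shows "0 < l2_norm \<Omega> (pr p)"
proof (rule ccontr)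
  assume "\<not> 0 < l2_norm \<Omega> (pr p)"
  then have "l2_norm \<Omega> (pr p) = 0" using l2_norm_nonneg[of \<Omega> "pr p"] by linarith
  then have "(LINT x|lebesgue_on \<Omega>. (pr p x)\<^sup>2) = 0"
    using l2_norm_sq[of \<Omega> "pr p"] by simp
  then have "AE x in lebesgue_on \<Omega>. (pr p x)\<^sup>2 = 0"
    using pr_L2[of p] by (subst (asm) integral_nonneg_eq_0_iff_AE) (auto simp: L2_real_iff)
  then have "AE x in lebesgue_on \<Omega>. (\<Sum>l<m. vec_index p l *\<^sub>R \<phi> l x) = 0"
    by (simp add: pr_def)
  then have "\<forall>l<m. vec_index p l = 0"
    using Q_basis unfolding is_basis_def by blast
  then have "p = 0\<^sub>v m" using p(1) by (intro eq_vecI) auto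
  with p(2) show False by simp
qed

text \<open>The supremum over the empty set is \<open>- \<infinity>\<close>, so the inf-sup condition excludes a trivial velocity space.\<close>

lemma velocity_dim_pos: "0 < n"
proof (rule ccontr)
  assume "\<not> 0 < n"
  then have vel_0: "vel c x = 0" for c x unfolding vel_def by simp
  have "AE x in lebesgue_on \<Omega>. v x = 0" if v: "v \<in> V" for v
  proof -
    obtain c where "AE x in lebesgue_on \<Omega>. v x = vel c x"
      by (rule V_coefficients[OF v])
    then show ?thesis by (simp add: vel_0)
  qed
  then have empty: "{v \<in> V. \<not> (AE x in lebesgue_on \<Omega>. v x = 0)} = {}" by blast
  have "ereal (\<delta> * l2_norm \<Omega> (pr (0\<^sub>v m))) \<le>
      (SUP v\<in>{v\<in>V. \<not> (AE x in lebesgue_on \<Omega>. v x = 0)}.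
           ereal (b_form \<Omega> v (pr (0\<^sub>v m)) / l2_norm \<Omega> (vgrad \<Omega> v))) + ereal (sqrt (s (pr (0\<^sub>v m)) (pr (0\<^sub>v m))))"
    using infsup pr_Q unfolding inf_sup_def by blast
  from this[unfolded empty] show False by (simp add: bot_ereal_def)
qed

text \<open>\<open>X\<close> bounds every quotient in the supremum once the velocities are replaced
  by coefficient vectors through \<open>V_coefficients\<close>.\<close>

lemma infsup_bound:
  assumes p: "p \<in> carrier_vec m" and X: "0 \<le> X"
    and B: "\<And>c. c \<in> carrier_vec n \<Longrightarrow> B *\<^sub>v c \<bullet>\<^sub>v p \<le> sqrt (energy c) * X"
  shows "\<delta> * l2_norm \<Omega> (pr p) \<le> X + sqrt (s (pr p) (pr p))"
proof -
  have "b_form \<Omega> v (pr p) / l2_norm \<Omega> (vgrad \<Omega> v) \<le> X" if v: "v \<in> V" for v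
  proof -
    obtain c where c: "c \<in> carrier_vec n" "AE x in lebesgue_on \<Omega>. vgrad \<Omega> v x = vgr c x"
      by (rule V_coefficients[OF v])
    have pairv: "(\<lambda>x. vgrad \<Omega> v x $ i $ k) \<in> borel_measurable (lebesgue_on \<Omega>)"
      "(\<lambda>x. vgr c x $ i $ k) \<in> borel_measurable (lebesgue_on \<Omega>)" for i k
      using h10_pairD(2)[OF V_pair[OF v], of i k] vgr_L2[of c i k] by (auto simp: L2_real_iff)
    have "l2_norm \<Omega> (vgrad \<Omega> v) = l2_norm \<Omega> (vgr c)"
      unfolding l2_norm_def l2_inner_def inner_vec_def using c(2)
      by (intro arg_cong[where f=sqrt] integral_cong_AE) (auto intro!: borel_measurable_sum borel_measurable_times pairv)
    then have n: "l2_norm \<Omega> (vgrad \<Omega> v) = sqrt (energy c)"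
      using l2_norm_vgr[of c] by (metis l2_norm_nonneg real_sqrt_unique)
    have "(LINT x|lebesgue_on \<Omega>. pr p x * wdiv \<Omega> v x) = (LINT x|lebesgue_on \<Omega>. vdiv c x * pr p x)"
      unfolding wdiv_def vdiv_eq using c(2) pr_L2[of p]
      by (intro integral_cong_AE)
        (auto intro!: borel_measurable_sum borel_measurable_times pairv simp: L2_real_iff elim!: eventually_mono)
    then have "b_form \<Omega> v (pr p) = B *\<^sub>v c \<bullet>\<^sub>v p"
      by (simp add: b_form_def l2_inner_def B_form'[OF c(1) p])
    \<comment> \<open>For zero energy the quotient is 0 by the convention for division, and
      \<open>0 \<le> X\<close> covers this case.\<close>
    then show ?thesis
      unfolding n using B[OF c(1)] X by (cases "energy c = 0") (auto simp: divide_le_eq mult.commute less_le)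
  qed
  then have "(SUP v\<in>{v\<in>V. \<not> (AE x in lebesgue_on \<Omega>. v x = 0)}.
           ereal (b_form \<Omega> v (pr p) / l2_norm \<Omega> (vgrad \<Omega> v))) \<le> ereal X"
    by (intro SUP_least) auto
  then have "(SUP v\<in>{v\<in>V. \<not> (AE x in lebesgue_on \<Omega>. v x = 0)}.
           ereal (b_form \<Omega> v (pr p) / l2_norm \<Omega> (vgrad \<Omega> v))) + ereal (sqrt (s (pr p) (pr p)))
      \<le> ereal X + ereal (sqrt (s (pr p) (pr p)))"
    by (rule add_right_mono)
  moreover have "ereal (\<delta> * l2_norm \<Omega> (pr p)) \<le>
      (SUP v\<in>{v\<in>V. \<not> (AE x in lebesgue_on \<Omega>. v x = 0)}.
           ereal (b_form \<Omega> v (pr p) / l2_norm \<Omega> (vgrad \<Omega> v))) + ereal (sqrt (s (pr p) (pr p)))"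
    using infsup pr_Q unfolding inf_sup_def by blast
  ultimately have "ereal (\<delta> * l2_norm \<Omega> (pr p)) \<le> ereal X + ereal (sqrt (s (pr p) (pr p)))"
    by (rule order_trans[rotated])
  then show ?thesis by simp
qed

text \<open>The coupling form of c and p equals the \<open>A\<close>-form of c and w, which is
  bounded term by term. The form of \<open>A\<close> at w controls \<nu> times the energy and
  \<gamma> times the squared divergence, so the viscous and grad-div terms keep the factors \<nu>
  and \<gamma>, whereas convection has only the energy at its disposal and pays 1/\<nu>.\<close>

lemma pressure_norm_bound:
  assumes w: "w \<in> carrier_vec n" and p: "p \<in> carrier_vec m"
    and wp: "transpose_mat A *\<^sub>v w = transpose_mat B *\<^sub>v p"
  defines "d \<equiv> (real CARD('d))\<^sup>2"
  shows "\<delta>\<^sup>2 * (l2_norm \<Omega> (pr p))\<^sup>2 \<le>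
    6 * (d\<^sup>2 * \<nu> + conv_const\<^sup>2 / \<nu> + \<gamma>) * (A *\<^sub>v w \<bullet>\<^sub>v w) + 2 * (\<nu> + \<gamma>) * (C *\<^sub>v p \<bullet>\<^sub>v p)"
proof -
  let ?e = "sqrt (energy w)" and ?g = "l2_norm \<Omega> (vdiv w)"
  define X where "X = \<nu> * d * ?e + conv_const * ?e + \<gamma> * ?g"
  have K: "0 \<le> conv_const" by (simp add: conv_const_def)
  have X: "0 \<le> X"
    using par K by (simp add: X_def d_def)
  have "B *\<^sub>v c \<bullet>\<^sub>v p \<le> sqrt (energy c) * X" if c: "c \<in> carrier_vec n" for c
  proof -
    have "B *\<^sub>v c \<bullet>\<^sub>v p = c \<bullet>\<^sub>v (transpose_mat A *\<^sub>v w)"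
      unfolding wp by (rule scalar_prod_mult_transpose[OF mat_carriers(6) c p])
    also have "\<dots> = A *\<^sub>v c \<bullet>\<^sub>v w"
      by (rule scalar_prod_mult_transpose[OF mat_carriers(5) c w, symmetric])
    also have "\<dots> \<le> \<nu> * (d * sqrt (energy c) * ?e) + conv_const * sqrt (energy c) * ?e + \<gamma> * (sqrt (energy c) * ?g)"
      unfolding A_form'[OF c w] d_def
      using par by (intro add_mono mult_left_mono D_bound N_bound G_bound cf c w) auto
    also have "\<dots> = sqrt (energy c) * X" by (simp add: X_def algebra_simps)
    finally show ?thesis .
  qed
  from infsup_bound[OF p X this] have "\<delta> * l2_norm \<Omega> (pr p) \<le> X + sqrt (s (pr p) (pr p))" .
  then have "(\<delta> * l2_norm \<Omega> (pr p))\<^sup>2 \<le> (X + sqrt (s (pr p) (pr p)))\<^sup>2"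
    using par by (intro power_mono) auto
  also have "\<dots> \<le> 2 * X\<^sup>2 + 2 * (sqrt (s (pr p) (pr p)))\<^sup>2"
    using sum_squares_bound[of X "sqrt (s (pr p) (pr p))"] by (simp add: power2_sum)
  also have "(sqrt (s (pr p) (pr p)))\<^sup>2 = (\<nu> + \<gamma>) * (C *\<^sub>v p \<bullet>\<^sub>v p)"
    using C_quadratic[OF p] \<kappa>_pos by simp
  also have "X\<^sup>2 \<le> 3 * (d\<^sup>2 * \<nu> + conv_const\<^sup>2 / \<nu> + \<gamma>) * (A *\<^sub>v w \<bullet>\<^sub>v w)"
  proof -
    \<comment> \<open>Together with the factor 2 from splitting off the stabilization, the three
      summands of \<open>X\<close> give the constant 6.\<close>
    have three: "(x + y + z)\<^sup>2 \<le> 3 * (x\<^sup>2 + y\<^sup>2 + z\<^sup>2)" for x y z :: real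
      using sum_squares_bound[of x y] sum_squares_bound[of x z] sum_squares_bound[of y z]
      by (simp add: power2_eq_square algebra_simps)
    have E: "?e\<^sup>2 = energy w" by simp
    have "X\<^sup>2 \<le> 3 * ((\<nu> * d * ?e)\<^sup>2 + (conv_const * ?e)\<^sup>2 + (\<gamma> * ?g)\<^sup>2)"
      unfolding X_def by (rule three)
    also have "\<dots> = 3 * (d\<^sup>2 * \<nu> * (\<nu> * energy w) + conv_const\<^sup>2 / \<nu> * (\<nu> * energy w) + \<gamma> * (\<gamma> * ?g\<^sup>2))"
      unfolding power_mult_distrib E using par by (simp add: power2_eq_square)
    also have "\<dots> \<le> 3 * (d\<^sup>2 * \<nu> * (A *\<^sub>v w \<bullet>\<^sub>v w) + conv_const\<^sup>2 / \<nu> * (A *\<^sub>v w \<bullet>\<^sub>v w) + \<gamma> * (A *\<^sub>v w \<bullet>\<^sub>v w))"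
      unfolding A_quadratic[OF w] using par
      by (intro mult_left_mono add_mono) auto
    finally show ?thesis by (simp add: algebra_simps)
  qed
  finally show ?thesis by (simp add: power_mult_distrib algebra_simps)
qed

text \<open>The reciprocal of a sum that dominates all requirements of \<open>bound_const_le\<close>
  at once: the coefficients of the velocity and stabilization terms in the pressure estimate, and
  the condition \<open>\<tau> \<le> 1 / 2\<close>. It depends on the dimension, \<open>R\<close>,
  \<open>C0\<close> and \<delta> only.\<close>

definition bound_const :: real where
  "bound_const = 1 / (2 + 12 * (((real CARD('d))\<^sup>2)\<^sup>2 * (C0\<^sup>2 + C0) + conv_const\<^sup>2 + (C0\<^sup>2 + C0)) / \<delta>\<^sup>2
     + 2 * (C0\<^sup>2 + C0) / \<delta>\<^sup>2 + 2 * (C0\<^sup>2 + C0))"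

text \<open>\<open>\<nu> \<le> C0\<close> bounds the square and
  \<open>\<gamma> \<le> C0 / \<nu>\<close> the product; the sum of the two bounds serves all three
  quantities.\<close>

lemma \<nu>\<kappa>_le: "\<nu> * (\<nu> + \<gamma>) \<le> C0\<^sup>2 + C0" "\<nu>\<^sup>2 \<le> C0\<^sup>2 + C0" "\<nu> * \<gamma> \<le> C0\<^sup>2 + C0"
proof -
  have 1: "\<nu>\<^sup>2 \<le> C0\<^sup>2" using par by (intro power_mono) auto
  have 2: "\<nu> * \<gamma> \<le> C0" using par by (simp add: pos_le_divide_eq mult.commute)
  show "\<nu> * (\<nu> + \<gamma>) \<le> C0\<^sup>2 + C0" "\<nu>\<^sup>2 \<le> C0\<^sup>2 + C0" "\<nu> * \<gamma> \<le> C0\<^sup>2 + C0"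
    using 1 2 C0_pos zero_le_power2[of C0] unfolding distrib_left power2_eq_square[of \<nu>] by linarith+
qed

lemma bound_const_pos: "0 < bound_const"
  unfolding bound_const_def using C0_pos
  by (intro divide_pos_pos add_pos_nonneg mult_nonneg_nonneg divide_nonneg_nonneg add_nonneg_nonneg) auto

lemma bound_const_le:
  "bound_const * (12 * (((real CARD('d))\<^sup>2)\<^sup>2 * (C0\<^sup>2 + C0) + conv_const\<^sup>2 + (C0\<^sup>2 + C0)) / \<delta>\<^sup>2) \<le> 1"
  "bound_const * (2 * (C0\<^sup>2 + C0) / \<delta>\<^sup>2 + (C0\<^sup>2 + C0)) \<le> 1"
  "bound_const * (C0\<^sup>2 + C0) \<le> 1 / 2"
proof -
  define L where "L = C0\<^sup>2 + C0"
  define x where "x = 12 * (((real CARD('d))\<^sup>2)\<^sup>2 * L + conv_const\<^sup>2 + L) / \<delta>\<^sup>2"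
  define y where "y = 2 * L / \<delta>\<^sup>2"
  have L: "0 \<le> L" using C0_pos by (simp add: L_def)
  then have nn: "0 \<le> x" "0 \<le> y"
    by (auto simp: x_def y_def intro!: divide_nonneg_nonneg mult_nonneg_nonneg add_nonneg_nonneg)
  define z where "z = 2 + x + y + 2 * L"
  have b: "bound_const = 1 / z"
    unfolding bound_const_def z_def x_def y_def L_def ..
  have "0 < z" "x \<le> z" "y + L \<le> z" "2 * L \<le> z"
    using nn L unfolding z_def by linarith+
  then have "bound_const * x \<le> 1" "bound_const * (y + L) \<le> 1" "bound_const * L \<le> 1 / 2"
    unfolding b by (simp_all add: divide_le_eq)
  then show "bound_const * (12 * (((real CARD('d))\<^sup>2)\<^sup>2 * (C0\<^sup>2 + C0) + conv_const\<^sup>2 + (C0\<^sup>2 + C0)) / \<delta>\<^sup>2) \<le> 1"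
    "bound_const * (2 * (C0\<^sup>2 + C0) / \<delta>\<^sup>2 + (C0\<^sup>2 + C0)) \<le> 1" "bound_const * (C0\<^sup>2 + C0) \<le> 1 / 2"
    unfolding x_def y_def L_def .
qed

definition \<tau> where "\<tau> = bound_const * (\<nu> * (\<nu> + \<gamma>))"

lemma \<tau>_bounds: "0 < \<tau>" "\<tau> \<le> 1 / 2"
proof -
  show "0 < \<tau>" unfolding \<tau>_def using bound_const_pos par \<kappa>_pos by simp
  have "\<tau> \<le> bound_const * (C0\<^sup>2 + C0)"
    unfolding \<tau>_def using bound_const_pos \<nu>\<kappa>_le by (intro mult_left_mono) auto
  then show "\<tau> \<le> 1 / 2" using bound_const_le(3) by linarith
qed

text \<open>Multiplying \<open>pressure_norm_bound\<close> by \<nu> removes the 1/\<nu> of the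
  convection term, and the remaining coefficients are bounded through \<open>C0\<close>.\<close>

lemma pressure_control':
  assumes w: "w \<in> carrier_vec n" and p: "p \<in> carrier_vec m"
    and wp: "transpose_mat A *\<^sub>v w = transpose_mat B *\<^sub>v p"
  shows "\<tau> * (T *\<^sub>v p \<bullet>\<^sub>v p) \<le> A *\<^sub>v w \<bullet>\<^sub>v w / 2 + C *\<^sub>v p \<bullet>\<^sub>v p"
proof -
  let ?d = "((real CARD('d))\<^sup>2)\<^sup>2" and ?a = "A *\<^sub>v w \<bullet>\<^sub>v w" and ?c = "C *\<^sub>v p \<bullet>\<^sub>v p" and ?L = "C0\<^sup>2 + C0"
  have a: "0 \<le> ?a" unfolding A_quadratic[OF w] using par by simp
  have c: "0 \<le> ?c" by (rule C_quadratic[OF p])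
  have "\<nu> * (\<delta>\<^sup>2 * (l2_norm \<Omega> (pr p))\<^sup>2) \<le>
      \<nu> * (6 * (?d * \<nu> + conv_const\<^sup>2 / \<nu> + \<gamma>) * ?a + 2 * (\<nu> + \<gamma>) * ?c)"
    using pressure_norm_bound[OF w p wp] par by (intro mult_left_mono) auto
  also have "\<dots> = 6 * (?d * \<nu>\<^sup>2 + conv_const\<^sup>2 + \<nu> * \<gamma>) * ?a + 2 * (\<nu> * (\<nu> + \<gamma>)) * ?c"
    using par by (simp add: field_simps power2_eq_square)
  also have "\<dots> \<le> 6 * (?d * ?L + conv_const\<^sup>2 + ?L) * ?a + 2 * ?L * ?c"
    using \<nu>\<kappa>_le a c by (intro add_mono mult_right_mono mult_left_mono) auto
  finally have 1: "\<nu> * (l2_norm \<Omega> (pr p))\<^sup>2 \<le> (6 * (?d * ?L + conv_const\<^sup>2 + ?L) * ?a + 2 * ?L * ?c) / \<delta>\<^sup>2"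
    using par by (simp add: pos_le_divide_eq mult_ac)
  \<comment> \<open>The factor \<nu> + \<gamma> in \<open>\<tau>\<close> cancels the scaling of the
    mass matrix in \<open>T\<close>.\<close>
  have "\<tau> * (T *\<^sub>v p \<bullet>\<^sub>v p) = bound_const * (\<nu> * (l2_norm \<Omega> (pr p))\<^sup>2 + \<nu> * (\<nu> + \<gamma>) * ?c)"
    unfolding T_quadratic[OF p] \<tau>_def using \<kappa>_pos by (simp add: field_simps)
  also have "\<dots> \<le> bound_const * ((6 * (?d * ?L + conv_const\<^sup>2 + ?L) * ?a + 2 * ?L * ?c) / \<delta>\<^sup>2 + ?L * ?c)"
    using bound_const_pos 1 \<nu>\<kappa>_le(1) c by (intro mult_left_mono add_mono mult_right_mono) auto
  also have "\<dots> = bound_const * (12 * (?d * ?L + conv_const\<^sup>2 + ?L) / \<delta>\<^sup>2) * (?a / 2) + bound_const * (2 * ?L / \<delta>\<^sup>2 + ?L) * ?c"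
    using par by (simp add: field_simps)
  also have "\<dots> \<le> 1 * (?a / 2) + 1 * ?c"
    using a c by (intro add_mono mult_right_mono bound_const_le) auto
  finally show ?thesis by simp
qed

sublocale saddle_point n m A B C T \<tau>
proof
  show "0 < A *\<^sub>v v \<bullet>\<^sub>v v" if "v \<in> carrier_vec n" "v \<noteq> 0\<^sub>v n" for v
    unfolding A_quadratic[OF that(1)] using energy_pos[OF that] par by (intro add_pos_nonneg) auto
  have s_comm: "s (\<phi> i) (\<phi> j) = s (\<phi> j) (\<phi> i)" if "i < m" "j < m" for i j
    by (rule s_sym[OF \<phi>_L2[OF that(1)] \<phi>_L2[OF that(2)]])
  show "transpose_mat C = C"
    by (rule eq_matI) (auto simp: C_def C_mat_def s_comm)
  show "transpose_mat T = T"
    unfolding T_def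
    by (rule eq_matI) (auto simp: C_def C_mat_def M_mat_def l2_inner_def mult.commute s_comm)
  show "0 \<le> C *\<^sub>v p \<bullet>\<^sub>v p" if "p \<in> carrier_vec m" for p
    by (rule C_quadratic[OF that])
  show "0 < T *\<^sub>v p \<bullet>\<^sub>v p" if "p \<in> carrier_vec m" "p \<noteq> 0\<^sub>v m" for p
    unfolding T_quadratic[OF that(1)] using pr_pos[OF that] C_quadratic[OF that(1)] \<kappa>_pos
    by (intro add_pos_nonneg) auto
  show "2 * (B *\<^sub>v w \<bullet>\<^sub>v p) \<le> A *\<^sub>v w \<bullet>\<^sub>v w + (T *\<^sub>v p \<bullet>\<^sub>v p - C *\<^sub>v p \<bullet>\<^sub>v p)"
    if w: "w \<in> carrier_vec n" and p: "p \<in> carrier_vec m" for w p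
  proof -
    let ?x = "l2_norm \<Omega> (vdiv w)" and ?y = "l2_norm \<Omega> (pr p)" and ?k = "\<nu> + \<gamma>"
    have "2 * (B *\<^sub>v w \<bullet>\<^sub>v p) \<le> 2 * (?x * ?y)"
      unfolding B_form'[OF w p] using l2_inner_Cauchy_Schwarz[OF vdiv_L2[of w] pr_L2[of p]] by linarith
    \<comment> \<open>Young's inequality with weight \<nu> + \<gamma>, which makes the pressure term
      exactly the mass part of \<open>T\<close>.\<close>
    also have "\<dots> \<le> ?k * ?x\<^sup>2 + ?y\<^sup>2 / ?k"
    proof -
      have "0 \<le> (?k * ?x - ?y)\<^sup>2 / ?k" using \<kappa>_pos by (intro divide_nonneg_pos) auto
      also have "\<dots> = ?k * ?x\<^sup>2 + ?y\<^sup>2 / ?k - 2 * (?x * ?y)"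
        using \<kappa>_pos by (simp add: power2_eq_square field_simps)
      finally show ?thesis by simp
    qed
    \<comment> \<open>The share \<nu> of the weight is paid by the gradient, with constant 1 by
      \<open>div_le_energy\<close>, and the share \<gamma> by the grad-div term.\<close>
    also have "?k * ?x\<^sup>2 \<le> A *\<^sub>v w \<bullet>\<^sub>v w"
      unfolding A_quadratic[OF w] using div_le_energy[of w] par
      by (simp add: distrib_right mult_left_mono)
    finally show ?thesis unfolding T_quadratic[OF p] by simp
  qed
qed (rule mat_carriers \<tau>_bounds pressure_control'; assumption)+

end

context stabilized_discretization
begin

text \<open>\<open>saddle_point.R\<close> is written in full because \<open>R\<close> is the radius
  of the domain in this context.\<close>

lemma preconditioner_bounds:
  "invertible_mat A \<and> invertible_mat S \<and> invertible_mat T \<and> invertible_mat E \<and> invertible_mat K \<and> invertible_mat P"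
  "mu W (K * inv_mat P) =
     (INF (v, q)\<in>{(v, q). v \<in> carrier_vec n \<and> q \<in> carrier_vec m \<and> (v, q) \<noteq> (0\<^sub>v n, 0\<^sub>v m)}.
       ip W (L *\<^sub>v (v @\<^sub>v q)) (v @\<^sub>v q) / ip W (v @\<^sub>v q) (v @\<^sub>v q))"
  "\<tau> \<le> mu W (K * inv_mat P)"
  "mu W (P * inv_mat K) =
     (INF (v, q)\<in>{(v, q). v \<in> carrier_vec n \<and> q \<in> carrier_vec m \<and> (v, q) \<noteq> (0\<^sub>v n, 0\<^sub>v m)}.
       ip W (saddle_point.R n m A B C T *\<^sub>v (v @\<^sub>v q)) (v @\<^sub>v q) / ip W (v @\<^sub>v q) (v @\<^sub>v q))"
  "1 / 2 \<le> mu W (P * inv_mat K)"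
  unfolding K_inv_P P_inv_K
  using inv_A(1) inv_S(1) inv_T(1) inv_E(1) inv_K(1) inv_P(1) mu_eq_pairs carrier_matD[OF L_carrier]
    carrier_matD[OF R_carrier] mu_ge[OF _ velocity_dim_pos L_bound] mu_ge[OF _ velocity_dim_pos R_bound]
  by auto

end

text \<open>Constants are square integrable on a bounded domain, so pressures are integrable and the
  mean value is linear; the local polynomial condition is \<open>piecewise_sum\<close>.\<close>

lemma Q_space_span:
  fixes \<Omega> :: "(real^'d) set" and m :: nat
  assumes \<Omega>: "open \<Omega>" "bounded \<Omega>" and T: "tessellation \<Omega> \<T>"
    and \<phi>: "\<And>l. l < m \<Longrightarrow> \<phi> l \<in> Q_space \<Omega> mapped k \<T>"
  shows "(\<lambda>x. \<Sum>l<m. c l * \<phi> l x) \<in> Q_space \<Omega> mapped k \<T>"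
proof -
  have L2: "\<phi> l \<in> L2 \<Omega>" and mean: "(LINT x|lebesgue_on \<Omega>. \<phi> l x) = 0" if "l < m" for l
    using \<phi>[OF that] by (auto simp: Q_space_def L2_mean_zero_def)
  have int: "integrable (lebesgue_on \<Omega>) (\<phi> l)" if "l < m" for l
    using L2_mult_integrable[OF L2[OF that] const_one_L2[OF \<Omega>]] by simp
  have "(LINT x|lebesgue_on \<Omega>. (\<Sum>l<m. c l * \<phi> l x)) = (\<Sum>l<m. LINT x|lebesgue_on \<Omega>. c l * \<phi> l x)"
    using int by (intro Bochner_Integration.integral_sum) auto
  also have "\<dots> = 0" using mean by simp
  finally have "(\<lambda>x. \<Sum>l<m. c l * \<phi> l x) \<in> L2_mean_zero \<Omega>"
    using L2 by (auto simp: L2_mean_zero_def intro!: L2_sum L2_cmult)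
  moreover have "piecewise mapped k \<T> (\<lambda>x. \<Sum>l<m. c l * \<phi> l x)"
    using \<phi> by (intro piecewise_sum[OF T]) (auto simp: Q_space_def)
  ultimately show ?thesis by (simp add: Q_space_def)
qed

theorem theorem4p3:
  fixes \<Omega> :: "(real^'d) set" and C\<^sub>0 \<delta>\<^sub>0 :: real
  assumes "CARD('d) = 2 \<or> CARD('d) = 3"
    and "polyhedral_domain \<Omega>"
    and "0 < \<delta>\<^sub>0"
  shows
    "\<exists>c>0. \<exists>c'>0. \<forall>(H :: real set) \<T> mapped (k :: nat) s \<nu> \<gamma> a.
       mesh_family \<Omega> H \<T> \<and>
       (\<forall>h\<in>H. psd_form \<Omega> (s h) \<and>
          inf_sup \<Omega> (V_space \<Omega> mapped k (\<T> h)) (Q_space \<Omega> mapped k (\<T> h)) (s h) \<delta>\<^sub>0) \<and>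
       0 < \<nu> \<and> 0 \<le> \<gamma> \<and> \<nu> \<le> C\<^sub>0 \<and> \<gamma> \<le> C\<^sub>0 / \<nu> \<and>
       convection_field \<Omega> a \<longrightarrow>
       (\<forall>h\<in>H. \<forall>n \<psi> m \<phi>.
         is_basis \<Omega> (V_space \<Omega> mapped k (\<T> h)) n \<psi> \<and>
         is_basis \<Omega> (Q_space \<Omega> mapped k (\<T> h)) m \<phi> \<longrightarrow>
         (let A = \<nu> \<cdot>\<^sub>m D_mat \<Omega> n \<psi> + N_mat \<Omega> a n \<psi> + \<gamma> \<cdot>\<^sub>m G_mat \<Omega> n \<psi>;
              As = (1/2) \<cdot>\<^sub>m (A + transpose_mat A);
              B = B_mat \<Omega> n \<psi> m \<phi>;
              C = C_mat \<nu> \<gamma> (s h) m \<phi>;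
              K = four_block_mat A (transpose_mat B) B (- C);
              S = B * inv_mat A * transpose_mat B + C;
              S' = (1 / (\<nu> + \<gamma>)) \<cdot>\<^sub>m M_mat \<Omega> m \<phi> + C;
              W = inv_mat (four_block_mat As (0\<^sub>m n m) (0\<^sub>m m n) S');
              P = four_block_mat A (transpose_mat B) (0\<^sub>m m n) (- S');
              Z = {(v, q). v \<in> carrier_vec n \<and> q \<in> carrier_vec m \<and> (v, q) \<noteq> (0\<^sub>v n, 0\<^sub>v m)};
              L = four_block_mat (1\<^sub>m n) (0\<^sub>m n m) (B * inv_mat A) (S * inv_mat S');
              R = four_block_mat (1\<^sub>m n) (0\<^sub>m n m)
                    (- (S' * inv_mat S * B * inv_mat A)) (S' * inv_mat S)
          in
            (\<comment> \<open>all inverses that occur exist\<close>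
             invertible_mat A \<and> invertible_mat S \<and> invertible_mat S' \<and>
             invertible_mat (four_block_mat As (0\<^sub>m n m) (0\<^sub>m m n) S') \<and>
             invertible_mat K \<and> invertible_mat P) \<and>
            (mu W (K * inv_mat P) =
               (INF (v, q)\<in>Z. ip W (L *\<^sub>v (v @\<^sub>v q)) (v @\<^sub>v q) / ip W (v @\<^sub>v q) (v @\<^sub>v q)) \<and>
             mu W (K * inv_mat P) \<ge> c * (\<nu> * (\<nu> + \<gamma>))) \<and>
            (mu W (P * inv_mat K) =
               (INF (v, q)\<in>Z. ip W (R *\<^sub>v (v @\<^sub>v q)) (v @\<^sub>v q) / ip W (v @\<^sub>v q) (v @\<^sub>v q)) \<and>
             mu W (P * inv_mat K) \<ge> 1/2) \<and>
            (\<comment> \<open>the contraction factor is positive, and the GMRES bound holds\<close>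
             c' * (\<nu> * (\<nu> + \<gamma>)) < 1 \<and>
             (\<forall>b \<in> carrier_vec (n + m). \<forall>x0 \<in> carrier_vec (n + m). \<forall>r.
               gmres_residuals W K P b x0 r \<longrightarrow>
               (\<forall>j. nrm W (r j) \<le>
                  (1 - c' * (\<nu> * (\<nu> + \<gamma>))) powr (real j / 2) * nrm W (r 0))))))"
proof -
  have \<Omega>: "open \<Omega>" "bounded \<Omega>"
    using assms(2) by (auto simp: polyhedral_domain_def)
  obtain R where R: "\<And>x. x \<in> \<Omega> \<Longrightarrow> norm x \<le> R"
    using \<Omega>(2) by (auto simp: bounded_iff)
  \<comment> \<open>The value of \<open>bound_const\<close>, written out since it must be fixed
    before the mesh and the bases that the locale takes as parameters. If \<open>C\<^sub>0\<close>
    is not positive, no \<nu> is admissible and any positive value serves.\<close>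
  define c where "c = (if 0 < C\<^sub>0 then 1 / (2 + 12 * (((real CARD('d))\<^sup>2)\<^sup>2 * (C\<^sub>0\<^sup>2 + C\<^sub>0) +
    ((real CARD('d))\<^sup>2 * (2 * \<bar>R\<bar>))\<^sup>2 + (C\<^sub>0\<^sup>2 + C\<^sub>0)) / \<delta>\<^sub>0\<^sup>2
     + 2 * (C\<^sub>0\<^sup>2 + C\<^sub>0) / \<delta>\<^sub>0\<^sup>2 + 2 * (C\<^sub>0\<^sup>2 + C\<^sub>0)) else 1)"
  have c: "0 < c"
    unfolding c_def
    by (auto intro!: divide_pos_pos add_pos_nonneg mult_nonneg_nonneg divide_nonneg_nonneg add_nonneg_nonneg)
  show ?thesis
  \<comment> \<open>One GMRES step multiplies the squared norm by at most
    \<open>1 - \<tau> / 2\<close>, hence the second constant is half of the first.\<close>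
  proof (rule exI[of _ c], intro conjI, rule c, rule exI[of _ "c / 2"], intro conjI allI impI ballI, goal_cases)
    case 1
    show ?case using c by simp
  next
    case (2 H \<T> mapped k s \<nu> \<gamma> a h n \<psi> m \<phi>)
    let ?V = "V_space \<Omega> mapped k (\<T> h)" and ?Q = "Q_space \<Omega> mapped k (\<T> h)"
    have C0: "0 < C\<^sub>0" using 2(1) by linarith
    have T: "tessellation \<Omega> (\<T> h)"
      using 2(1,2) by (auto simp: mesh_family_def)
    have \<phi>: "\<phi> l \<in> ?Q" if "l < m" for l
      using 2(3) that by (auto simp: is_basis_def)
    interpret D: stabilized_discretization \<Omega> R n \<psi> ?V a \<nu> \<gamma> \<delta>\<^sub>0 C\<^sub>0 ?Q m \<phi> "s h"
    proof
      show "is_basis \<Omega> ?V n \<psi>" "is_basis \<Omega> ?Q m \<phi>" using 2(3) by auto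
      show "(\<lambda>x. v x $ i) \<in> H10 \<Omega>" if "v \<in> ?V" for v i using that by (simp add: V_space_def)
      show "?Q \<subseteq> L2 \<Omega>" by (auto simp: Q_space_def L2_mean_zero_def)
      show "(\<lambda>x. \<Sum>l<m. c l * \<phi> l x) \<in> ?Q" for c
        by (rule Q_space_span[OF \<Omega> T \<phi>])
    qed (use 2(1,2) \<Omega> R assms(3) in auto)
    have \<tau>: "D.\<tau> = c * (\<nu> * (\<nu> + \<gamma>))"
      using C0 by (simp add: D.\<tau>_def D.bound_const_def D.conv_const_def c_def)
    have \<tau>2: "D.\<tau> / 2 = c / 2 * (\<nu> * (\<nu> + \<gamma>))"
      by (simp add: \<tau>)
    have lt: "c / 2 * (\<nu> * (\<nu> + \<gamma>)) < 1"
      using D.\<tau>_bounds \<tau>2 by linarith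
    have gmres: "\<forall>b\<in>carrier_vec (n + m). \<forall>x0\<in>carrier_vec (n + m). \<forall>r.
        gmres_residuals D.W D.K D.P b x0 r \<longrightarrow>
        (\<forall>j. nrm D.W (r j) \<le> (1 - c / 2 * (\<nu> * (\<nu> + \<gamma>))) powr (real j / 2) * nrm D.W (r 0))"
      using D.gmres_bound[unfolded \<tau>2] by blast
    note all = conjI[OF D.preconditioner_bounds(1) conjI[OF conjI[OF D.preconditioner_bounds(2,3)]
      conjI[OF conjI[OF D.preconditioner_bounds(4,5)] conjI[OF lt gmres]]]]
    show ?case
      using all[unfolded \<tau> D.L_def D.R_def D.P_def D.K_def, unfolded D.W_def, unfolded D.E_def D.S_def,
        unfolded D.As_def, unfolded D.T_def, unfolded D.A_def D.B_def D.C_def]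
      unfolding Let_def .
  qed
qed

end
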